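(* Let $k$ be an $F$-finite field of prime characteristic $p$, let $G$ be a simple connected graph on the vertex set $[d]=\{1,\dots,d\}$, let $R=k[x_1,\dots,x_d,y_1,\dots,y_d]$, and let $J_G\subseteq R$ be the binomial edge ideal of $G$. Suppose that $G$ is one of the following graphs: 1) a complete multipartite graph; 2) a caterpillar graph; 3) a graph such that $|\operatorname{Ass}(J_G)|\le 2$; 4) a traceable graph such that $J_G$ is unmixed. Then $J_G$ is symbolic $F$-split.
   Context: A graph is simple if it is undirected, without loops and without multiple edges. For a simple graph $G$ with vertex set $[d]$ and edge set $E$, the binomial edge ideal is $J_G=(x_iy_j-x_jy_i \mid \{i,j\}\in E)\subseteq R$; it is a radical ideal. $\operatorname{Ass}(J)$ denotes the set of associated primes of $R/J$. $J_G$ is unmixed if all its associated primes have the same height. A field $k$ of characteristic $p$ is $F$-finite if $k$ is a finite extension of $k^p$. Multipartite: the vertex set has a partition into nonempty subsets $V_1,\dots,V_l$ such that no two vertices in the same $V_i$ are adjacent; complete multipartite: moreover every $u\in V_i$ and $v\in V_j$ with $i\ne j$ are adjacent. Caterpillar graph: a graph $G$ having an induced path $P$ on vertices $v_1,\dots,v_l$ (with edges $\{v_i,v_{i+1}\}$, $i=1,\dots,l-1$) such that every vertex $u$ of $G$ not on $P$ has exactly one neighbour in $G$, and this neighbour lies in $V(P)\setminus\{v_1,v_l\}$. Traceable: $G$ contains a path passing through every vertex exactly once (a Hamiltonian path). Symbolic powers: for a radical ideal $I$ in a Noetherian ring $R$ with minimal primes $\mathfrak q_1,\dots,\mathfrak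 q_m$, $I^{(n)}=\bigcap_{i=1}^m (\mathfrak q_i^nR_{\mathfrak q_i}\cap R)$ for $n\ge 1$, and $I^{(0)}=R$. $F$-split filtration: a sequence of ideals $\{I_n\}_{n\ge 0}$ in a reduced ring $R$ of characteristic $p$ such that (i) $I_0=R$; (ii) $I_{n+1}\subseteq I_n$ for all $n\ge0$; (iii) $I_nI_m\subseteq I_{n+m}$ for all $n,m\ge0$; (iv) there is an $R$-linear map $\phi:R^{1/p}\to R$ which is a splitting of the inclusion $R\subseteq R^{1/p}$ (i.e. $\phi|_R=\mathrm{id}_R$) such that $\phi((I_{np+1})^{1/p})\subseteq I_{n+1}$ for all $n\ge 0$. An ideal $I$ is symbolic $F$-split if $\{I^{(n)}\}_{n\ge0}$ is an $F$-split filtration. *)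

theory Defs
  imports
    "HOL-Algebra.Algebra"
    "HOL-Algebra.Algebraic_Closure_Type"
    "HOL-Library.Poly_Mapping"
    "HOL-Library.Product_Lexorder"
    "HOL-Library.Extended_Nat"
    "HOL-Library.Disjoint_Sets"
    "Graph_Theory.Graph_Theory"
begin

section \<open>Simple graphs\<close>

text \<open>
  A simple graph is a value satisfying \<open>pair_graph\<close>: a finite symmetric loop-free set of
  ordered pairs of vertices.
\<close>

definition complete_multipartite :: "'v pair_pre_digraph \<Rightarrow> bool" where
  "complete_multipartite G \<longleftrightarrow>
     (\<exists>\<V>. partition_on (pverts G) \<V> \<and>
        (\<forall>A\<in>\<V>. \<forall>u\<in>A. \<forall>v\<in>A. (u, v) \<notin> parcs G) \<and>
        (\<forall>A\<in>\<V>. \<forall>B\<in>\<V>. A \<noteq> B \<longrightarrow> (\<forall>u\<in>A. \<forall>v\<in>B. (u, v) \<in> parcs G)))"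

definition caterpillar :: "'v pair_pre_digraph \<Rightarrow> bool" where
  "caterpillar G \<longleftrightarrow>
     (\<exists>P. vpath P (with_proj G) \<and>
        (\<forall>i<length P. \<forall>j<length P.
           (P ! i, P ! j) \<in> parcs G \<longleftrightarrow> j = Suc i \<or> i = Suc j) \<and>
        (\<forall>u \<in> pverts G - set P.
           \<exists>v \<in> set P - {hd P, last P}. {w. (u, w) \<in> parcs G} = {v}))"

definition traceable :: "'v pair_pre_digraph \<Rightarrow> bool" where
  "traceable G \<longleftrightarrow> (\<exists>P. vpath P (with_proj G) \<and> set P = pverts G)"


section \<open>Associated primes, height, minimal primes\<close>

text \<open>
  The annihilator of the class of \<open>r\<close> in \<open>R/J\<close> consists of the \<open>a\<close> with \<open>a r \<in> J\<close>.
\<close>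

definition assoc_primes :: "('a, 'b) ring_scheme \<Rightarrow> 'a set \<Rightarrow> 'a set set" where
  "assoc_primes R J =
     {P. primeideal P R \<and> (\<exists>r \<in> carrier R. P = {a \<in> carrier R. a \<otimes>\<^bsub>R\<^esub> r \<in> J})}"

definition prime_chain :: "('a, 'b) ring_scheme \<Rightarrow> 'a set \<Rightarrow> nat \<Rightarrow> (nat \<Rightarrow> 'a set) \<Rightarrow> bool" where
  "prime_chain R P n c \<longleftrightarrow>
     (\<forall>i\<le>n. primeideal (c i) R) \<and> (\<forall>i<n. c i \<subset> c (Suc i)) \<and> c n = P"

definition prime_height :: "('a, 'b) ring_scheme \<Rightarrow> 'a set \<Rightarrow> enat" where
  "prime_height R P = (SUP n \<in> {n. \<exists>c. prime_chain R P n c}. enat n)"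

definition unmixed :: "('a, 'b) ring_scheme \<Rightarrow> 'a set \<Rightarrow> bool" where
  "unmixed R J \<longleftrightarrow>
     (\<forall>P \<in> assoc_primes R J. \<forall>Q \<in> assoc_primes R J. prime_height R P = prime_height R Q)"

definition minimal_primes :: "('a, 'b) ring_scheme \<Rightarrow> 'a set \<Rightarrow> 'a set set" where
  "minimal_primes R I =
     {P. primeideal P R \<and> I \<subseteq> P \<and> (\<forall>Q. primeideal Q R \<longrightarrow> I \<subseteq> Q \<longrightarrow> Q \<subseteq> P \<longrightarrow> Q = P)}"


section \<open>Symbolic powers\<close>

text \<open>
  From here on \<open>R\<close> is an integral domain given by a type \<open>'a\<close>, and its localizations are realised
  as subrings of the field of fractions \<open>'a fract\<close>.
\<close>

definition localization :: "'a::idom set \<Rightarrow> 'a fract ring" where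
  "localization \<qq> = ring_of_type_algebra\<lparr>carrier := {Fraction_Field.Fract a s |a s. s \<notin> \<qq>}\<rparr>"

text \<open>The ideal \<open>\<qq>\<^sup>n R\<^sub>\<qq> \<inter> R\<close>, where \<open>\<qq>\<^sup>n\<close> is the power in the monoid of ideals of \<open>R\<close>.\<close>

definition local_power :: "'a::idom set \<Rightarrow> nat \<Rightarrow> 'a set" where
  "local_power \<qq> n =
     {r. to_fract r \<in>
        Idl\<^bsub>localization \<qq>\<^esub> (to_fract ` (\<qq> [^]\<^bsub>ideals_set ring_of_type_algebra\<^esub> n))}"

definition symbolic_power :: "'a::idom set \<Rightarrow> nat \<Rightarrow> 'a set" where
  "symbolic_power I n =
     (if n = 0 then UNIV else (\<Inter>\<qq> \<in> minimal_primes ring_of_type_algebra I. local_power \<qq> n))"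


section \<open>F-split filtrations\<close>

text \<open>
  For a domain \<open>R\<close> of characteristic \<open>p\<close>, the ring \<open>R\<^sup>1\<^sup>/\<^sup>p\<close> is the subring of an algebraic closure
  of the field of fractions consisting of the \<open>p\<close>-th roots of elements of \<open>R\<close>.
  For a subset \<open>S\<close> of \<open>R\<close>, \<open>pth_roots p S\<close> is \<open>S\<^sup>1\<^sup>/\<^sup>p\<close>.
\<close>

definition closure_emb :: "'a::idom \<Rightarrow> 'a fract alg_closure" where
  "closure_emb r = to_ac (to_fract r)"

definition pth_roots :: "nat \<Rightarrow> 'a::idom set \<Rightarrow> 'a fract alg_closure set" where
  "pth_roots p S = {z. z ^ p \<in> closure_emb ` S}"

definition pth_root_splitting :: "nat \<Rightarrow> ('a::idom fract alg_closure \<Rightarrow> 'a) \<Rightarrow> bool" where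
  "pth_root_splitting p \<phi> \<longleftrightarrow>
     (\<forall>z \<in> pth_roots p UNIV. \<forall>w \<in> pth_roots p UNIV. \<phi> (z + w) = \<phi> z + \<phi> w) \<and>
     (\<forall>r. \<forall>z \<in> pth_roots p UNIV. \<phi> (closure_emb r * z) = r * \<phi> z) \<and>
     (\<forall>r. \<phi> (closure_emb r) = r)"

definition F_split_filtration :: "nat \<Rightarrow> (nat \<Rightarrow> 'a::idom set) \<Rightarrow> bool" where
  "F_split_filtration p I \<longleftrightarrow>
     (\<forall>n. ideal (I n) ring_of_type_algebra) \<and>
     I 0 = UNIV \<and>
     (\<forall>n. I (n + 1) \<subseteq> I n) \<and>
     (\<forall>n m. I n \<cdot>\<^bsub>ring_of_type_algebra\<^esub> I m \<subseteq> I (n + m)) \<and>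
     (\<exists>\<phi>. pth_root_splitting p \<phi> \<and> (\<forall>n. \<phi> ` pth_roots p (I (n * p + 1)) \<subseteq> I (n + 1)))"

definition symbolic_F_split :: "nat \<Rightarrow> 'a::idom set \<Rightarrow> bool" where
  "symbolic_F_split p I \<longleftrightarrow> F_split_filtration p (symbolic_power I)"

definition F_finite :: "'k::field itself \<Rightarrow> bool" where
  "F_finite _ \<longleftrightarrow>
     ring.finite_dimension (ring_of_type_algebra :: 'k ring) (range (\<lambda>x. x ^ CHAR('k))) UNIV"


section \<open>Binomial edge ideals\<close>

text \<open>
  The polynomial ring over \<open>'k\<close> in the variables \<open>x\<^sub>i = (False, i)\<close> and \<open>y\<^sub>i = (True, i)\<close>.
  The index type \<open>'d\<close> (finite and linearly ordered) plays the role of \<open>{1, \<dots>, d}\<close>; the order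
  on the variables is used only for the integral domain instance of the polynomial type.
\<close>

type_synonym ('d, 'k) xy_poly = "((bool \<times> 'd) \<Rightarrow>\<^sub>0 nat) \<Rightarrow>\<^sub>0 'k"

definition x_var :: "'d \<Rightarrow> ('d, 'k::field) xy_poly" where
  "x_var i = Poly_Mapping.single (Poly_Mapping.single (False, i) 1) 1"

definition y_var :: "'d \<Rightarrow> ('d, 'k::field) xy_poly" where
  "y_var i = Poly_Mapping.single (Poly_Mapping.single (True, i) 1) 1"

definition binomial_edge_ideal ::
  "'k::field itself \<Rightarrow> 'd pair_pre_digraph \<Rightarrow> ('d, 'k) xy_poly set" where
  "binomial_edge_ideal _ G =
     Idl\<^bsub>ring_of_type_algebra\<^esub>
       {x_var i * y_var j - x_var j * y_var i |i j. (i, j) \<in> parcs G}"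

end

theory Submission
  imports Defs
begin

text \<open>
  For a minimal prime \<open>Q\<close> of the binomial edge ideal \<open>J\<close> let \<open>S\<close> be the set of vertices \<open>i\<close> with
  \<open>x\<^sub>i, y\<^sub>i \<in> Q\<close>. Then \<open>Q\<close> is generated by these variables and the minors
  \<open>[i, j] = x\<^sub>i y\<^sub>j - x\<^sub>j y\<^sub>i\<close> with \<open>i, j\<close> in the same component of \<open>G - S\<close>, and locally at \<open>Q\<close> it has
  \<open>h(S) = 2 |S| + |- S| - c(S)\<close> generators, where \<open>c(S)\<close> is the number of components. If a polynomial \<open>f\<close> lies
  in \<open>Q\<^sup>h\<close> with \<open>h = h(S)\<close> for every such \<open>Q\<close>, and its leading monomial is the product of all
  variables, then the trace map of Frobenius precomposed with \<open>f\<^sup>p\<^sup>-\<^sup>1\<close> is a splitting compatible with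
  the symbolic powers. We take \<open>f = y\<^sub>v [v, v'] [v', v''] \<dots> x\<^sub>w\<close> for an ordering \<open>v, v', \<dots>, w\<close> of
  all vertices. It lies in \<open>Q\<^sup>h\<close> if every component of \<open>G - S\<close> is an interval of the ordering. Such orderings
  exist in the first three cases, since each vertex of \<open>S\<close> has neighbours in two different
  components of \<open>G - S\<close>. For a traceable graph the ordering is a Hamiltonian path, so that
  \<open>f \<in> J\<^sup>d\<^sup>-\<^sup>1\<close>, and unmixedness gives \<open>h(S) \<le> d - 1\<close> since the prime for \<open>S = {}\<close>
  has height \<open>d - 1\<close>.
\<close>

section \<open>Ideals and symbolic powers\<close>

text \<open>The obstacle is that one polynomial has to serve all minimal primes at once. It has
  degree 2d, so that its (p-1)-st power can contain the monomial with all exponents p - 1, the only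
  one that the trace sends to 1; yet it must vanish to order h(S) at every prime. Hence a single
  ordering has to suit all cut sets. Which sets S occur is never determined: the necessary condition
  that no vertex can be taken out of S is enough. That the candidate primes are prime follows from
  an explicit monomial parametrisation and a straightening argument. Heights are only estimated:
  explicit chains bound them from below for every S, and for S = {} the bound from above comes from
  prolonging a chain up to the ideal of all variables and counting against the dimension 2d. This
  dimension bound is itself proved by counting monomials.\<close>

definition is_ideal :: "'a::comm_ring_1 set \<Rightarrow> bool" where
  "is_ideal I \<longleftrightarrow> 0 \<in> I \<and> (\<forall>a\<in>I. \<forall>b\<in>I. a + b \<in> I) \<and> (\<forall>r. \<forall>a\<in>I. r * a \<in> I)"

definition is_prime :: "'a::comm_ring_1 set \<Rightarrow> bool" where
  "is_prime P \<longleftrightarrow> is_ideal P \<and> 1 \<notin> P \<and> (\<forall>a b. a * b \<in> P \<longrightarrow> a \<in> P \<or> b \<in> P)"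

lemma is_idealI:
  "0 \<in> I \<Longrightarrow> (\<And>a b. a \<in> I \<Longrightarrow> b \<in> I \<Longrightarrow> a + b \<in> I) \<Longrightarrow> (\<And>r a. a \<in> I \<Longrightarrow> r * a \<in> I) \<Longrightarrow> is_ideal I"
  by (auto simp: is_ideal_def)

lemma is_ideal_0: "is_ideal I \<Longrightarrow> 0 \<in> I"
  and is_ideal_add: "is_ideal I \<Longrightarrow> a \<in> I \<Longrightarrow> b \<in> I \<Longrightarrow> a + b \<in> I"
  and is_ideal_mult: "is_ideal I \<Longrightarrow> a \<in> I \<Longrightarrow> r * a \<in> I"
  by (auto simp: is_ideal_def)

lemma is_ideal_mult': "is_ideal I \<Longrightarrow> a \<in> I \<Longrightarrow> a * r \<in> I"
  by (metis is_ideal_mult mult.commute)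

lemma is_ideal_uminus: "is_ideal I \<Longrightarrow> a \<in> I \<Longrightarrow> - a \<in> I"
  using is_ideal_mult[of I a "-1"] by simp

lemma is_ideal_diff: "is_ideal I \<Longrightarrow> a \<in> I \<Longrightarrow> b \<in> I \<Longrightarrow> a - b \<in> I"
  using is_ideal_add[of I a "- b"] is_ideal_uminus[of I b] by simp

lemma is_ideal_sum: "is_ideal I \<Longrightarrow> (\<And>x. x \<in> A \<Longrightarrow> f x \<in> I) \<Longrightarrow> sum f A \<in> I"
  by (induction A rule: infinite_finite_induct) (auto intro: is_ideal_0 is_ideal_add)

lemma is_prime_ideal: "is_prime P \<Longrightarrow> is_ideal P"
  by (simp add: is_prime_def)

lemma is_prime_1: "is_prime P \<Longrightarrow> 1 \<notin> P"
  by (simp add: is_prime_def)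

lemma is_prime_mult: "is_prime P \<Longrightarrow> a * b \<in> P \<longleftrightarrow> a \<in> P \<or> b \<in> P"
  unfolding is_prime_def by (metis is_ideal_mult is_ideal_mult')

lemma is_prime_power: "is_prime P \<Longrightarrow> a \<notin> P \<Longrightarrow> a ^ n \<notin> P"
  by (induction n) (auto simp: is_prime_mult is_prime_1)

lemma is_prime_prod: "is_prime P \<Longrightarrow> (\<And>x. x \<in> A \<Longrightarrow> f x \<notin> P) \<Longrightarrow> prod f A \<notin> P"
  by (induction A rule: infinite_finite_induct) (auto simp: is_prime_mult is_prime_1)

lemma a_inv_rota: "\<ominus>\<^bsub>ring_of_type_algebra\<^esub> (a::'a::comm_ring_1) = - a"
proof -
  interpret ring "ring_of_type_algebra :: 'a ring" by (rule ring_from_type_algebra)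
  show ?thesis
    by (rule minus_equality) (auto simp: ring_of_type_algebra_def)
qed

text \<open>Transfers the locale predicate on the record ring to type-class arithmetic, in which all
  later computations take place.\<close>

lemma ideal_iff: "ideal I ring_of_type_algebra \<longleftrightarrow> is_ideal (I::'a::comm_ring_1 set)"
proof
  assume "ideal I ring_of_type_algebra"
  then interpret ideal I "ring_of_type_algebra" .
  show "is_ideal I"
  proof (rule is_idealI)
    show "0 \<in> I" using additive_subgroup.zero_closed[OF is_additive_subgroup] by (simp add: ring_of_type_algebra_def)
    show "a + b \<in> I" if "a \<in> I" "b \<in> I" for a b
      using additive_subgroup.a_closed[OF is_additive_subgroup that] by (simp add: ring_of_type_algebra_def)
    show "r * a \<in> I" if "a \<in> I" for r a
      using I_l_closed[OF that, of r] by (simp add: ring_of_type_algebra_def)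
  qed
next
  assume I: "is_ideal I"
  show "ideal I ring_of_type_algebra"
  proof (rule idealI)
    show "ring (ring_of_type_algebra :: 'a ring)" by (rule ring_from_type_algebra)
    show "subgroup I (add_monoid ring_of_type_algebra)"
    proof (rule group.subgroupI)
      interpret ring "ring_of_type_algebra :: 'a ring" by (rule ring_from_type_algebra)
      show "Group.group (add_monoid (ring_of_type_algebra :: 'a ring))"
        by (rule add.is_group)
      show "I \<noteq> {}" using is_ideal_0[OF I] by auto
      show "inv\<^bsub>add_monoid ring_of_type_algebra\<^esub> a \<in> I" if "a \<in> I" for a
        using is_ideal_uminus[OF I that] a_inv_rota[of a] by (simp add: a_inv_def)
    qed (use I in \<open>auto simp: ring_of_type_algebra_def intro: is_ideal_add\<close>)
  qed (use I in \<open>auto simp: ring_of_type_algebra_def intro: is_ideal_mult is_ideal_mult'\<close>)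
qed

lemma primeideal_iff: "primeideal P ring_of_type_algebra \<longleftrightarrow> is_prime (P::'a::comm_ring_1 set)"
proof
  assume "primeideal P ring_of_type_algebra"
  then interpret primeideal P "ring_of_type_algebra" .
  have P: "is_ideal P" using is_ideal ideal_iff by blast
  show "is_prime P"
    unfolding is_prime_def
  proof (intro conjI allI impI P notI)
    assume "1 \<in> P"
    hence "P = UNIV" using is_ideal_mult[OF P] by (metis UNIV_eq_I mult.right_neutral)
    with I_notcarr show False by (simp add: ring_of_type_algebra_def)
  next
    fix a b assume "a * b \<in> P"
    thus "a \<in> P \<or> b \<in> P" using I_prime[of a b] by (simp add: ring_of_type_algebra_def)
  qed
next
  assume P: "is_prime P"
  show "primeideal P ring_of_type_algebra"
  proof (rule primeidealI)
    show "ideal P ring_of_type_algebra" using P ideal_iff is_prime_ideal by blast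
    show "cring (ring_of_type_algebra :: 'a ring)" by (rule cring_from_type_algebra)
  qed (use P in \<open>auto simp: ring_of_type_algebra_def is_prime_mult dest: is_prime_1\<close>)
qed

text \<open>Combinations are built one summand at a time; this induction suits maps that are
  additive but not linear over the ring, such as the map T in
  \<open>cartier_local_power\<close>.\<close>

inductive_set idl :: "'a::comm_ring_1 set \<Rightarrow> 'a set" for S where
  idl_zero: "0 \<in> idl S"
| idl_step: "s \<in> S \<Longrightarrow> x \<in> idl S \<Longrightarrow> r * s + x \<in> idl S"

lemma is_ideal_idl: "is_ideal (idl S)"
proof (rule is_idealI)
  show "0 \<in> idl S" by (rule idl_zero)
  show "a + b \<in> idl S" if "a \<in> idl S" "b \<in> idl S" for a b
    using that by (induction a rule: idl.induct) (auto simp: add.assoc intro: idl.intros)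
  show "r * a \<in> idl S" if "a \<in> idl S" for r a
    using that
  proof (induction a rule: idl.induct)
    case (idl_step s x q)
    thus ?case using idl.idl_step[of s S "r * x" "r * q"] by (simp add: algebra_simps)
  qed (auto intro: idl_zero)
qed

lemma idl_base: "s \<in> S \<Longrightarrow> s \<in> idl S"
  using idl_step[of s S 0 1] by (simp add: idl_zero)

lemma idl_least: "is_ideal I \<Longrightarrow> S \<subseteq> I \<Longrightarrow> idl S \<subseteq> I"
proof
  fix x assume "is_ideal I" "S \<subseteq> I" "x \<in> idl S"
  from this(3,1,2) show "x \<in> I"
    by (induction rule: idl.induct) (auto intro: is_ideal_add is_ideal_mult is_ideal_0)
qed

lemma idl_mono_idl: "S \<subseteq> idl S' \<Longrightarrow> idl S \<subseteq> idl S'"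
  by (rule idl_least[OF is_ideal_idl])

lemma Idl_eq: "Idl\<^bsub>ring_of_type_algebra\<^esub> S = idl (S::'a::comm_ring_1 set)"
  unfolding genideal_def ideal_iff
  using is_ideal_idl[of S] idl_base[of _ S] idl_least[of _ S] by blast

section \<open>Powers of ideals\<close>

definition ipow :: "'a::comm_ring_1 set \<Rightarrow> nat \<Rightarrow> 'a set" where
  "ipow I n = I [^]\<^bsub>ideals_set ring_of_type_algebra\<^esub> n"

lemma ipow_0: "ipow I 0 = UNIV"
  by (simp add: ipow_def nat_pow_def ideals_set_def ring_of_type_algebra_def)

lemma ipow_Suc: "ipow I (Suc n) = ideal_prod ring_of_type_algebra (ipow I n) I"
  by (simp add: ipow_def nat_pow_def ideals_set_def)

lemma is_ideal_prod:
  "is_ideal I \<Longrightarrow> is_ideal J \<Longrightarrow> is_ideal (ideal_prod ring_of_type_algebra I J)"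
  using ring.ideal_prod_is_ideal[OF ring_from_type_algebra] ideal_iff by blast

lemma is_ideal_ipow: "is_ideal I \<Longrightarrow> is_ideal (ipow I n)"
  by (induction n) (auto simp: ipow_0 ipow_Suc intro: is_ideal_prod, simp add: is_ideal_def)

lemma ideal_prod_mem: "a \<in> I \<Longrightarrow> b \<in> J \<Longrightarrow> a * b \<in> ideal_prod ring_of_type_algebra I J"
  using ideal_prod.prod[of a I b J ring_of_type_algebra] by (simp add: ring_of_type_algebra_def)

lemma ideal_prod_subset:
  assumes "\<And>a b. a \<in> I \<Longrightarrow> b \<in> J \<Longrightarrow> a * b \<in> K" "\<And>a b. a \<in> K \<Longrightarrow> b \<in> K \<Longrightarrow> a + b \<in> K"
  shows "ideal_prod ring_of_type_algebra I J \<subseteq> K"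
proof
  fix x assume "x \<in> ideal_prod ring_of_type_algebra I J"
  thus "x \<in> K"
    by (induction rule: ideal_prod.induct) (use assms in \<open>auto simp: ring_of_type_algebra_def\<close>)
qed

lemma ipow_mem_Suc: "a \<in> ipow I n \<Longrightarrow> b \<in> I \<Longrightarrow> a * b \<in> ipow I (Suc n)"
  unfolding ipow_Suc by (rule ideal_prod_mem)

lemma ipow_mult:
  assumes I: "is_ideal I" and "a \<in> ipow I m" "b \<in> ipow I n"
  shows "a * b \<in> ipow I (m + n)"
  using assms(3)
proof (induction n arbitrary: b)
  case 0
  thus ?case using is_ideal_mult'[OF is_ideal_ipow[OF I] assms(2)] by simp
next
  case (Suc n)
  have "ipow I (Suc n) \<subseteq> {b. a * b \<in> ipow I (m + Suc n)}"
    unfolding ipow_Suc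
  proof (rule ideal_prod_subset)
    fix c d assume "c \<in> ipow I n" "d \<in> I"
    thus "c * d \<in> {b. a * b \<in> ipow I (m + Suc n)}"
      using ipow_mem_Suc[OF Suc.IH[of c], of d] by (simp add: mult.assoc)
  qed (use is_ideal_ipow[OF I, of "m + Suc n"] in \<open>auto simp: distrib_left intro: is_ideal_add\<close>)
  with Suc.prems show ?case by blast
qed

lemma ipow_1: "is_ideal I \<Longrightarrow> a \<in> I \<Longrightarrow> a \<in> ipow I (Suc 0)"
  using ipow_mem_Suc[of 1 I 0 a] by (simp add: ipow_0)

lemma ipow_Suc_subset:
  assumes "is_ideal I" shows "ipow I (Suc n) \<subseteq> ipow I n"
  unfolding ipow_Suc
  by (rule ideal_prod_subset)
     (use is_ideal_ipow[OF assms, of n] in \<open>auto intro: is_ideal_mult' is_ideal_add\<close>)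

lemma ipow_antimono: "is_ideal I \<Longrightarrow> m \<le> n \<Longrightarrow> ipow I n \<subseteq> ipow I m"
  using lift_Suc_antimono_le[of "\<lambda>n. ipow I n" m n] ipow_Suc_subset[of I] by blast

lemma ipow_power:
  assumes "is_ideal I" "a \<in> ipow I m" shows "a ^ n \<in> ipow I (m * n)"
proof (induction n)
  case (Suc n)
  show ?case using ipow_mult[OF assms(1) assms(2) Suc] by simp
qed (simp add: ipow_0)

lemma ipow_prod:
  assumes "is_ideal I" "\<And>x. x \<in> A \<Longrightarrow> f x \<in> ipow I (w x)"
  shows "prod f A \<in> ipow I (sum w A)"
  using assms(2) by (induction A rule: infinite_finite_induct)
    (auto simp: ipow_0 intro: ipow_mult[OF assms(1)])

section \<open>Localizations and symbolic powers\<close>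

lemma ring_localization:
  assumes "is_prime (Q::'a::idom set)"
  shows "ring (localization Q)"
proof -
  interpret ring "ring_of_type_algebra :: 'a fract ring" by (rule ring_from_type_algebra)
  have nz: "s \<noteq> 0" if "s \<notin> Q" for s
    using that is_ideal_0[OF is_prime_ideal[OF assms]] by auto
  have "subring {Fraction_Field.Fract a s |a s. s \<notin> Q} (ring_of_type_algebra :: 'a fract ring)"
  proof (rule subringI)
    show "\<one>\<^bsub>ring_of_type_algebra\<^esub> \<in> {Fraction_Field.Fract a s |a s. s \<notin> Q}"
      using is_prime_1[OF assms] by (auto simp: ring_of_type_algebra_def One_fract_def)
  next
    fix h assume "h \<in> {Fraction_Field.Fract a s |a s. s \<notin> Q}"
    thus "\<ominus>\<^bsub>ring_of_type_algebra\<^esub> h \<in> {Fraction_Field.Fract a s |a s. s \<notin> Q}"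
      by (auto simp: a_inv_rota) blast
  next
    fix g h assume "g \<in> {Fraction_Field.Fract a s |a s. s \<notin> Q}" "h \<in> {Fraction_Field.Fract a s |a s. s \<notin> Q}"
    then obtain a s b t where *: "g = Fraction_Field.Fract a s" "h = Fraction_Field.Fract b t" "s \<notin> Q" "t \<notin> Q"
      by auto
    hence st: "s * t \<notin> Q" by (simp add: is_prime_mult[OF assms])
    show "g \<otimes>\<^bsub>ring_of_type_algebra\<^esub> h \<in> {Fraction_Field.Fract a s |a s. s \<notin> Q}"
      using * st by (auto simp: ring_of_type_algebra_def)
    show "g \<oplus>\<^bsub>ring_of_type_algebra\<^esub> h \<in> {Fraction_Field.Fract a s |a s. s \<notin> Q}"
      using * st nz by (auto simp: ring_of_type_algebra_def)
  qed (auto simp: ring_of_type_algebra_def)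
  from subring_is_ring[OF this] show ?thesis
    by (simp add: localization_def)
qed

text \<open>Fractions with numerator in Q^n and denominator outside Q already form an ideal of the
  localization, so contracting to the ring amounts to clearing one denominator. Later arguments
  about symbolic powers go through this form.\<close>

lemma local_power_iff:
  assumes Q: "is_prime (Q::'a::idom set)"
  shows "r \<in> local_power Q n \<longleftrightarrow> (\<exists>s. s \<notin> Q \<and> s * r \<in> ipow Q n)"
proof -
  note I = is_ideal_ipow[OF is_prime_ideal[OF Q], of n]
  have nz: "s \<noteq> 0" if "s \<notin> Q" for s
    using that is_ideal_0[OF is_prime_ideal[OF Q]] by auto
  interpret L: ring "localization Q" by (rule ring_localization[OF Q])
  have Lc: "carrier (localization Q) = {Fraction_Field.Fract a s |a s. s \<notin> Q}"
    by (simp add: localization_def)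
  have Lm: "x \<otimes>\<^bsub>localization Q\<^esub> y = x * y" and La: "x \<oplus>\<^bsub>localization Q\<^esub> y = x + y"
    and Lz: "\<zero>\<^bsub>localization Q\<^esub> = 0" for x y
    by (auto simp: localization_def ring_of_type_algebra_def)
  let ?L = "{Fraction_Field.Fract a s |a s. a \<in> ipow Q n \<and> s \<notin> Q}"
  have Lsum: "Fraction_Field.Fract a s + Fraction_Field.Fract b t \<in> ?L"
    if "a \<in> ipow Q n" "s \<notin> Q" "b \<in> ipow Q n" "t \<notin> Q" for a s b t
  proof -
    have "a * t + b * s \<in> ipow Q n" "s * t \<notin> Q"
      using that I Q by (auto simp: is_prime_mult intro!: is_ideal_add is_ideal_mult')
    thus ?thesis using that nz by auto
  qed
  have Linv: "\<ominus>\<^bsub>localization Q\<^esub> x = - x" if "x \<in> carrier (localization Q)" for x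
  proof (rule L.minus_equality)
    show "- x \<oplus>\<^bsub>localization Q\<^esub> x = \<zero>\<^bsub>localization Q\<^esub>"
      by (simp add: La Lz)
    show "- x \<in> carrier (localization Q)" using that by (auto simp: Lc) blast
  qed (use that in auto)
  have idL: "ideal ?L (localization Q)"
  proof (rule idealI)
    show "ring (localization Q)" by (rule L.ring_axioms)
    show "subgroup ?L (add_monoid (localization Q))"
    proof (rule group.subgroupI)
      show "Group.group (add_monoid (localization Q))" by (rule L.add.is_group)
      show "?L \<subseteq> carrier (add_monoid (localization Q))" by (auto simp: Lc)
      show "?L \<noteq> {}" using is_ideal_0[OF I] is_prime_1[OF Q] by blast
      show "x \<otimes>\<^bsub>add_monoid (localization Q)\<^esub> y \<in> ?L" if "x \<in> ?L" "y \<in> ?L" for x y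
        using that Lsum by (auto simp: La)
      show "inv\<^bsub>add_monoid (localization Q)\<^esub> x \<in> ?L" if "x \<in> ?L" for x
      proof -
        from that obtain a s where as: "x = Fraction_Field.Fract a s" "a \<in> ipow Q n" "s \<notin> Q" by auto
        have "inv\<^bsub>add_monoid (localization Q)\<^esub> x = - x"
          using Linv[of x] as by (auto simp: a_inv_def Lc)
        thus ?thesis using as is_ideal_uminus[OF I, of a] by auto
      qed
    qed
  next
    fix a x assume ax: "a \<in> ?L" "x \<in> carrier (localization Q)"
    then obtain b s c t where *: "a = Fraction_Field.Fract b s" "b \<in> ipow Q n" "s \<notin> Q"
      "x = Fraction_Field.Fract c t" "t \<notin> Q"
      by (auto simp: Lc)
    hence "c * b \<in> ipow Q n" "t * s \<notin> Q"
      using I Q by (auto simp: is_prime_mult intro: is_ideal_mult)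
    hence "x * a \<in> ?L" using * by auto
    thus "x \<otimes>\<^bsub>localization Q\<^esub> a \<in> ?L" "a \<otimes>\<^bsub>localization Q\<^esub> x \<in> ?L"
      by (auto simp: Lm mult.commute)
  qed
  show ?thesis
  proof
    assume "r \<in> local_power Q n"
    moreover have "to_fract ` ipow Q n \<subseteq> ?L"
      using is_prime_1[OF Q] by (auto simp: to_fract_def)
    ultimately have "to_fract r \<in> ?L"
      using idL unfolding local_power_def ipow_def[symmetric] genideal_def by blast
    then obtain a s where as: "to_fract r = Fraction_Field.Fract a s" "a \<in> ipow Q n" "s \<notin> Q" by auto
    hence "s * r = a" using nz[of s] by (auto simp: to_fract_def eq_fract mult.commute)
    thus "\<exists>s. s \<notin> Q \<and> s * r \<in> ipow Q n" using as by auto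
  next
    assume "\<exists>s. s \<notin> Q \<and> s * r \<in> ipow Q n"
    then obtain s where s: "s \<notin> Q" "s * r \<in> ipow Q n" by auto
    show "r \<in> local_power Q n"
      unfolding local_power_def ipow_def[symmetric] genideal_def
    proof clarify
      fix K assume K: "ideal K (localization Q)" "to_fract ` ipow Q n \<subseteq> K"
      have "Fraction_Field.Fract 1 s \<in> carrier (localization Q)" using s by (auto simp: Lc)
      moreover have "to_fract (s * r) \<in> K" using K s by auto
      ultimately have "Fraction_Field.Fract 1 s \<otimes>\<^bsub>localization Q\<^esub> to_fract (s * r) \<in> K"
        using ideal.I_l_closed[OF K(1)] by blast
      moreover have "Fraction_Field.Fract 1 s * to_fract (s * r) = to_fract r"
        using nz[OF s(1)] unfolding to_fract_def by (simp add: eq_fract)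
      ultimately show "to_fract r \<in> K" unfolding Lm by metis
    qed
  qed
qed

lemma is_ideal_local_power:
  assumes Q: "is_prime (Q::'a::idom set)"
  shows "is_ideal (local_power Q n)"
proof -
  note I = is_ideal_ipow[OF is_prime_ideal[OF Q], of n]
  show ?thesis
  proof (rule is_idealI)
    show "0 \<in> local_power Q n"
      using is_ideal_0[OF I] is_prime_1[OF Q] by (auto simp: local_power_iff[OF Q])
    show "a + b \<in> local_power Q n" if "a \<in> local_power Q n" "b \<in> local_power Q n" for a b
    proof -
      from that obtain s t where "s \<notin> Q" "t \<notin> Q" "s * a \<in> ipow Q n" "t * b \<in> ipow Q n"
        by (auto simp: local_power_iff[OF Q])
      hence "s * t \<notin> Q" "t * (s * a) + s * (t * b) \<in> ipow Q n"
        by (auto simp: is_prime_mult[OF Q] intro: is_ideal_add[OF I] is_ideal_mult[OF I])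
      thus ?thesis by (auto simp: local_power_iff[OF Q] algebra_simps)
    qed
    show "r * a \<in> local_power Q n" if "a \<in> local_power Q n" for r a
    proof -
      from that obtain s where "s \<notin> Q" "s * a \<in> ipow Q n" by (auto simp: local_power_iff[OF Q])
      hence "s \<notin> Q" "r * (s * a) \<in> ipow Q n" by (auto intro: is_ideal_mult[OF I])
      thus ?thesis by (auto simp: local_power_iff[OF Q] algebra_simps)
    qed
  qed
qed

lemma local_power_Suc:
  assumes Q: "is_prime (Q::'a::idom set)"
  shows "local_power Q (Suc n) \<subseteq> local_power Q n"
  using ipow_Suc_subset[OF is_prime_ideal[OF Q], of n] unfolding subset_iff local_power_iff[OF Q] by blast

lemma local_power_mult:
  assumes Q: "is_prime (Q::'a::idom set)" and "a \<in> local_power Q m" "b \<in> local_power Q n"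
  shows "a * b \<in> local_power Q (m + n)"
proof -
  from assms obtain s t where "s \<notin> Q" "t \<notin> Q" "s * a \<in> ipow Q m" "t * b \<in> ipow Q n"
    by (auto simp: local_power_iff[OF Q])
  hence "s * t \<notin> Q" "(s * a) * (t * b) \<in> ipow Q (m + n)"
    by (auto simp: is_prime_mult[OF Q] intro: ipow_mult[OF is_prime_ideal[OF Q]])
  thus ?thesis by (auto simp: local_power_iff[OF Q] algebra_simps)
qed

lemma local_power_0:
  assumes Q: "is_prime (Q::'a::idom set)" shows "local_power Q 0 = UNIV"
  using is_prime_1[OF Q] by (auto simp: local_power_iff[OF Q] ipow_0)

lemma minimal_primes_iff:
  "Q \<in> minimal_primes ring_of_type_algebra I \<longleftrightarrow>
     is_prime Q \<and> I \<subseteq> Q \<and> (\<forall>P. is_prime P \<longrightarrow> I \<subseteq> P \<longrightarrow> P \<subseteq> Q \<longrightarrow> P = Q)"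
  by (auto simp: minimal_primes_def primeideal_iff)

text \<open>The case n = 0 is absorbed because \<open>local_power Q 0\<close> is the whole
  ring.\<close>

lemma symbolic_power_eq:
  "symbolic_power I n = (\<Inter>Q \<in> minimal_primes ring_of_type_algebra I. local_power Q n)"
  by (auto simp: symbolic_power_def local_power_0 minimal_primes_iff)

section \<open>Roots in the algebraic closure and splittings\<close>

lemma closure_emb_simps:
  "closure_emb (a + b) = closure_emb a + closure_emb b"
  "closure_emb (a * b) = closure_emb a * closure_emb b"
  "closure_emb 0 = 0" "closure_emb 1 = 1"
  "closure_emb a = closure_emb b \<longleftrightarrow> a = b"
  by (auto simp: closure_emb_def)

lemma closure_emb_power: "closure_emb (a ^ n) = closure_emb a ^ n"
  by (induction n) (auto simp: closure_emb_simps)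

lemma closure_emb_of_nat: "closure_emb (of_nat n) = of_nat n"
  by (induction n) (auto simp: closure_emb_simps)

text \<open>A Cartier-linear map \<open>T\<close>, viewed as the map \<open>g\<^sup>1\<^sup>/\<^sup>p \<mapsto> T g\<close>, precomposed with multiplication by
  \<open>F\<^sup>1\<^sup>/\<^sup>p\<close>, is the splitting.\<close>

lemma symbolic_F_splitI:
  fixes I :: "'a::idom set" and T :: "'a \<Rightarrow> 'a"
  assumes p: "Factorial_Ring.prime p" and char: "CHAR('a) = p"
    and T_add: "\<And>a b. T (a + b) = T a + T b"
    and T_power: "\<And>a b. T (a ^ p * b) = a * T b"
    and T_1: "T F = 1"
    and T_local: "\<And>Q n g. Q \<in> minimal_primes ring_of_type_algebra I \<Longrightarrow> g \<in> local_power Q (n * p + 1)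
                   \<Longrightarrow> T (F * g) \<in> local_power Q (n + 1)"
  shows "symbolic_F_split p I"
proof -
  let ?MP = "minimal_primes ring_of_type_algebra I"
  have prime: "is_prime Q" if "Q \<in> ?MP" for Q
    using that by (simp add: minimal_primes_iff)
  have char': "CHAR('a fract alg_closure) = p"
  proof -
    have "(of_nat p :: 'a fract alg_closure) = closure_emb (of_nat p :: 'a)"
      by (simp add: closure_emb_of_nat)
    also have "\<dots> = 0" using char of_nat_CHAR[where 'a = 'a] by (simp add: closure_emb_simps)
    finally have "CHAR('a fract alg_closure) dvd p" by (simp add: of_nat_eq_0_iff_char_dvd)
    moreover have "CHAR('a fract alg_closure) \<noteq> 1" by simp
    ultimately show ?thesis using p by (metis prime_nat_iff)
  qed
  have frob: "(z + w) ^ p = z ^ p + w ^ p" for z w :: "'a fract alg_closure"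
    by (rule freshmans_dream) (use char' p in simp_all)
  \<comment> \<open>\<open>rt z\<close> is the ring element whose p-th root is z. Injectivity of
    \<open>closure_emb\<close> makes it well defined on \<open>pth_roots p UNIV\<close>, and
    \<open>frob\<close> makes it additive there; elsewhere its value is arbitrary.\<close>
  define rt :: "'a fract alg_closure \<Rightarrow> 'a" where "rt z = inv_into UNIV closure_emb (z ^ p)" for z
  have rt_eq: "rt z = g" if "z ^ p = closure_emb g" for z g
    unfolding rt_def that by (rule inv_f_f) (auto simp: inj_def closure_emb_simps)
  define \<phi> where "\<phi> z = T (F * rt z)" for z
  have "pth_root_splitting p \<phi>"
    unfolding pth_root_splitting_def
  proof (intro conjI allI ballI)
    fix z w :: "'a fract alg_closure" assume "z \<in> pth_roots p UNIV" "w \<in> pth_roots p UNIV"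
    then obtain g h where gh: "z ^ p = closure_emb g" "w ^ p = closure_emb h"
      by (auto simp: pth_roots_def)
    hence "(z + w) ^ p = closure_emb (g + h)" by (simp add: frob closure_emb_simps)
    from rt_eq[OF this] rt_eq[OF gh(1)] rt_eq[OF gh(2)]
    show "\<phi> (z + w) = \<phi> z + \<phi> w"
      by (simp add: \<phi>_def distrib_left T_add)
  next
    fix r :: 'a and z :: "'a fract alg_closure" assume "z \<in> pth_roots p UNIV"
    then obtain g where g: "z ^ p = closure_emb g" by (auto simp: pth_roots_def)
    hence "(closure_emb r * z) ^ p = closure_emb (r ^ p * g)"
      by (simp add: closure_emb_simps closure_emb_power power_mult_distrib)
    from rt_eq[OF this] rt_eq[OF g] show "\<phi> (closure_emb r * z) = r * \<phi> z"
      using T_power[of r "F * g"] by (simp add: \<phi>_def algebra_simps)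
  next
    fix r :: 'a
    \<comment> \<open>An element r of the ring is the p-th root of r^p, so it is sent to T (r^p F) =
      r T F = r.\<close>
    have "rt (closure_emb r) = r ^ p" by (rule rt_eq) (simp add: closure_emb_power)
    thus "\<phi> (closure_emb r) = r" using T_power[of r F] by (simp add: \<phi>_def T_1 mult.commute)
  qed
  moreover have "\<phi> ` pth_roots p (symbolic_power I (n * p + 1)) \<subseteq> symbolic_power I (n + 1)" for n
  proof clarify
    fix z assume "z \<in> pth_roots p (symbolic_power I (n * p + 1))"
    then obtain g where g: "z ^ p = closure_emb g" "g \<in> symbolic_power I (n * p + 1)"
      by (auto simp: pth_roots_def)
    thus "\<phi> z \<in> symbolic_power I (n + 1)"
      using T_local[of _ g n] unfolding symbolic_power_eq by (auto simp: \<phi>_def rt_eq[OF g(1)])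
  qed
  moreover have ideal_symb: "is_ideal (symbolic_power I n)" for n
    unfolding symbolic_power_eq using is_ideal_local_power[OF prime]
    by (intro is_idealI) (auto intro: is_ideal_0 is_ideal_add is_ideal_mult)
  moreover have "symbolic_power I n \<cdot>\<^bsub>ring_of_type_algebra\<^esub> symbolic_power I m \<subseteq> symbolic_power I (n + m)" for n m
  proof (rule ideal_prod_subset)
    fix a b assume "a \<in> symbolic_power I n" "b \<in> symbolic_power I m"
    thus "a * b \<in> symbolic_power I (n + m)"
      unfolding symbolic_power_eq by (auto intro: local_power_mult[OF prime])
  next
    fix a b assume "a \<in> symbolic_power I (n + m)" "b \<in> symbolic_power I (n + m)"
    thus "a + b \<in> symbolic_power I (n + m)"
      by (rule is_ideal_add[OF ideal_symb])
  qed
  moreover have "symbolic_power I (n + 1) \<subseteq> symbolic_power I n" for n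
    using local_power_Suc[OF prime] unfolding symbolic_power_eq by fastforce
  moreover have "symbolic_power I 0 = UNIV" by (simp add: symbolic_power_def)
  ultimately show ?thesis
    unfolding symbolic_F_split_def F_split_filtration_def ideal_iff by blast
qed

section \<open>Polynomial rings\<close>

type_synonym ('v, 'k) mpoly = "('v \<Rightarrow>\<^sub>0 nat) \<Rightarrow>\<^sub>0 'k"

lemma poly_mapping_sum_singles:
  "f = (\<Sum>m\<in>Poly_Mapping.keys f. Poly_Mapping.single m (Poly_Mapping.lookup f m))"
proof (rule poly_mapping_eqI)
  fix k
  have "(\<Sum>m\<in>Poly_Mapping.keys f. Poly_Mapping.lookup (Poly_Mapping.single m (Poly_Mapping.lookup f m)) k)
      = (\<Sum>m\<in>Poly_Mapping.keys f. if m = k then Poly_Mapping.lookup f k else 0)"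
    by (intro sum.cong) (auto simp: lookup_single when_def)
  also have "\<dots> = Poly_Mapping.lookup f k"
    by (simp add: in_keys_iff)
  finally show "Poly_Mapping.lookup f k = Poly_Mapping.lookup
      (\<Sum>m\<in>Poly_Mapping.keys f. Poly_Mapping.single m (Poly_Mapping.lookup f m)) k"
    by (simp add: lookup_sum)
qed

lemma poly_mapping_induct [case_names zero single add]:
  assumes "P 0" "\<And>m c. P (Poly_Mapping.single m c)" "\<And>f g. P f \<Longrightarrow> P g \<Longrightarrow> P (f + g)"
  shows "P (f :: 'a \<Rightarrow>\<^sub>0 'b::comm_monoid_add)"
proof -
  have "P (\<Sum>m\<in>A. Poly_Mapping.single m (Poly_Mapping.lookup f m))" for A
    by (induction A rule: infinite_finite_induct) (auto intro: assms)
  from this[of "Poly_Mapping.keys f"] show ?thesis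
    using poly_mapping_sum_singles[of f] by simp
qed

definition var :: "'v \<Rightarrow> ('v, 'k::field) mpoly" where
  "var v = Poly_Mapping.single (Poly_Mapping.single v 1) 1"

definition const :: "'k \<Rightarrow> ('v, 'k::field) mpoly" where
  "const c = Poly_Mapping.single 0 c"

lemma x_var_eq: "x_var i = var (False, i)" and y_var_eq: "y_var i = var (True, i)"
  by (simp_all add: x_var_def y_var_def var_def)

lemma const_simps: "const 0 = 0" "const 1 = 1" "const (a + b) = const a + const b"
  "const (a * b) = const a * const b"
  by (auto simp: const_def single_add mult_single)

definition nsm :: "nat \<Rightarrow> ('v::finite \<Rightarrow>\<^sub>0 nat) \<Rightarrow> ('v \<Rightarrow>\<^sub>0 nat)" where
  "nsm k m = Abs_poly_mapping (\<lambda>v. k * Poly_Mapping.lookup m v)"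

text \<open>The exponent vector of the c-th power of the product of all variables.\<close>

definition fullm :: "nat \<Rightarrow> ('v::finite \<Rightarrow>\<^sub>0 nat)" where
  "fullm c = Abs_poly_mapping (\<lambda>v. c)"

lemma lookup_nsm [simp]: "Poly_Mapping.lookup (nsm k m) v = k * Poly_Mapping.lookup m v"
  by (simp add: nsm_def)

lemma lookup_fullm [simp]: "Poly_Mapping.lookup (fullm c) v = c"
  by (simp add: fullm_def)

lemma single_power: "Poly_Mapping.single m c ^ k = Poly_Mapping.single (nsm k m) (c ^ k)"
proof (induction k)
  case 0
  have "nsm 0 m = 0" by (rule poly_mapping_eqI) simp
  thus ?case by simp
next
  case (Suc k)
  have "m + nsm k m = nsm (Suc k) m" by (rule poly_mapping_eqI) (simp add: lookup_add)
  with Suc show ?case by (simp add: mult_single)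
qed

lemma prod_single:
  "finite A \<Longrightarrow> (\<Prod>x\<in>A. Poly_Mapping.single (m x) (1::'k::comm_semiring_1)) = Poly_Mapping.single (sum m A) 1"
  by (induction A rule: finite_induct) (auto simp: mult_single)

section \<open>Ring homomorphisms and substitution\<close>

definition rhom :: "('a::comm_ring_1 \<Rightarrow> 'b::comm_ring_1) \<Rightarrow> bool" where
  "rhom h \<longleftrightarrow> (\<forall>a b. h (a + b) = h a + h b) \<and> (\<forall>a b. h (a * b) = h a * h b) \<and> h 1 = 1"

lemma rhomD:
  assumes "rhom h"
  shows "h (a + b) = h a + h b" "h (a * b) = h a * h b" "h 1 = 1" "h 0 = 0" "h (a - b) = h a - h b"
    "h (- a) = - h a" "h (a ^ n) = h a ^ n" "h (sum f A) = (\<Sum>x\<in>A. h (f x))" "h (prod f A) = (\<Prod>x\<in>A. h (f x))"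
proof -
  show 1: "h (a + b) = h a + h b" "h (a * b) = h a * h b" "h 1 = 1" for a b
    using assms by (auto simp: rhom_def)
  show 0: "h 0 = 0" using 1(1)[of 0 0] by simp
  show 2: "h (- a) = - h a" for a using 1(1)[of a "- a"] 0 by (simp add: eq_neg_iff_add_eq_0 add.commute)
  show "h (a - b) = h a - h b" using 1(1)[of a "- b"] 2 by simp
  show "h (a ^ n) = h a ^ n" by (induction n) (auto simp: 1)
  show "h (sum f A) = (\<Sum>x\<in>A. h (f x))" by (induction A rule: infinite_finite_induct) (auto simp: 1 0)
  show "h (prod f A) = (\<Prod>x\<in>A. h (f x))" by (induction A rule: infinite_finite_induct) (auto simp: 1)
qed

lemma is_prime_kernel:
  fixes h :: "'a::comm_ring_1 \<Rightarrow> 'b::idom"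
  assumes "rhom h" shows "is_prime {a. h a = 0}"
  using rhomD[OF assms] by (auto simp: is_prime_def intro!: is_idealI)

definition monev :: "('v::finite \<Rightarrow> 'a::comm_ring_1) \<Rightarrow> ('v \<Rightarrow>\<^sub>0 nat) \<Rightarrow> 'a" where
  "monev \<sigma> m = (\<Prod>v\<in>UNIV. \<sigma> v ^ Poly_Mapping.lookup m v)"

lemma monev_add: "monev \<sigma> (m + n) = monev \<sigma> m * monev \<sigma> n"
  by (simp add: monev_def lookup_add power_add prod.distrib)

lemma monev_0: "monev \<sigma> 0 = 1"
  by (simp add: monev_def)

lemma monev_single: "monev \<sigma> (Poly_Mapping.single v k) = \<sigma> v ^ k"
proof -
  have "monev \<sigma> (Poly_Mapping.single v k) = (\<Prod>w\<in>UNIV. if w = v then \<sigma> v ^ k else 1)"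
    unfolding monev_def by (intro prod.cong) (auto simp: lookup_single)
  thus ?thesis by simp
qed

definition subst :: "('v::finite \<Rightarrow> ('w, 'k::field) mpoly) \<Rightarrow> ('v, 'k) mpoly \<Rightarrow> ('w, 'k) mpoly" where
  "subst \<sigma> f = (\<Sum>m\<in>Poly_Mapping.keys f. const (Poly_Mapping.lookup f m) * monev \<sigma> m)"

text \<open>Cancellation can shrink the support of a sum, so additivity of \<open>subst\<close> is
  checked on a common finite index set.\<close>

lemma subst_superset:
  assumes "finite A" "Poly_Mapping.keys f \<subseteq> A"
  shows "subst \<sigma> f = (\<Sum>m\<in>A. const (Poly_Mapping.lookup f m) * monev \<sigma> m)"
  unfolding subst_def using assms
  by (intro sum.mono_neutral_left) (auto simp: in_keys_iff const_simps)

lemma subst_add: "subst \<sigma> (f + g) = subst \<sigma> f + subst \<sigma> g"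
proof -
  let ?A = "Poly_Mapping.keys f \<union> Poly_Mapping.keys g"
  have "Poly_Mapping.keys (f + g) \<subseteq> ?A" by (rule keys_add)
  thus ?thesis
    by (simp add: subst_superset[of ?A] lookup_add const_simps distrib_right sum.distrib)
qed

lemma subst_single: "subst \<sigma> (Poly_Mapping.single m c) = const c * monev \<sigma> m"
  by (subst subst_superset[of "{m}"]) (auto split: if_splits)

lemma subst_0: "subst \<sigma> 0 = 0"
  by (simp add: subst_def)

lemma rhom_subst: "rhom (subst \<sigma> :: ('v::finite, 'k::field) mpoly \<Rightarrow> ('w, 'k) mpoly)"
  unfolding rhom_def
proof (intro conjI allI)
  fix f g :: "('v, 'k) mpoly"
  show "subst \<sigma> (f * g) = subst \<sigma> f * subst \<sigma> g"
  proof (induction f rule: poly_mapping_induct)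
    case (single m c)
    show ?case
      by (induction g rule: poly_mapping_induct)
         (auto simp: subst_add subst_0 distrib_left distrib_right mult_single subst_single const_simps monev_add mult_ac)
  qed (auto simp: subst_add subst_0 distrib_right)
  have "subst \<sigma> (Poly_Mapping.single 0 1) = 1" by (simp add: subst_single const_simps monev_0 del: single_one)
  thus "subst \<sigma> 1 = 1" by simp
qed (rule subst_add)

lemma subst_var [simp]: "subst \<sigma> (var v) = \<sigma> v"
  by (simp add: var_def subst_single monev_single const_simps)

lemma CHAR_mpoly: "CHAR(('v, 'k::field) mpoly) = CHAR('k)"
proof (rule CHAR_eqI)
  show "of_nat CHAR('k) = (0 :: ('v, 'k) mpoly)"
    using of_nat_CHAR[where 'a = 'k] by (simp flip: single_of_nat)
next
  fix n assume "of_nat n = (0 :: ('v, 'k) mpoly)"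
  hence "Poly_Mapping.lookup (Poly_Mapping.single (0::'v \<Rightarrow>\<^sub>0 nat) (of_nat n :: 'k)) 0 = 0"
    by (simp only: single_of_nat lookup_zero)
  hence "of_nat n = (0 :: 'k)" by (simp only: lookup_single_eq)
  thus "CHAR('k) dvd n" by (simp add: of_nat_eq_0_iff_char_dvd)
qed

section \<open>The Cartier map\<close>

text \<open>Let k act on itself by sending b to a^p b; additivity of Frobenius makes this a vector
  space. A linear map to k with its ordinary action is prescribed on the independent set {1} and
  extended.\<close>

lemma exists_frobenius_section:
  assumes "Factorial_Ring.prime p" "CHAR('k::field) = p"
  shows "\<exists>\<pi> :: 'k \<Rightarrow> 'k. (\<forall>a b. \<pi> (a + b) = \<pi> a + \<pi> b) \<and> (\<forall>a b. \<pi> (a ^ p * b) = a * \<pi> b) \<and> \<pi> 1 = 1"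
proof -
  have frob: "(a + b) ^ p = a ^ p + b ^ p" for a b :: 'k
    by (rule freshmans_dream) (use assms in simp_all)
  interpret v1: vector_space "\<lambda>a b::'k. a ^ p * b"
    by unfold_locales (auto simp: frob algebra_simps power_mult_distrib)
  interpret v2: vector_space "(*) :: 'k \<Rightarrow> 'k \<Rightarrow> 'k"
    by unfold_locales (auto simp: algebra_simps)
  interpret vp: vector_space_pair "\<lambda>a b::'k. a ^ p * b" "(*) :: 'k \<Rightarrow> 'k \<Rightarrow> 'k"
    by unfold_locales
  have "v1.independent {1}" by simp
  then obtain g where g: "Vector_Spaces.linear (\<lambda>a b::'k. a ^ p * b) (*) g" "\<forall>x\<in>{1}. g x = 1"
    using vp.linear_independent_extend[of "{1}" "\<lambda>_. 1"] by blast
  interpret g: Vector_Spaces.linear "\<lambda>a b::'k. a ^ p * b" "(*)" g by (rule g(1))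
  show ?thesis using g.add g.scale g(2) by (intro exI[of _ g]) auto
qed

text \<open>The monomials with all exponents below p form a basis of the polynomial ring over the
  subring generated by k and the p-th powers of the variables. The map takes the coordinate at the
  top basis monomial, with all exponents p - 1, and extracts a p-th root, using \<open>\<pi>\<close>
  on coefficients.\<close>

definition cartier :: "nat \<Rightarrow> ('k \<Rightarrow> 'k) \<Rightarrow> ('v::finite, 'k::field) mpoly \<Rightarrow> ('v, 'k) mpoly" where
  "cartier p \<pi> g = Abs_poly_mapping (\<lambda>\<alpha>. \<pi> (Poly_Mapping.lookup g (nsm p \<alpha> + fullm (p - 1))))"

locale frobenius_section =
  fixes p :: nat and \<pi> :: "'k::field \<Rightarrow> 'k"
  assumes p: "Factorial_Ring.prime p" and char: "CHAR('k) = p"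
    and pi_add: "\<pi> (a + b) = \<pi> a + \<pi> b" and pi_power: "\<pi> (a ^ p * b) = a * \<pi> b" and pi_1: "\<pi> 1 = 1"
begin

lemma pi_0: "\<pi> 0 = 0"
proof -
  have "\<pi> 0 + \<pi> 0 = \<pi> 0 + 0" using pi_add[of 0 0] by simp
  thus ?thesis by (simp only: add_left_cancel)
qed

lemma inj_shift: "inj (\<lambda>\<alpha>::'v::finite \<Rightarrow>\<^sub>0 nat. nsm p \<alpha> + fullm (p - 1))"
proof (rule injI)
  fix a b :: "'v \<Rightarrow>\<^sub>0 nat" assume "nsm p a + fullm (p - 1) = nsm p b + fullm (p - 1)"
  hence "p * Poly_Mapping.lookup a v = p * Poly_Mapping.lookup b v" for v
    by (metis add_right_cancel lookup_nsm)
  thus "a = b" using prime_gt_0_nat[OF p] by (auto intro: poly_mapping_eqI)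
qed

lemma lookup_cartier:
  "Poly_Mapping.lookup (cartier p \<pi> g) \<alpha> = \<pi> (Poly_Mapping.lookup g (nsm p \<alpha> + fullm (p - 1)))"
proof -
  have "finite ((\<lambda>\<alpha>. nsm p \<alpha> + fullm (p - 1)) -` Poly_Mapping.keys g)"
    by (rule finite_vimageI[OF _ inj_shift]) simp
  hence "finite {\<alpha>. \<pi> (Poly_Mapping.lookup g (nsm p \<alpha> + fullm (p - 1))) \<noteq> 0}"
    by (rule rev_finite_subset) (auto simp: in_keys_iff pi_0)
  thus ?thesis by (simp add: cartier_def)
qed

lemma cartier_add: "cartier p \<pi> (f + g) = cartier p \<pi> f + cartier p \<pi> g"
  by (rule poly_mapping_eqI) (simp add: lookup_cartier lookup_add pi_add)

lemma cartier_0: "cartier p \<pi> 0 = 0"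
  by (rule poly_mapping_eqI) (simp add: lookup_cartier pi_0)

text \<open>Multiplication by the p-th power of a monomial shifts every exponent by a multiple of p,
  so it preserves the condition of being p - 1 modulo p in every variable. When n violates this
  condition, both sides vanish.\<close>

lemma cartier_power_single:
  "cartier p \<pi> (Poly_Mapping.single m c ^ p * Poly_Mapping.single n b)
     = Poly_Mapping.single m c * cartier p \<pi> (Poly_Mapping.single (n::'v::finite \<Rightarrow>\<^sub>0 nat) b)"
proof (cases "\<exists>\<alpha>. n = nsm p \<alpha> + fullm (p - 1)")
  case True
  then obtain \<alpha> where \<alpha>: "n = nsm p \<alpha> + fullm (p - 1)" by blast
  have T: "cartier p \<pi> (Poly_Mapping.single (nsm p \<beta> + fullm (p - 1)) d) = Poly_Mapping.single \<beta> (\<pi> d)"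
    for \<beta> :: "'v \<Rightarrow>\<^sub>0 nat" and d
    using inj_shift by (intro poly_mapping_eqI) (auto simp: lookup_cartier lookup_single when_def pi_0 inj_def)
  have "nsm p m + n = nsm p (m + \<alpha>) + fullm (p - 1)"
    by (rule poly_mapping_eqI) (simp add: \<alpha> lookup_add distrib_left)
  thus ?thesis by (simp add: single_power mult_single T[unfolded One_nat_def] \<alpha> pi_power)
next
  case False
  have "nsm p m + n \<noteq> nsm p \<alpha> + fullm (p - 1)" for \<alpha>
  proof
    assume eq: "nsm p m + n = nsm p \<alpha> + fullm (p - 1)"
    have eqv: "p * Poly_Mapping.lookup m v + Poly_Mapping.lookup n v = p * Poly_Mapping.lookup \<alpha> v + (p - 1)" for v
      using arg_cong[OF eq, of "\<lambda>q. Poly_Mapping.lookup q v"] by (simp add: lookup_add)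
    \<comment> \<open>The remainder p - 1 is below p, so m never exceeds \<alpha> and the
      subtraction \<open>\<alpha> - m\<close> is not truncated.\<close>
    have le: "Poly_Mapping.lookup m v \<le> Poly_Mapping.lookup \<alpha> v" for v
    proof (rule ccontr)
      assume "\<not> ?thesis"
      hence "p * (Poly_Mapping.lookup \<alpha> v + 1) \<le> p * Poly_Mapping.lookup m v" by (intro mult_left_mono) auto
      with eqv[of v] prime_gt_0_nat[OF p] show False by simp
    qed
    have "n = nsm p (\<alpha> - m) + fullm (p - 1)"
    proof (rule poly_mapping_eqI)
      fix v
      have "p * Poly_Mapping.lookup m v \<le> p * Poly_Mapping.lookup \<alpha> v" using le[of v] by simp
      thus "Poly_Mapping.lookup n v = Poly_Mapping.lookup (nsm p (\<alpha> - m) + fullm (p - 1)) v"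
        using eqv[of v] by (simp add: lookup_add lookup_minus right_diff_distrib')
    qed
    with False show False by blast
  qed
  moreover have "cartier p \<pi> (Poly_Mapping.single q d) = 0" if "\<And>\<alpha>. q \<noteq> nsm p \<alpha> + fullm (p - 1)"
    for q :: "'v \<Rightarrow>\<^sub>0 nat" and d
    using that by (intro poly_mapping_eqI) (auto simp: lookup_cartier lookup_single when_def pi_0)
  ultimately show ?thesis using False by (simp add: single_power mult_single)
qed

text \<open>Both sides are additive in g and, by Frobenius, in a; this leaves the case of
  monomials.\<close>

lemma cartier_power: "cartier p \<pi> (a ^ p * g) = a * cartier p \<pi> (g :: ('v::finite, 'k) mpoly)"
proof (induction a rule: poly_mapping_induct)
  case zero
  thus ?case using prime_gt_0_nat[OF p] by (simp add: cartier_0 zero_power)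
next
  case (single m c)
  show ?case
    by (induction g rule: poly_mapping_induct)
       (auto simp: cartier_0 cartier_power_single cartier_add distrib_left)
next
  case (add a b)
  have "(a + b) ^ p = a ^ p + b ^ p"
    by (rule freshmans_dream) (use p char in \<open>simp_all add: CHAR_mpoly\<close>)
  with add show ?case by (simp add: distrib_right cartier_add)
qed

end

text \<open>A weight takes the place of a monomial order: one monomial has to outweigh the others
  strictly, while ties among the others are harmless.\<close>

definition monic_lead :: "(('v \<Rightarrow>\<^sub>0 nat) \<Rightarrow> nat) \<Rightarrow> ('v, 'k::field) mpoly \<Rightarrow> ('v \<Rightarrow>\<^sub>0 nat) \<Rightarrow> bool" where
  "monic_lead W f m \<longleftrightarrow> (\<exists>g. f = Poly_Mapping.single m 1 + g \<and> (\<forall>k\<in>Poly_Mapping.keys g. W k < W m))"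

lemma monic_lead_single: "monic_lead W (Poly_Mapping.single m 1) m"
  unfolding monic_lead_def by (intro exI[of _ 0]) auto

lemma monic_lead_mult:
  assumes W: "\<And>a b. W (a + b) = W a + W b" and "monic_lead W f m" "monic_lead W g n"
  shows "monic_lead W (f * g) (m + n)"
proof -
  from assms obtain f0 g0 where *: "f = Poly_Mapping.single m 1 + f0" "g = Poly_Mapping.single n 1 + g0"
    and f0: "\<And>k. k \<in> Poly_Mapping.keys f0 \<Longrightarrow> W k < W m"
    and g0: "\<And>k. k \<in> Poly_Mapping.keys g0 \<Longrightarrow> W k < W n"
    by (auto simp: monic_lead_def)
  let ?h = "Poly_Mapping.single m 1 * g0 + f0 * (Poly_Mapping.single n 1 + g0)"
  have "f * g = Poly_Mapping.single (m + n) 1 + ?h"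
    by (simp add: * algebra_simps mult_single)
  moreover have "W k < W (m + n)" if "k \<in> Poly_Mapping.keys ?h" for k
  proof -
    from that consider "k \<in> Poly_Mapping.keys (Poly_Mapping.single m 1 * g0)"
      | "k \<in> Poly_Mapping.keys (f0 * (Poly_Mapping.single n 1 + g0))"
      using keys_add[of "Poly_Mapping.single m 1 * g0" "f0 * (Poly_Mapping.single n 1 + g0)"] by blast
    thus ?thesis
    proof cases
      case 1
      then obtain b where "k = m + b" "b \<in> Poly_Mapping.keys g0"
        using keys_mult[of "Poly_Mapping.single m 1" g0] by (auto split: if_splits)
      thus ?thesis using g0[of b] by (simp add: W)
    next
      case 2
      then obtain a b where "k = a + b" "a \<in> Poly_Mapping.keys f0" "b \<in> Poly_Mapping.keys (Poly_Mapping.single n 1 + g0)"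
        using keys_mult[of f0 "Poly_Mapping.single n 1 + g0"] by auto
      moreover from this(3) have "b = n \<or> b \<in> Poly_Mapping.keys g0"
        using keys_add[of "Poly_Mapping.single n 1" g0] by (auto split: if_splits)
      ultimately show ?thesis using f0[of a] g0[of b] by (auto simp: W)
    qed
  qed
  ultimately show ?thesis unfolding monic_lead_def by blast
qed

lemma monic_lead_prod:
  assumes W: "\<And>a b. W (a + b) = W a + W b" and "finite A" "\<And>x. x \<in> A \<Longrightarrow> monic_lead W (f x) (m x)"
  shows "monic_lead W (prod f A) (sum m A)"
  using assms(2,3)
proof (induction A rule: finite_induct)
  case empty
  thus ?case using monic_lead_single[of W 0] by simp
qed (auto intro: monic_lead_mult[OF W])

text \<open>The coefficients read by \<open>cartier\<close> sit at exponents dominating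
  \<open>fullm (p - 1)\<close>. Their weight is at least that of the leading monomial, so the
  remaining terms of F are never seen.\<close>

lemma (in frobenius_section) cartier_monic_lead:
  assumes W: "\<And>a b. W (a + b) = W a + W b" and F: "monic_lead W F (fullm (p - 1))"
  shows "cartier p \<pi> F = (1 :: ('v::finite, 'k) mpoly)"
proof -
  obtain g where g: "F = Poly_Mapping.single (fullm (p - 1)) 1 + g"
      "\<And>k. k \<in> Poly_Mapping.keys g \<Longrightarrow> W k < W (fullm (p - 1))"
    using F by (auto simp: monic_lead_def)
  show ?thesis
  proof (rule poly_mapping_eqI)
    fix \<alpha> :: "'v \<Rightarrow>\<^sub>0 nat"
    have "Poly_Mapping.lookup g (nsm p \<alpha> + fullm (p - 1)) = 0"
      using g(2)[of "nsm p \<alpha> + fullm (p - 1)"] by (auto simp: W in_keys_iff)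
    moreover have "nsm p \<alpha> + fullm (p - 1) = fullm (p - 1) \<longleftrightarrow> \<alpha> = 0"
      using inj_shift[THEN injD, of \<alpha> 0] by (auto simp: poly_mapping_eq_iff fun_eq_iff lookup_add)
    ultimately show "Poly_Mapping.lookup (cartier p \<pi> F) \<alpha> = Poly_Mapping.lookup 1 \<alpha>"
      by (auto simp: lookup_cartier g(1) lookup_add lookup_single when_def pi_add pi_0 pi_1 lookup_one)
  qed
qed

section \<open>A criterion for compatibility with local powers\<close>

lemma is_ideal_colon: "is_ideal K \<Longrightarrow> is_ideal {b. s * b \<in> K}"
  unfolding is_ideal_def by (simp add: distrib_left mult.left_commute[of s])

lemma idl_mult_mem:
  assumes "a \<in> idl S" "b \<in> idl T" "is_ideal K" "\<And>s t. s \<in> S \<Longrightarrow> t \<in> T \<Longrightarrow> s * t \<in> K"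
  shows "a * b \<in> K"
proof -
  have "s * b \<in> K" if "s \<in> S" for s
    using idl_least[OF is_ideal_colon[OF assms(3), of s], of T] assms(2,4) that by blast
  hence "idl S \<subseteq> {a. b * a \<in> K}"
    by (intro idl_least[OF is_ideal_colon[OF assms(3)]]) (auto simp: mult.commute)
  thus ?thesis using assms(1) by (auto simp: mult.commute)
qed

lemma ipow_mono: "I \<subseteq> J \<Longrightarrow> ipow I n \<subseteq> ipow J n"
proof (induction n)
  case (Suc n)
  show ?case unfolding ipow_Suc[of I]
  proof (rule ideal_prod_subset)
    show "a * b \<in> ipow J (Suc n)" if "a \<in> ipow I n" "b \<in> I" for a b
      using Suc that by (intro ipow_mem_Suc) auto
    show "a + b \<in> ipow J (Suc n)" if "a \<in> ipow J (Suc n)" "b \<in> ipow J (Suc n)" for a b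
      using ideal_prod.sum[of a ring_of_type_algebra "ipow J n" J b] that
      by (simp add: ipow_Suc ring_of_type_algebra_def)
  qed
qed (simp add: ipow_0)

lemma ipow_idl_monomials:
  assumes "finite Z"
  shows "ipow (idl Z) M \<subseteq> idl {\<Prod>z\<in>Z. z ^ \<gamma> z |\<gamma>. sum \<gamma> Z = M}"
proof (induction M)
  case 0
  have "1 \<in> {\<Prod>z\<in>Z. z ^ \<gamma> z |\<gamma>. sum \<gamma> Z = 0}"
    by (rule CollectI, rule exI[of _ "\<lambda>_. 0"]) simp
  hence "1 \<in> idl {\<Prod>z\<in>Z. z ^ \<gamma> z |\<gamma>. sum \<gamma> Z = 0}" by (rule idl_base)
  hence "r \<in> idl {\<Prod>z\<in>Z. z ^ \<gamma> z |\<gamma>. sum \<gamma> Z = 0}" for r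
    using is_ideal_mult[OF is_ideal_idl, of 1 _ r] by (simp only: mult_1_right)
  thus ?case by (intro subsetI)
next
  case (Suc M)
  let ?K = "idl {\<Prod>z\<in>Z. z ^ \<gamma> z |\<gamma>. sum \<gamma> Z = Suc M}"
  have step: "(\<Prod>z\<in>Z. z ^ \<gamma> z) * t \<in> ?K" if "sum \<gamma> Z = M" "t \<in> Z" for \<gamma> t
  proof (rule idl_base, rule CollectI, intro exI[of _ "\<gamma>(t := Suc (\<gamma> t))"] conjI)
    show "(\<Prod>z\<in>Z. z ^ \<gamma> z) * t = (\<Prod>z\<in>Z. z ^ (\<gamma>(t := Suc (\<gamma> t))) z)"
    proof -
      have "(\<Prod>z\<in>Z - {t}. z ^ (\<gamma>(t := Suc (\<gamma> t))) z) = (\<Prod>z\<in>Z - {t}. z ^ \<gamma> z)"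
        by (intro prod.cong) auto
      thus ?thesis
        unfolding prod.remove[OF assms that(2), of "\<lambda>z. z ^ \<gamma> z"]
          prod.remove[OF assms that(2), of "\<lambda>z. z ^ (\<gamma>(t := Suc (\<gamma> t))) z"]
        by (simp add: mult_ac)
    qed
    show "sum (\<gamma>(t := Suc (\<gamma> t))) Z = Suc M"
    proof -
      have "sum (\<gamma>(t := Suc (\<gamma> t))) (Z - {t}) = sum \<gamma> (Z - {t})"
        by (intro sum.cong) auto
      thus ?thesis
        using that(1) unfolding sum.remove[OF assms that(2), of \<gamma>]
          sum.remove[OF assms that(2), of "\<gamma>(t := Suc (\<gamma> t))"]
        by simp
    qed
  qed
  show ?case unfolding ipow_Suc
  proof (rule ideal_prod_subset)
    fix a b assume "a \<in> ipow (idl Z) M" "b \<in> idl Z"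
    hence "a \<in> idl {\<Prod>z\<in>Z. z ^ \<gamma> z |\<gamma>. sum \<gamma> Z = M}" "b \<in> idl Z"
      using Suc.IH by blast+
    thus "a * b \<in> ?K"
    proof (rule idl_mult_mem[OF _ _ is_ideal_idl])
      fix s t assume "s \<in> {\<Prod>z\<in>Z. z ^ \<gamma> z |\<gamma>. sum \<gamma> Z = M}" "t \<in> Z"
      thus "s * t \<in> ?K" using step by blast
    qed
  qed (rule is_ideal_add[OF is_ideal_idl])
qed

text \<open>Divide each exponent of a monomial of degree M by p. The remainders add up to at most
  \<open>card Z * (p - 1)\<close>, so p times the sum of the quotients is at least n p + 1; by
  integrality the quotients add up to at least n + 1.\<close>

lemma ipow_pigeonhole:
  assumes Z: "finite Z" and p: "p > 0" and M: "M = card Z * (p - 1) + n * p + 1"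
  shows "ipow (idl Z) M \<subseteq> idl {w ^ p |w. w \<in> ipow (idl Z) (n + 1)}"
proof -
  have "(\<Prod>z\<in>Z. z ^ \<gamma> z) \<in> idl {w ^ p |w. w \<in> ipow (idl Z) (n + 1)}" if \<gamma>: "sum \<gamma> Z = M" for \<gamma>
  proof -
    define w where "w = (\<Prod>z\<in>Z. z ^ (\<gamma> z div p))"
    have "M \<le> (\<Sum>z\<in>Z. p * (\<gamma> z div p) + (p - 1))"
      unfolding \<gamma>[symmetric]
    proof (rule sum_mono)
      fix z
      have "\<gamma> z = p * (\<gamma> z div p) + \<gamma> z mod p" by simp
      moreover have "\<gamma> z mod p < p" using p by simp
      ultimately show "\<gamma> z \<le> p * (\<gamma> z div p) + (p - 1)" by linarith
    qed
    hence "n * p + 1 \<le> p * (\<Sum>z\<in>Z. \<gamma> z div p)"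
      by (simp add: M sum.distrib sum_distrib_left)
    hence n: "n + 1 \<le> (\<Sum>z\<in>Z. \<gamma> z div p)"
    proof (rule contrapos_pp)
      assume "\<not> n + 1 \<le> (\<Sum>z\<in>Z. \<gamma> z div p)"
      hence "p * (\<Sum>z\<in>Z. \<gamma> z div p) \<le> p * n" by (intro mult_le_mono2) simp
      thus "\<not> n * p + 1 \<le> p * (\<Sum>z\<in>Z. \<gamma> z div p)"
        using mult.commute[of n p] by linarith
    qed
    have "w \<in> ipow (idl Z) (\<Sum>z\<in>Z. \<gamma> z div p)"
      unfolding w_def
      by (rule ipow_prod[OF is_ideal_idl])
         (use ipow_power[OF is_ideal_idl ipow_1[OF is_ideal_idl idl_base]] in auto)
    with n have "w \<in> ipow (idl Z) (n + 1)"
      using ipow_antimono[OF is_ideal_idl n] by blast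
    moreover have "(\<Prod>z\<in>Z. z ^ \<gamma> z) = (\<Prod>z\<in>Z. z ^ (\<gamma> z mod p)) * w ^ p"
      by (simp add: w_def prod_power_distrib prod.distrib[symmetric] power_mult[symmetric] power_add[symmetric])
    ultimately show ?thesis
      using is_ideal_mult[OF is_ideal_idl idl_base] by (metis (mono_tags, lifting) mem_Collect_eq)
  qed
  hence "idl {\<Prod>z\<in>Z. z ^ \<gamma> z |\<gamma>. sum \<gamma> Z = M} \<subseteq> idl {w ^ p |w. w \<in> ipow (idl Z) (n + 1)}"
    by (intro idl_mono_idl) auto
  with ipow_idl_monomials[OF Z, of M] show ?thesis by blast
qed

text \<open>Locally at \<open>Q\<close> the ideal \<open>Q\<close> has \<open>h\<close> generators, so that \<open>f\<^sup>p\<^sup>-\<^sup>1 Q\<^sup>n\<^sup>p\<^sup>+\<^sup>1\<close> is contained in the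
  Frobenius power of \<open>Q\<^sup>n\<^sup>+\<^sup>1\<close> by the pigeonhole principle.\<close>

lemma cartier_local_power:
  fixes T :: "'a::idom \<Rightarrow> 'a"
  assumes Q: "is_prime Q" and Z: "finite Z" "Z \<subseteq> Q" and s: "s \<notin> Q" "\<And>q. q \<in> Q \<Longrightarrow> s * q \<in> idl Z"
    and f: "f \<in> ipow Q h" "card Z \<le> h" and p: "p > 0"
    and T_add: "\<And>a b. T (a + b) = T a + T b"
    and T_power: "\<And>a b. T (a ^ p * b) = a * T b"
    and g: "g \<in> local_power Q (n * p + 1)"
  shows "T (f ^ (p - 1) * g) \<in> local_power Q (n + 1)"
proof -
  note I = is_prime_ideal[OF Q]
  obtain t where t: "t \<notin> Q" "t * g \<in> ipow Q (n * p + 1)"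
    using g by (auto simp: local_power_iff[OF Q])
  define M where "M = card Z * (p - 1) + n * p + 1"
  \<comment> \<open>One factor s for each factor from Q turns local generation of Q by Z into local
    generation of its powers.\<close>
  have clear: "s ^ k * x \<in> ipow (idl Z) k" if "x \<in> ipow Q k" for x k
    using that
  proof (induction k arbitrary: x)
    case (Suc k)
    have "ipow Q (Suc k) \<subseteq> {x. s ^ Suc k * x \<in> ipow (idl Z) (Suc k)}"
      unfolding ipow_Suc[of Q]
    proof (rule ideal_prod_subset)
      fix a b assume "a \<in> ipow Q k" "b \<in> Q"
      hence "(s ^ k * a) * (s * b) \<in> ipow (idl Z) (Suc k)"
        by (intro ipow_mem_Suc Suc.IH s)
      thus "a * b \<in> {x. s ^ Suc k * x \<in> ipow (idl Z) (Suc k)}" by (simp add: mult_ac)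
    next
      fix a b assume "a \<in> {x. s ^ Suc k * x \<in> ipow (idl Z) (Suc k)}" "b \<in> {x. s ^ Suc k * x \<in> ipow (idl Z) (Suc k)}"
      thus "a + b \<in> {x. s ^ Suc k * x \<in> ipow (idl Z) (Suc k)}"
        unfolding mem_Collect_eq distrib_left by (intro is_ideal_add[OF is_ideal_ipow[OF is_ideal_idl]])
    qed
    with Suc.prems show ?case by blast
  qed (simp add: ipow_0)
  have "f ^ (p - 1) * (t * g) \<in> ipow Q (h * (p - 1) + (n * p + 1))"
    by (rule ipow_mult[OF I ipow_power[OF I f(1)] t(2)])
  moreover have "M \<le> h * (p - 1) + (n * p + 1)"
    using f(2) by (simp add: M_def)
  ultimately have "f ^ (p - 1) * (t * g) \<in> ipow Q M"
    using ipow_antimono[OF I] by blast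
  from clear[OF this] have "s ^ M * (f ^ (p - 1) * (t * g)) \<in> idl {w ^ p |w. w \<in> ipow (idl Z) (n + 1)}"
    using ipow_pigeonhole[OF Z(1) p M_def] by blast
  \<comment> \<open>The clearing factor s^M t is completed to a p-th power, which T releases as s^M
    t, an element outside Q.\<close>
  hence "(s ^ M * t) ^ (p - 1) * (s ^ M * (f ^ (p - 1) * (t * g))) \<in> idl {w ^ p |w. w \<in> ipow (idl Z) (n + 1)}"
    by (rule is_ideal_mult[OF is_ideal_idl])
  also have "(s ^ M * t) ^ (p - 1) * (s ^ M * (f ^ (p - 1) * (t * g))) = ((s ^ M * t) ^ (p - 1) * (s ^ M * t)) * (f ^ (p - 1) * g)"
    by (simp only: mult_ac)
  also have "(s ^ M * t) ^ (p - 1) * (s ^ M * t) = (s ^ M * t) ^ p"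
    using p by (metis power_minus_mult)
  finally have mem: "(s ^ M * t) ^ p * (f ^ (p - 1) * g) \<in> idl {w ^ p |w. w \<in> ipow (idl Z) (n + 1)}" .
  have T_0: "T 0 = 0" using T_power[of 0 0] p by (simp add: zero_power)
  have T_idl: "T x \<in> ipow Q (n + 1)" if "x \<in> idl {w ^ p |w. w \<in> ipow (idl Z) (n + 1)}" for x
    using that
  proof (induction x rule: idl.induct)
    case idl_zero
    show ?case using T_0 is_ideal_0[OF is_ideal_ipow[OF I]] by simp
  next
    case (idl_step w' x r)
    then obtain w where w: "w' = w ^ p" "w \<in> ipow (idl Z) (n + 1)" by blast
    hence "w \<in> ipow Q (n + 1)"
      using ipow_mono[OF idl_least[OF I Z(2)]] by blast
    hence "w * T r + T x \<in> ipow Q (n + 1)"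
      using idl_step by (intro is_ideal_add[OF is_ideal_ipow[OF I]] is_ideal_mult'[OF is_ideal_ipow[OF I]])
    moreover have "T (r * w' + x) = w * T r + T x"
      using T_power[of w r] by (simp add: T_add w(1) mult.commute)
    ultimately show ?case by simp
  qed
  from T_idl[OF mem] have "(s ^ M * t) * T (f ^ (p - 1) * g) \<in> ipow Q (n + 1)"
    by (simp only: T_power)
  moreover have "s ^ M * t \<notin> Q"
    using is_prime_power[OF Q s(1)] t(1) by (simp add: is_prime_mult[OF Q])
  ultimately show ?thesis unfolding local_power_iff[OF Q] by blast
qed

section \<open>The polynomial attached to an ordering of the vertices\<close>

definition minor :: "'d \<Rightarrow> 'd \<Rightarrow> ('d, 'k::field) xy_poly" where
  "minor i j = var (False, i) * var (True, j) - var (False, j) * var (True, i)"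

text \<open>The two outer variables make the leading monomial the product of all variables; they also
  compensate for endpoints of \<open>vs\<close> which lie in a cut set.\<close>

definition path_poly :: "'d list \<Rightarrow> ('d::{finite,linorder}, 'k::field) xy_poly" where
  "path_poly vs = var (True, hd vs) * var (False, last vs) * (\<Prod>j<length vs - 1. minor (vs ! j) (vs ! Suc j))"

text \<open>The weight ignores the x-variables and gives y_v the position of v in \<open>vs\<close>.
  In the minor of two consecutive vertices, x of the earlier times y of the later then wins by one.
  These leading terms miss only the last x and the first y, which the outer variables
  supply.\<close>

lemma path_poly_monic_lead:
  fixes vs :: "'d::{finite,linorder} list"
  assumes vs: "distinct vs" "set vs = UNIV"
  shows "\<exists>W. (\<forall>a b. W (a + b) = W a + W b) \<and> monic_lead W (path_poly vs :: ('d, 'k::field) xy_poly) (fullm 1)"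
proof -
  define idx where "idx v = inv_into {..<length vs} ((!) vs) v" for v
  have idx: "idx (vs ! j) = j" if "j < length vs" for j
    unfolding idx_def using that vs(1) by (intro inv_into_f_f) (auto simp: inj_on_nth)
  define W where "W m = (\<Sum>v\<in>UNIV. idx v * Poly_Mapping.lookup m (True, v))" for m :: "(bool \<times> 'd) \<Rightarrow>\<^sub>0 nat"
  have W_add: "W (a + b) = W a + W b" for a b
    by (simp add: W_def lookup_add distrib_left sum.distrib)
  have W_F: "W (Poly_Mapping.single (False, v) 1) = 0" for v
    by (simp add: W_def lookup_single)
  have W_T: "W (Poly_Mapping.single (True, v) 1) = idx v" for v
    by (simp add: W_def lookup_single when_def if_distrib cong: if_cong)
  obtain e where e: "length vs = Suc e"
    using vs by (cases vs) auto
  let ?F = "\<lambda>v::'d. Poly_Mapping.single (False, v) (1::nat)" and ?T = "\<lambda>v::'d. Poly_Mapping.single (True, v) (1::nat)"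
  have lead_minor: "monic_lead W (minor (vs ! j) (vs ! Suc j) :: ('d, 'k) xy_poly) (?F (vs ! j) + ?T (vs ! Suc j))"
    if "j < e" for j
    unfolding monic_lead_def
  proof (intro exI[of _ "Poly_Mapping.single (?F (vs ! Suc j) + ?T (vs ! j)) (- 1)"] conjI ballI)
    show "(minor (vs ! j) (vs ! Suc j) :: ('d, 'k) xy_poly) = Poly_Mapping.single (?F (vs ! j) + ?T (vs ! Suc j)) 1
            + Poly_Mapping.single (?F (vs ! Suc j) + ?T (vs ! j)) (- 1)"
      by (simp add: minor_def var_def mult_single single_uminus)
    fix k assume "k \<in> Poly_Mapping.keys (Poly_Mapping.single (?F (vs ! Suc j) + ?T (vs ! j)) (- 1 :: 'k))"
    hence "k = ?F (vs ! Suc j) + ?T (vs ! j)" by (auto split: if_splits)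
    thus "W k < W (?F (vs ! j) + ?T (vs ! Suc j))"
      using that e W_F W_T by (simp add: W_add idx)
  qed
  have "monic_lead W (path_poly vs :: ('d, 'k) xy_poly) (?T (hd vs) + ?F (last vs) + (\<Sum>j<e. ?F (vs ! j) + ?T (vs ! Suc j)))"
    unfolding path_poly_def e diff_Suc_1
  proof (rule monic_lead_mult[OF W_add])
    show "monic_lead W (var (True, hd vs) * var (False, last vs) :: ('d, 'k) xy_poly) (?T (hd vs) + ?F (last vs))"
      unfolding var_def by (rule monic_lead_mult[OF W_add]) (rule monic_lead_single)+
    show "monic_lead W (\<Prod>j<e. minor (vs ! j) (vs ! Suc j) :: ('d, 'k) xy_poly) (\<Sum>j<e. ?F (vs ! j) + ?T (vs ! Suc j))"
      by (rule monic_lead_prod[OF W_add finite_lessThan], rule lead_minor, simp)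
  qed
  also have "?T (hd vs) + ?F (last vs) + (\<Sum>j<e. ?F (vs ! j) + ?T (vs ! Suc j)) = fullm 1"
  proof -
    have "vs \<noteq> []" using e by auto
    hence "?T (hd vs) + ?F (last vs) + (\<Sum>j<e. ?F (vs ! j) + ?T (vs ! Suc j))
            = (\<Sum>j<Suc e. ?F (vs ! j)) + (\<Sum>j<Suc e. ?T (vs ! j))"
      unfolding sum.lessThan_Suc_shift[of _ e, where g = "\<lambda>j. ?T (vs ! j)"] sum.lessThan_Suc[of "\<lambda>j. ?F (vs ! j)"]
      by (simp add: sum.distrib hd_conv_nth last_conv_nth e ac_simps)
    also have "\<dots> = (\<Sum>j<length vs. ?F (vs ! j) + ?T (vs ! j))"
      by (simp add: e sum.distrib)
    also have "\<dots> = (\<Sum>v\<in>UNIV. ?F v + ?T v)"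
    proof (rule sum.reindex_bij_betw)
      show "bij_betw ((!) vs) {..<length vs} UNIV"
        using bij_betw_nth[OF vs(1), of "{..<length vs}" UNIV] vs(2) by simp
    qed
    also have "\<dots> = fullm 1"
    proof (rule poly_mapping_eqI)
      fix bv :: "bool \<times> 'd"
      obtain b v where "bv = (b, v)" by (cases bv)
      thus "Poly_Mapping.lookup (\<Sum>v\<in>UNIV. ?F v + ?T v) bv = Poly_Mapping.lookup (fullm 1) bv"
        by (cases b) (simp_all add: lookup_sum lookup_add lookup_single sum.distrib when_def)
    qed
    finally show ?thesis .
  qed
  finally show ?thesis using W_add by (intro exI[of _ W]) simp
qed

lemma (in frobenius_section) cartier_path_poly:
  fixes vs :: "'d::{finite,linorder} list"
  assumes vs: "distinct vs" "set vs = UNIV"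
  shows "cartier p \<pi> (path_poly vs ^ (p - 1) :: ('d, 'k) xy_poly) = 1"
proof -
  obtain W where W: "\<And>a b. W (a + b) = W a + W b" "monic_lead W (path_poly vs :: ('d, 'k) xy_poly) (fullm 1)"
    using path_poly_monic_lead[OF vs] by blast
  have "monic_lead W (\<Prod>i<p - 1. path_poly vs :: ('d, 'k) xy_poly) (\<Sum>i<p - 1. fullm 1)"
    by (rule monic_lead_prod[OF W(1)]) (simp_all only: finite_lessThan W(2))
  moreover have "(\<Sum>i<p - 1. fullm 1) = (fullm (p - 1) :: (bool \<times> 'd) \<Rightarrow>\<^sub>0 nat)"
    by (rule poly_mapping_eqI) (simp add: lookup_sum)
  ultimately show ?thesis
    by (intro cartier_monic_lead[OF W(1)]) simp
qed

section \<open>Dimension of a polynomial ring\<close>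

text \<open>Each exponent is bounded separately, not the total degree, so that the monomials in
  question are counted by a plain power of K + 1.\<close>

definition box :: "nat \<Rightarrow> ('v, 'k::field) mpoly \<Rightarrow> bool" where
  "box K f \<longleftrightarrow> (\<forall>q\<in>Poly_Mapping.keys f. \<forall>v. Poly_Mapping.lookup q v \<le> K)"

lemma box_mono: "box K f \<Longrightarrow> K \<le> L \<Longrightarrow> box L f"
  unfolding box_def using le_trans by blast

lemma box_1: "box 0 1"
  by (simp add: box_def)

lemma box_mult: "box K f \<Longrightarrow> box L g \<Longrightarrow> box (K + L) (f * g)"
  unfolding box_def
proof (intro ballI allI)
  fix q v
  assume f: "\<forall>q\<in>Poly_Mapping.keys f. \<forall>v. Poly_Mapping.lookup q v \<le> K"
    and g: "\<forall>q\<in>Poly_Mapping.keys g. \<forall>v. Poly_Mapping.lookup q v \<le> L"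
    and "q \<in> Poly_Mapping.keys (f * g)"
  then obtain a b where "q = a + b" "a \<in> Poly_Mapping.keys f" "b \<in> Poly_Mapping.keys g"
    using keys_mult[of f g] by blast
  with f g show "Poly_Mapping.lookup q v \<le> K + L" by (simp add: lookup_add add_mono)
qed

lemma box_power: "box K f \<Longrightarrow> box (n * K) (f ^ n)"
proof (induction n)
  case (Suc n)
  thus ?case using box_mult[of K f "n * K" "f ^ n"] by simp
qed (simp add: box_1)

lemma box_prod: "finite A \<Longrightarrow> (\<And>x. x \<in> A \<Longrightarrow> box K (f x)) \<Longrightarrow> box (card A * K) (prod f A)"
proof (induction A rule: finite_induct)
  case (insert x A)
  hence "box K (f x)" "box (card A * K) (prod f A)" by auto
  from box_mult[OF this] insert(1,2) show ?case by simp
qed (simp add: box_1)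

lemma vector_space_mpoly: "vector_space (\<lambda>c f. const c * (f :: ('v, 'k::field) mpoly))"
  by unfold_locales (simp_all add: const_simps algebra_simps)

lemma box_monomials:
  fixes K :: nat
  defines "B \<equiv> (\<lambda>q. Poly_Mapping.single q 1 :: ('v::finite, 'k::field) mpoly) ` {q. \<forall>v. Poly_Mapping.lookup q v \<le> K}"
  shows "finite B" "card B \<le> (K + 1) ^ card (UNIV :: 'v set)"
    "box K f \<Longrightarrow> f \<in> module.span (\<lambda>c f. const c * f) B"
proof -
  interpret vector_space "\<lambda>c f. const c * (f :: ('v, 'k) mpoly)" by (rule vector_space_mpoly)
  let ?E = "(UNIV :: 'v set) \<rightarrow>\<^sub>E {..K}"
  have E: "finite ?E" "card ?E = (K + 1) ^ card (UNIV :: 'v set)"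
    by (auto simp: card_PiE intro: finite_PiE)
  have sub: "B \<subseteq> (\<lambda>h. Poly_Mapping.single (Abs_poly_mapping h) 1) ` ?E"
    unfolding B_def
  proof clarify
    fix q :: "'v \<Rightarrow>\<^sub>0 nat" assume "\<forall>v. Poly_Mapping.lookup q v \<le> K"
    hence "Poly_Mapping.lookup q \<in> ?E" by auto
    thus "Poly_Mapping.single q 1 \<in> (\<lambda>h. Poly_Mapping.single (Abs_poly_mapping h) 1) ` ?E"
      by (intro image_eqI[of _ _ "Poly_Mapping.lookup q"]) simp_all
  qed
  show "finite B" using finite_subset[OF sub] E(1) by blast
  have "card B \<le> card ((\<lambda>h. Poly_Mapping.single (Abs_poly_mapping h) 1 :: ('v,'k) mpoly) ` ?E)"
    using sub E(1) by (intro card_mono) auto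
  also have "\<dots> \<le> (K + 1) ^ card (UNIV :: 'v set)"
    using card_image_le[OF E(1)] E(2) by metis
  finally show "card B \<le> (K + 1) ^ card (UNIV :: 'v set)" .
  show "f \<in> span B" if "box K f"
  proof -
    have "(\<Sum>q\<in>Poly_Mapping.keys f. Poly_Mapping.single q (Poly_Mapping.lookup f q)) \<in> span B"
    proof (rule span_sum)
      fix q assume "q \<in> Poly_Mapping.keys f"
      hence "Poly_Mapping.single q 1 \<in> B" using that by (auto simp: B_def box_def)
      from span_scale[OF span_base[OF this], of "Poly_Mapping.lookup f q"]
      show "Poly_Mapping.single q (Poly_Mapping.lookup f q) \<in> span B"
        by (simp add: const_def mult_single)
    qed
    thus ?thesis using poly_mapping_sum_singles[of f] by simp
  qed
qed

text \<open>There are \<open>(N + 1)\<^sup>m\<close> monomials of degree at most \<open>N\<close> in each of the \<open>a\<^sub>i\<close>, but they only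
  involve \<open>O(N\<^sup>n)\<close> monomials in the \<open>n\<close> variables.\<close>

lemma algebraically_dependent:
  fixes a :: "nat \<Rightarrow> ('v::finite, 'k::field) mpoly"
  assumes m: "card (UNIV :: 'v set) < m"
  shows "\<exists>A c. finite A \<and> A \<noteq> {} \<and> A \<subseteq> extensional {..<m} \<and> (\<forall>\<alpha>\<in>A. c \<alpha> \<noteq> 0) \<and>
           (\<Sum>\<alpha>\<in>A. const (c \<alpha>) * (\<Prod>i<m. a i ^ \<alpha> i)) = 0"
proof -
  interpret vector_space "\<lambda>c f. const c * (f :: ('v, 'k) mpoly)" by (rule vector_space_mpoly)
  have "\<exists>D. \<forall>i<m. box D (a i)"
  proof -
    have ex: "\<exists>D. box D f" for f :: "('v, 'k) mpoly"
    proof (intro exI)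
      show "box (Max ((\<lambda>(q, v). Poly_Mapping.lookup q v) ` (Poly_Mapping.keys f \<times> UNIV))) f"
        unfolding box_def by (auto intro!: Max_ge)
    qed
    define d where "d i = (SOME D. box D (a i))" for i
    have "box (d i) (a i)" for i unfolding d_def by (rule someI_ex[OF ex])
    hence "\<forall>i<m. box (\<Sum>i<m. d i) (a i)"
      by (auto intro: box_mono member_le_sum)
    thus ?thesis by blast
  qed
  then obtain D where D: "\<And>i. i < m \<Longrightarrow> box D (a i)" by blast
  define n where "n = card (UNIV :: 'v set)"
  \<comment> \<open>Chosen so that (m N D + 1)^n is at most (C (N + 1))^n = N (N + 1)^n, which is
    below (N + 1)^m because n < m.\<close>
  define C where "C = m * D + 1"
  define N where "N = C ^ n"
  have N: "(m * (N * D) + 1) ^ n < (N + 1) ^ m"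
  proof -
    have "m * (N * D) + 1 \<le> C * (N + 1)" by (simp add: C_def algebra_simps)
    hence "(m * (N * D) + 1) ^ n \<le> (C * (N + 1)) ^ n" by (rule power_mono) simp
    also have "\<dots> = N * (N + 1) ^ n" unfolding power_mult_distrib N_def ..
    also have "\<dots> < (N + 1) ^ Suc n" by simp
    also have "\<dots> \<le> (N + 1) ^ m" using m by (intro power_increasing) (auto simp: n_def)
    finally show ?thesis .
  qed
  let ?E = "{..<m} \<rightarrow>\<^sub>E {..N}"
  define ev where "ev \<alpha> = (\<Prod>i<m. a i ^ \<alpha> i)" for \<alpha>
  have E: "finite ?E" "card ?E = (N + 1) ^ m"
    by (auto simp: card_PiE intro: finite_PiE)
  show ?thesis
  \<comment> \<open>Linear dependence is a property of a set of polynomials, so a coincidence of two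
    products is treated separately; their difference is then the relation.\<close>
  proof (cases "inj_on ev ?E")
    case False
    then obtain \<alpha> \<beta> where ab: "\<alpha> \<in> ?E" "\<beta> \<in> ?E" "\<alpha> \<noteq> \<beta>" "ev \<alpha> = ev \<beta>" by (auto simp: inj_on_def)
    have "const 1 + const (- 1) = (0 :: ('v, 'k) mpoly)"
      by (simp add: const_simps(1) flip: const_simps(3))
    hence "(\<Sum>\<gamma>\<in>{\<alpha>, \<beta>}. const (if \<gamma> = \<alpha> then 1 else - 1) * ev \<gamma>) = 0"
      using ab by (simp add: distrib_right[symmetric])
    with ab show ?thesis
      unfolding ev_def
      by (intro exI[of _ "{\<alpha>, \<beta>}"] exI[of _ "\<lambda>\<gamma>. if \<gamma> = \<alpha> then 1 else - 1"]) (auto simp: PiE_def)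
  next
    case True
    let ?B = "(\<lambda>q. Poly_Mapping.single q 1 :: ('v, 'k) mpoly) ` {q. \<forall>v. Poly_Mapping.lookup q v \<le> m * (N * D)}"
    have "ev ` ?E \<subseteq> span ?B"
    proof clarify
      fix \<alpha> assume \<alpha>: "\<alpha> \<in> ?E"
      have "box (card {..<m} * (N * D)) (ev \<alpha>)"
        unfolding ev_def
      proof (rule box_prod)
        fix i assume i: "i \<in> {..<m}"
        have "box (\<alpha> i * D) (a i ^ \<alpha> i)" using i by (intro box_power D) simp
        moreover have "\<alpha> i * D \<le> N * D" using \<alpha> i by (intro mult_right_mono) auto
        ultimately show "box (N * D) (a i ^ \<alpha> i)" by (rule box_mono)
      qed simp
      thus "ev \<alpha> \<in> span ?B" using box_monomials(3)[of "m * (N * D)" "ev \<alpha>"] by simp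
    qed
    moreover have "card ?B < card (ev ` ?E)"
      using box_monomials(2)[where 'v = 'v and 'k = 'k, of "m * (N * D)"] N
      unfolding card_image[OF True] E(2) n_def by linarith
    ultimately have "dependent (ev ` ?E)"
      using independent_span_bound[OF box_monomials(1), of "ev ` ?E" "m * (N * D)"] by linarith
    then obtain u where u: "\<exists>f\<in>ev ` ?E. u f \<noteq> 0" "(\<Sum>f\<in>ev ` ?E. const (u f) * f) = 0"
      using dependent_finite[of "ev ` ?E"] E(1) by blast
    let ?A = "{\<alpha>\<in>?E. u (ev \<alpha>) \<noteq> 0}"
    have A: "finite ?A" "?A \<noteq> {}" "?A \<subseteq> extensional {..<m}"
    proof -
      show "finite ?A" using E(1) by simp
      show "?A \<noteq> {}" using u(1) by blast
      show "?A \<subseteq> extensional {..<m}" unfolding PiE_def by blast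
    qed
    have "(\<Sum>\<alpha>\<in>?A. const (u (ev \<alpha>)) * ev \<alpha>) = (\<Sum>\<alpha>\<in>?E. const (u (ev \<alpha>)) * ev \<alpha>)"
    proof (rule sum.mono_neutral_left[OF E(1)])
      show "\<forall>\<alpha>\<in>?E - ?A. const (u (ev \<alpha>)) * ev \<alpha> = 0"
        using const_simps(1) by simp
    qed blast
    also have "\<dots> = 0" using u(2) by (simp add: sum.reindex[OF True])
    finally show ?thesis
      using A unfolding ev_def[symmetric]
      by (intro exI[of _ ?A] exI[of _ "\<lambda>\<alpha>. u (ev \<alpha>)"] conjI) simp_all
  qed
qed

lemma const_notin_prime: "is_prime P \<Longrightarrow> c \<noteq> 0 \<Longrightarrow> const c \<notin> P"
  using is_ideal_mult[of P "const c" "const (inverse c)"] is_prime_1[of P] is_prime_ideal[of P]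
  by (auto simp: const_simps(4)[symmetric] const_simps(2))

text \<open>Given a polynomial relation between elements \<open>a\<^sub>i \<in> P\<^sub>i\<^sub>+\<^sub>1 - P\<^sub>i\<close>, cancel powers of \<open>a\<^sub>i\<close> modulo \<open>P\<^sub>i\<close> and
  then set \<open>a\<^sub>i = 0\<close> modulo \<open>P\<^sub>i\<^sub>+\<^sub>1\<close>; eventually a nonzero constant lies in \<open>P\<^sub>m\<close>.\<close>

lemma prime_chain_length_le:
  fixes P :: "nat \<Rightarrow> ('v::finite, 'k::field) mpoly set"
  assumes P: "\<And>i. i \<le> m \<Longrightarrow> is_prime (P i)" and sub: "\<And>i. i < m \<Longrightarrow> P i \<subset> P (Suc i)"
  shows "m \<le> card (UNIV :: 'v set)"
proof (rule ccontr)
  assume m: "\<not> m \<le> card (UNIV :: 'v set)"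
  have ex: "\<exists>x. x \<in> P (Suc i) \<and> x \<notin> P i" if "i < m" for i using sub[OF that] by blast
  define a where "a i = (SOME x. x \<in> P (Suc i) \<and> x \<notin> P i)" for i
  have a: "a i \<in> P (Suc i)" "a i \<notin> P i" if "i < m" for i
    unfolding a_def using someI_ex[OF ex[OF that]] by auto
  define ev where "ev \<alpha> = (\<Prod>i<m. a i ^ \<alpha> i)" for \<alpha>
  have claim: "\<exists>A c. finite A \<and> A \<noteq> {} \<and> A \<subseteq> extensional {..<m} \<and> (\<forall>\<alpha>\<in>A. c \<alpha> \<noteq> 0) \<and> (\<forall>\<alpha>\<in>A. \<forall>i<j. \<alpha> i = 0) \<and>
           (\<Sum>\<alpha>\<in>A. const (c \<alpha>) * ev \<alpha>) \<in> P j" if "j \<le> m" for j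
    using that
  proof (induction j)
    case 0
    obtain A c where A: "finite A" "A \<noteq> {}" "A \<subseteq> extensional {..<m}" "\<forall>\<alpha>\<in>A. c \<alpha> \<noteq> 0"
      "(\<Sum>\<alpha>\<in>A. const (c \<alpha>) * ev \<alpha>) = 0"
      using algebraically_dependent[of m a] m unfolding ev_def by auto
    show ?case
      using A is_ideal_0[OF is_prime_ideal[OF P[of 0]]]
      by (intro exI[of _ A] exI[of _ c]) simp
  next
    case (Suc j)
    then obtain A c where A: "finite A" "A \<noteq> {}" "A \<subseteq> extensional {..<m}" "\<forall>\<alpha>\<in>A. c \<alpha> \<noteq> 0" "\<forall>\<alpha>\<in>A. \<forall>i<j. \<alpha> i = 0"
      and mem: "(\<Sum>\<alpha>\<in>A. const (c \<alpha>) * ev \<alpha>) \<in> P j"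
      by auto
    have jm: "j < m" using Suc.prems by simp
    \<comment> \<open>The largest power of a_j dividing all the products formally; it can be
      cancelled because a_j lies outside the prime P_j.\<close>
    define e where "e = Min ((\<lambda>\<alpha>. \<alpha> j) ` A)"
    have e: "e \<le> \<alpha> j" if "\<alpha> \<in> A" for \<alpha> unfolding e_def using A that by (intro Min_le) auto
    have "e \<in> (\<lambda>\<alpha>. \<alpha> j) ` A" unfolding e_def using A by (intro Min_in) auto
    then obtain \<beta> where \<beta>: "\<beta> \<in> A" "\<beta> j = e" by auto
    define r where "r \<alpha> = ev (\<alpha>(j := \<alpha> j - e))" for \<alpha>
    have ev_upd: "ev (\<alpha>(j := k)) = a j ^ k * (\<Prod>i\<in>{..<m} - {j}. a i ^ \<alpha> i)" for \<alpha> k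
      unfolding ev_def using jm by (subst prod.remove[of _ j]) (auto intro!: prod.cong)
    have ev_r: "ev \<alpha> = a j ^ e * r \<alpha>" if "\<alpha> \<in> A" for \<alpha>
      using e[OF that] ev_upd[of \<alpha> "\<alpha> j"] ev_upd[of \<alpha> "\<alpha> j - e"]
      by (simp add: r_def power_add[symmetric] mult.assoc[symmetric])
    have "(\<Sum>\<alpha>\<in>A. const (c \<alpha>) * ev \<alpha>) = a j ^ e * (\<Sum>\<alpha>\<in>A. const (c \<alpha>) * r \<alpha>)"
      unfolding sum_distrib_left by (intro sum.cong refl) (simp add: ev_r mult_ac)
    hence "(\<Sum>\<alpha>\<in>A. const (c \<alpha>) * r \<alpha>) \<in> P j"
      using mem is_prime_power[OF P a(2)] jm by (simp add: is_prime_mult[OF P])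
    hence rj: "(\<Sum>\<alpha>\<in>A. const (c \<alpha>) * r \<alpha>) \<in> P (Suc j)" using sub[OF jm] by blast
    note I = is_prime_ideal[OF P[OF Suc.prems]]
    \<comment> \<open>The terms from which a_j has disappeared after the cancellation. Minimality of
      e provides at least one, and all other terms lie in P_(j+1).\<close>
    let ?A' = "{\<alpha>\<in>A. \<alpha> j = e}"
    have split: "(\<Sum>\<alpha>\<in>A. const (c \<alpha>) * r \<alpha>) = (\<Sum>\<alpha>\<in>?A'. const (c \<alpha>) * r \<alpha>) + (\<Sum>\<alpha>\<in>A - ?A'. const (c \<alpha>) * r \<alpha>)"
      using A(1) by (subst sum.subset_diff[of ?A']) (auto simp: add.commute)
    have "const (c \<alpha>) * r \<alpha> \<in> P (Suc j)" if \<alpha>: "\<alpha> \<in> A - ?A'" for \<alpha>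
    proof -
      have "e \<le> \<alpha> j" "\<alpha> j \<noteq> e" using \<alpha> e[of \<alpha>] by auto
      then obtain l where "\<alpha> j - e = Suc l" by (metis Suc_diff_Suc le_neq_implies_less)
      hence "r \<alpha> = a j * (a j ^ l * (\<Prod>i\<in>{..<m} - {j}. a i ^ \<alpha> i))"
        unfolding r_def by (simp only: ev_upd power_Suc mult.assoc)
      hence "r \<alpha> \<in> P (Suc j)" using is_ideal_mult'[OF I a(1)[OF jm]] by simp
      thus ?thesis by (rule is_ideal_mult[OF I])
    qed
    hence "(\<Sum>\<alpha>\<in>A - ?A'. const (c \<alpha>) * r \<alpha>) \<in> P (Suc j)" by (rule is_ideal_sum[OF I])
    from is_ideal_diff[OF I rj this] have rj2: "(\<Sum>\<alpha>\<in>?A'. const (c \<alpha>) * r \<alpha>) \<in> P (Suc j)"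
      by (simp add: split)
    let ?z = "\<lambda>\<alpha>::nat \<Rightarrow> nat. \<alpha>(j := 0)"
    have inj: "inj_on ?z ?A'"
    proof (rule inj_onI)
      fix \<alpha> \<beta> assume "\<alpha> \<in> ?A'" "\<beta> \<in> ?A'" and eq: "?z \<alpha> = ?z \<beta>"
      show "\<alpha> = \<beta>"
      proof
        fix i
        show "\<alpha> i = \<beta> i"
          using fun_cong[OF eq, of i] \<open>\<alpha> \<in> ?A'\<close> \<open>\<beta> \<in> ?A'\<close> by (cases "i = j") auto
      qed
    qed
    have undo: "(?z \<alpha>)(j := e) = \<alpha>" if "\<alpha> \<in> ?A'" for \<alpha> using that by auto
    have "(\<Sum>\<beta>\<in>?z ` ?A'. const (c (\<beta>(j := e))) * ev \<beta>) = (\<Sum>\<alpha>\<in>?A'. const (c \<alpha>) * r \<alpha>)"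
      unfolding sum.reindex[OF inj] o_def by (intro sum.cong refl) (auto simp: fun_upd_idem r_def)
    with rj2 have "(\<Sum>\<beta>\<in>?z ` ?A'. const (c (\<beta>(j := e))) * ev \<beta>) \<in> P (Suc j)" by simp
    moreover have "\<forall>\<beta>\<in>?z ` ?A'. c (\<beta>(j := e)) \<noteq> 0" using A(4) undo by auto
    moreover have "\<forall>\<beta>\<in>?z ` ?A'. \<forall>i<Suc j. \<beta> i = 0" using A(5) by (auto simp: less_Suc_eq)
    moreover have "?z ` ?A' \<subseteq> extensional {..<m}" using A(3) jm by (auto simp: extensional_def)
    moreover have "finite (?z ` ?A')" "?z ` ?A' \<noteq> {}" using A(1) \<beta> by auto
    ultimately show ?case
      by (intro exI[of _ "?z ` ?A'"] exI[of _ "\<lambda>\<beta>. c (\<beta>(j := e))"] conjI)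
  qed
  obtain A c where A: "finite A" "A \<noteq> {}" "A \<subseteq> extensional {..<m}" "\<forall>\<alpha>\<in>A. c \<alpha> \<noteq> 0" "\<forall>\<alpha>\<in>A. \<forall>i<m. \<alpha> i = 0"
      and mem: "(\<Sum>\<alpha>\<in>A. const (c \<alpha>) * ev \<alpha>) \<in> P m"
    using claim[OF order_refl] by (elim exE conjE) (rule that)
  obtain \<alpha> where \<alpha>: "\<alpha> \<in> A" using A(2) by blast
  \<comment> \<open>All exponents below m vanish and extensional functions agree elsewhere, so a
    single term is left.\<close>
  have "\<beta> = \<alpha>" if "\<beta> \<in> A" for \<beta>
  proof (rule extensionalityI)
    show "\<beta> \<in> extensional {..<m}" "\<alpha> \<in> extensional {..<m}" using A(3) \<alpha> that by auto
    show "\<beta> i = \<alpha> i" if "i \<in> {..<m}" for i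
      using bspec[OF A(5) \<alpha>] bspec[OF A(5) \<open>\<beta> \<in> A\<close>] that by simp
  qed
  hence "A = {\<alpha>}" using \<alpha> by blast
  moreover have "ev \<alpha> = 1" using bspec[OF A(5) \<alpha>] by (simp add: ev_def)
  ultimately have "const (c \<alpha>) \<in> P m" using mem by simp
  thus False using const_notin_prime[OF P[of m]] A(4) \<alpha> by blast
qed

section \<open>Ideals generated by variables and minors\<close>

text \<open>The fibres of r are the blocks within which all minors are taken. \<open>D\<close>
  consists of variables rather than vertices, so that x_i and y_i can be killed in separate steps of
  a chain of primes.\<close>

definition vm_gens :: "(bool \<times> 'd) set \<Rightarrow> ('d \<Rightarrow> 'd) \<Rightarrow> ('d::{finite,linorder}, 'k::field) xy_poly set" where
  "vm_gens D r = var ` D \<union> {minor i j |i j. i \<noteq> j \<and> r i = r j}"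

definition vm_ideal :: "(bool \<times> 'd) set \<Rightarrow> ('d \<Rightarrow> 'd) \<Rightarrow> ('d::{finite,linorder}, 'k::field) xy_poly set" where
  "vm_ideal D r = idl (vm_gens D r)"

text \<open>Killing x_i in a block with a second vertex j would leave the product x_j y_i in the
  ideal, which then need not be prime.\<close>

definition vm_ok :: "(bool \<times> 'd) set \<Rightarrow> ('d \<Rightarrow> 'd) \<Rightarrow> bool" where
  "vm_ok D r \<longleftrightarrow> (\<forall>i j b. i \<noteq> j \<longrightarrow> r i = r j \<longrightarrow> (b, i) \<notin> D)"

text \<open>The parametrisation \<open>x\<^sub>i = t\<^sub>i a\<^sub>r\<^sub>(\<^sub>i\<^sub>)\<close>, \<open>y\<^sub>i = t\<^sub>i b\<^sub>r\<^sub>(\<^sub>i\<^sub>)\<close>, with \<open>t\<^sub>i = (True, True, i)\<close>,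
  \<open>a\<^sub>c = (False, False, c)\<close> and \<open>b\<^sub>c = (False, True, c)\<close>.\<close>

definition vm_param :: "(bool \<times> 'd) set \<Rightarrow> ('d \<Rightarrow> 'd) \<Rightarrow>
    ('d::{finite,linorder}, 'k::field) xy_poly \<Rightarrow> (bool \<times> bool \<times> 'd, 'k) mpoly" where
  "vm_param D r = subst (\<lambda>(b, i). if (b, i) \<in> D then 0 else var (True, True, i) * var (False, b, r i))"

lemma is_ideal_vm: "is_ideal (vm_ideal D r)"
  unfolding vm_ideal_def by (rule is_ideal_idl)

lemma vm_param_var: "vm_param D r (var (b, i)) = (if (b, i) \<in> D then 0 else var (True, True, i) * var (False, b, r i))"
  by (simp add: vm_param_def)

lemma rhom_vm_param: "rhom (vm_param D r)"
  unfolding vm_param_def by (rule rhom_subst)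

lemma minor_same [simp]: "minor i i = 0"
  by (simp add: minor_def)

lemma minor_swap: "minor j i = - minor i j"
  by (simp add: minor_def)

lemma vm_ideal_minor: "r i = r j \<Longrightarrow> minor i j \<in> vm_ideal D r"
proof (cases "i = j")
  case False
  assume "r i = r j"
  with False have "minor i j \<in> vm_gens D r" by (auto simp: vm_gens_def)
  thus ?thesis unfolding vm_ideal_def by (rule idl_base)
qed (simp add: is_ideal_0[OF is_ideal_vm])

lemma vm_ideal_var: "v \<in> D \<Longrightarrow> var v \<in> vm_ideal D r"
  unfolding vm_ideal_def by (rule idl_base) (simp add: vm_gens_def)

lemma vm_ideal_subset:
  assumes "is_ideal I" "\<And>v. v \<in> D \<Longrightarrow> var v \<in> I" "\<And>i j. i \<noteq> j \<Longrightarrow> r i = r j \<Longrightarrow> minor i j \<in> I"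
  shows "vm_ideal D r \<subseteq> I"
  unfolding vm_ideal_def
  by (rule idl_least[OF assms(1)]) (use assms(2,3) in \<open>auto simp: vm_gens_def\<close>)

lemma sum_bool_prod: "(\<Sum>v\<in>UNIV. f v) = (\<Sum>i\<in>UNIV. f (False, i) + f (True, i))"
  for f :: "bool \<times> 'd::finite \<Rightarrow> 'a::comm_monoid_add"
proof -
  have "(\<Sum>v\<in>UNIV. f v) = (\<Sum>b\<in>UNIV. \<Sum>i\<in>UNIV. f (b, i))"
    by (simp add: sum.cartesian_product flip: UNIV_Times_UNIV)
  thus ?thesis by (simp add: UNIV_bool sum.distrib)
qed

text \<open>The exponent of the image of a monomial m without killed variables. In it t_i records
  the degree of m at vertex i, and b_c the y-degree of m on the block labelled c; these are the
  invariants in \<open>vm_congruence\<close>.\<close>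

definition vm_exp :: "('d \<Rightarrow> 'd) \<Rightarrow> ((bool \<times> 'd::{finite,linorder}) \<Rightarrow>\<^sub>0 nat) \<Rightarrow> ((bool \<times> bool \<times> 'd) \<Rightarrow>\<^sub>0 nat)" where
  "vm_exp r m = (\<Sum>(b, i)\<in>UNIV. nsm (Poly_Mapping.lookup m (b, i))
      (Poly_Mapping.single (True, True, i) 1 + Poly_Mapping.single (False, b, r i) 1))"

lemma lookup_vm_exp_t:
  "Poly_Mapping.lookup (vm_exp r m) (True, True, i) = Poly_Mapping.lookup m (False, i) + Poly_Mapping.lookup m (True, i)"
proof -
  have "Poly_Mapping.lookup (vm_exp r m) (True, True, i)
      = (\<Sum>j\<in>UNIV. if j = i then Poly_Mapping.lookup m (False, j) + Poly_Mapping.lookup m (True, j) else 0)"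
    unfolding vm_exp_def lookup_sum sum_bool_prod
    by (intro sum.cong) (auto simp: lookup_add lookup_single)
  thus ?thesis by simp
qed

lemma lookup_vm_exp_b:
  "Poly_Mapping.lookup (vm_exp r m) (False, True, c) = (\<Sum>i | r i = c. Poly_Mapping.lookup m (True, i))"
proof -
  have "Poly_Mapping.lookup (vm_exp r m) (False, True, c)
      = (\<Sum>i\<in>UNIV. if r i = c then Poly_Mapping.lookup m (True, i) else 0)"
    unfolding vm_exp_def
    by (simp add: lookup_sum lookup_add lookup_single sum_bool_prod when_def if_distrib cong: if_cong)
  also have "\<dots> = (\<Sum>i | r i = c. Poly_Mapping.lookup m (True, i))"
    by (simp add: sum.If_cases)
  finally show ?thesis .
qed

lemma vm_param_single:
  assumes "\<And>v. v \<in> D \<Longrightarrow> Poly_Mapping.lookup m v = 0"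
  shows "vm_param D r (Poly_Mapping.single m c) = Poly_Mapping.single (vm_exp r m) c"
proof -
  let ?\<sigma> = "\<lambda>(b, i). if (b, i) \<in> D then 0 else var (True, True, i) * var (False, b, r i) :: (bool \<times> bool \<times> 'a, 'b) mpoly"
  have "monev ?\<sigma> m = (\<Prod>(b, i)\<in>UNIV. Poly_Mapping.single (nsm (Poly_Mapping.lookup m (b, i))
      (Poly_Mapping.single (True, True, i) 1 + Poly_Mapping.single (False, b, r i) 1)) 1)"
    unfolding monev_def
  proof (rule prod.cong[OF refl])
    fix v :: "bool \<times> 'a"
    obtain b i where v: "v = (b, i)" by (cases v)
    show "?\<sigma> v ^ Poly_Mapping.lookup m v = (case v of (b, i) \<Rightarrow> Poly_Mapping.single (nsm (Poly_Mapping.lookup m (b, i))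
      (Poly_Mapping.single (True, True, i) 1 + Poly_Mapping.single (False, b, r i) 1)) 1)"
    proof (cases "v \<in> D")
      case True
      have "nsm 0 m' = 0" for m' :: "(bool \<times> bool \<times> 'a) \<Rightarrow>\<^sub>0 nat" by (rule poly_mapping_eqI) simp
      with True assms[OF True] show ?thesis by (simp add: v)
    next
      case False
      thus ?thesis by (simp add: v var_def mult_single single_power)
    qed
  qed
  also have "\<dots> = Poly_Mapping.single (vm_exp r m) 1"
    unfolding vm_exp_def prod_single[OF finite, symmetric] by (simp add: case_prod_unfold)
  finally show ?thesis
    unfolding vm_param_def subst_single by (simp add: const_def mult_single)
qed

lemma vm_param_single_0:
  assumes "v \<in> D" "Poly_Mapping.lookup m v \<noteq> 0"
  shows "Poly_Mapping.single m c \<in> vm_ideal D r"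
proof -
  have "Poly_Mapping.single m c = Poly_Mapping.single (m - Poly_Mapping.single v 1) c * var v"
  proof -
    have "m - Poly_Mapping.single v 1 + Poly_Mapping.single v 1 = m"
      using assms(2) by (intro poly_mapping_eqI) (auto simp: lookup_add lookup_minus lookup_single when_def)
    thus ?thesis by (simp add: var_def mult_single)
  qed
  thus ?thesis using is_ideal_mult[OF is_ideal_vm vm_ideal_var[OF assms(1)]] by metis
qed

text \<open>Straightening: two monomials with the same parametrisation are congruent, since replacing
  \<open>x\<^sub>i y\<^sub>j\<close> by \<open>x\<^sub>j y\<^sub>i\<close> does not change the class of a monomial.\<close>

lemma vm_congruence:
  fixes m n :: "(bool \<times> 'd::{finite,linorder}) \<Rightarrow>\<^sub>0 nat"
  assumes deg: "\<And>i. Poly_Mapping.lookup m (False, i) + Poly_Mapping.lookup m (True, i)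
      = Poly_Mapping.lookup n (False, i) + Poly_Mapping.lookup n (True, i)"
    and comp: "\<And>c. (\<Sum>i | r i = c. Poly_Mapping.lookup m (True, i)) = (\<Sum>i | r i = c. Poly_Mapping.lookup n (True, i))"
  shows "Poly_Mapping.single m c - Poly_Mapping.single n c \<in> (vm_ideal D r :: ('d, 'k::field) xy_poly set)"
  using assms
\<comment> \<open>The measure is the total amount by which m falls short of n in the y-variables;
  each exchange lowers it.\<close>
proof (induction "\<Sum>i\<in>UNIV. Poly_Mapping.lookup n (True, i) - Poly_Mapping.lookup m (True, i)" arbitrary: m rule: less_induct)
  case (less m)
  let ?m = "Poly_Mapping.lookup m" and ?n = "Poly_Mapping.lookup n"
  show ?case
  proof (cases "\<forall>i. ?n (True, i) \<le> ?m (True, i)")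
    case True
    have eq: "?m (True, i) = ?n (True, i)" for i
    proof (rule ccontr)
      assume "?m (True, i) \<noteq> ?n (True, i)"
      with True[rule_format, of i] have lt: "?n (True, i) < ?m (True, i)" by linarith
      have "(\<Sum>j | r j = r i. ?n (True, j)) < (\<Sum>j | r j = r i. ?m (True, j))"
        by (rule sum_strict_mono_ex1) (use True lt in auto)
      with less.prems(2)[of "r i"] show False by simp
    qed
    have "m = n"
    proof (rule poly_mapping_eqI)
      fix v :: "bool \<times> 'd"
      obtain b i where "v = (b, i)" by (cases v)
      thus "?m v = ?n v" using eq[of i] less.prems(1)[of i] by (cases b) auto
    qed
    thus ?thesis by (simp add: is_ideal_0[OF is_ideal_vm])
  next
    case False
    then obtain i where i: "?m (True, i) < ?n (True, i)" by (auto simp: not_le)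
    have "\<exists>j. r j = r i \<and> ?n (True, j) < ?m (True, j)"
    proof (rule ccontr)
      assume "\<not> ?thesis"
      hence *: "\<forall>j. r j = r i \<longrightarrow> ?m (True, j) \<le> ?n (True, j)" by (auto simp: not_less)
      have "(\<Sum>j | r j = r i. ?m (True, j)) < (\<Sum>j | r j = r i. ?n (True, j))"
        by (rule sum_strict_mono_ex1) (use * i in auto)
      with less.prems(2)[of "r i"] show False by simp
    qed
    then obtain j where j: "r j = r i" "?n (True, j) < ?m (True, j)" by blast
    have ij: "i \<noteq> j" using i j by auto
    define base where "base = m - Poly_Mapping.single (False, i) 1 - Poly_Mapping.single (True, j) 1"
    define m' where "m' = base + Poly_Mapping.single (False, j) 1 + Poly_Mapping.single (True, i) 1"
    \<comment> \<open>Vertex i has equal degree in m and n but a smaller y-exponent in m, so x_i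
      occurs in m; y_j occurs because j has a surplus.\<close>
    have pos: "?m (False, i) \<ge> 1" "?m (True, j) \<ge> 1" using i j less.prems(1)[of i] by linarith+
    have m: "m = base + Poly_Mapping.single (False, i) 1 + Poly_Mapping.single (True, j) 1"
      using pos by (intro poly_mapping_eqI) (auto simp: base_def lookup_add lookup_minus lookup_single when_def)
    have m'_T: "Poly_Mapping.lookup m' (True, l) = (if l = i then ?m (True, i) + 1 else if l = j then ?m (True, j) - 1 else ?m (True, l))" for l
      using ij pos by (auto simp: m'_def base_def lookup_add lookup_minus lookup_single when_def)
    have m'_F: "Poly_Mapping.lookup m' (False, l) = (if l = i then ?m (False, i) - 1 else if l = j then ?m (False, j) + 1 else ?m (False, l))" for l
      using ij pos by (auto simp: m'_def base_def lookup_add lookup_minus lookup_single when_def)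
    have deg': "Poly_Mapping.lookup m' (False, l) + Poly_Mapping.lookup m' (True, l) = ?n (False, l) + ?n (True, l)" for l
      using less.prems(1)[of l] pos by (auto simp: m'_T m'_F)
    have comp': "(\<Sum>l | r l = d. Poly_Mapping.lookup m' (True, l)) = (\<Sum>l | r l = d. ?n (True, l))" for d
    proof -
      have "(\<Sum>l | r l = d. Poly_Mapping.lookup m' (True, l)) = (\<Sum>l | r l = d. ?m (True, l))"
      proof (cases "d = r i")
        case True
        have sp: "(\<Sum>l | r l = d. f l) = f i + (f j + (\<Sum>l\<in>{l. r l = d} - {i} - {j}. f l))" for f :: "'d \<Rightarrow> nat"
          using True j(1) ij by (subst sum.remove[of _ i], simp, simp, subst sum.remove[of _ j], auto)
        show ?thesis unfolding sp using pos ij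
          by (simp add: m'_T)
      next
        case False
        thus ?thesis using j(1) by (intro sum.cong) (auto simp: m'_T)
      qed
      thus ?thesis using less.prems(2)[of d] by simp
    qed
    have "(\<Sum>l\<in>UNIV. ?n (True, l) - Poly_Mapping.lookup m' (True, l)) < (\<Sum>l\<in>UNIV. ?n (True, l) - ?m (True, l))"
    proof (rule sum_strict_mono_ex1)
      show "\<forall>l\<in>UNIV. ?n (True, l) - Poly_Mapping.lookup m' (True, l) \<le> ?n (True, l) - ?m (True, l)"
        using j(2) by (auto simp: m'_T)
      show "\<exists>l\<in>UNIV. ?n (True, l) - Poly_Mapping.lookup m' (True, l) < ?n (True, l) - ?m (True, l)"
        using i by (intro bexI[of _ i]) (auto simp: m'_T)
    qed simp
    from less.hyps[OF this deg' comp']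
    have 1: "Poly_Mapping.single m' c - Poly_Mapping.single n c \<in> (vm_ideal D r :: ('d, 'k) xy_poly set)" .
    have "Poly_Mapping.single m c - Poly_Mapping.single m' c = Poly_Mapping.single base c * (minor i j :: ('d, 'k) xy_poly)"
      by (subst m) (simp add: m'_def minor_def var_def mult_single right_diff_distrib add.assoc)
    moreover have "minor i j \<in> (vm_ideal D r :: ('d, 'k) xy_poly set)" using vm_ideal_minor[of r i j] j(1) by simp
    ultimately have 2: "Poly_Mapping.single m c - Poly_Mapping.single m' c \<in> (vm_ideal D r :: ('d, 'k) xy_poly set)"
      using is_ideal_mult[OF is_ideal_vm] by metis
    from is_ideal_add[OF is_ideal_vm 2 1] show ?thesis by simp
  qed
qed

lemma vm_ideal_subset_kernel:
  assumes "vm_ok D r" shows "vm_ideal D r \<subseteq> {f. vm_param D r f = 0}"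
proof (rule vm_ideal_subset)
  show "is_ideal {f. vm_param D r f = 0}"
    using is_prime_kernel[OF rhom_vm_param] is_prime_ideal by blast
  show "var v \<in> {f. vm_param D r f = 0}" if "v \<in> D" for v
    using that by (cases v) (simp add: vm_param_var)
  show "minor i j \<in> {f. vm_param D r f = 0}" if "i \<noteq> j" "r i = r j" for i j
  proof -
    have "(b, i) \<notin> D \<and> (b, j) \<notin> D" for b
      using assms that unfolding vm_ok_def by metis
    thus ?thesis
      by (simp add: minor_def rhomD[OF rhom_vm_param] vm_param_var that)
  qed
qed

text \<open>Monomials of a kernel element are removed one by one. A monomial containing a killed
  variable lies in the ideal. Any other has an image that must cancel against the image of a second
  monomial of f; the two are congruent, so the coefficient can be moved onto the second one without
  enlarging the support.\<close>

lemma vm_ideal_eq_kernel: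
  assumes ok: "vm_ok D r"
  shows "vm_ideal D r = {f :: ('d::{finite,linorder}, 'k::field) xy_poly. vm_param D r f = 0}"
proof
  show "vm_ideal D r \<subseteq> {f. vm_param D r f = 0}" by (rule vm_ideal_subset_kernel[OF ok])
  have "f \<in> vm_ideal D r" if "vm_param D r f = 0" for f :: "('d, 'k) xy_poly"
    using that
  proof (induction "card (Poly_Mapping.keys f)" arbitrary: f rule: less_induct)
    case (less f)
    have step: "f \<in> vm_ideal D r"
      if m: "m \<in> Poly_Mapping.keys f" and g: "g \<in> vm_ideal D r"
        and keys: "Poly_Mapping.keys (f - g) \<subseteq> Poly_Mapping.keys f - {m}" for m g
    proof -
      have "card (Poly_Mapping.keys (f - g)) < card (Poly_Mapping.keys f)"
        using keys m by (intro psubset_card_mono) auto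
      moreover have "vm_param D r (f - g) = 0"
        using less.prems g vm_ideal_subset_kernel[OF ok] by (auto simp: rhomD[OF rhom_vm_param])
      ultimately have "f - g \<in> vm_ideal D r" by (rule less.hyps)
      from is_ideal_add[OF is_ideal_vm this g] show ?thesis by simp
    qed
    show ?case
    proof (cases "\<exists>m\<in>Poly_Mapping.keys f. \<exists>v\<in>D. Poly_Mapping.lookup m v \<noteq> 0")
      case True
      then obtain m v where mv: "m \<in> Poly_Mapping.keys f" "v \<in> D" "Poly_Mapping.lookup m v \<noteq> 0" by blast
      show ?thesis
      proof (rule step[OF mv(1) vm_param_single_0[OF mv(2,3)]])
        show "Poly_Mapping.keys (f - Poly_Mapping.single m (Poly_Mapping.lookup f m)) \<subseteq> Poly_Mapping.keys f - {m}"
          by (auto simp: in_keys_iff lookup_minus lookup_single when_def split: if_splits)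
      qed
    next
      case False
      hence off: "\<And>m v. m \<in> Poly_Mapping.keys f \<Longrightarrow> v \<in> D \<Longrightarrow> Poly_Mapping.lookup m v = 0" by blast
      show ?thesis
      proof (cases "f = 0")
        case True
        thus ?thesis by (simp add: is_ideal_0[OF is_ideal_vm])
      next
        case nz: False
        then obtain m where m: "m \<in> Poly_Mapping.keys f"
          by (metis ex_in_conv keys_eq_empty)
        have "vm_param D r f = (\<Sum>n\<in>Poly_Mapping.keys f. Poly_Mapping.single (vm_exp r n) (Poly_Mapping.lookup f n))"
          by (subst poly_mapping_sum_singles[of f], subst rhomD(8)[OF rhom_vm_param])
             (intro sum.cong refl vm_param_single off)
        hence "(\<Sum>n\<in>Poly_Mapping.keys f. Poly_Mapping.lookup (Poly_Mapping.single (vm_exp r n) (Poly_Mapping.lookup f n)) (vm_exp r m)) = 0"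
          using less.prems by (simp flip: lookup_sum)
        hence "Poly_Mapping.lookup f m + (\<Sum>n\<in>Poly_Mapping.keys f - {m}. Poly_Mapping.lookup (Poly_Mapping.single (vm_exp r n) (Poly_Mapping.lookup f n)) (vm_exp r m)) = 0"
          using m by (subst (asm) sum.remove[of _ m]) simp_all
        moreover have "Poly_Mapping.lookup f m \<noteq> 0" using m by (simp add: in_keys_iff)
        ultimately have "(\<Sum>n\<in>Poly_Mapping.keys f - {m}. Poly_Mapping.lookup (Poly_Mapping.single (vm_exp r n) (Poly_Mapping.lookup f n)) (vm_exp r m)) \<noteq> 0"
          by auto
        then obtain n where n: "n \<in> Poly_Mapping.keys f" "n \<noteq> m"
          "Poly_Mapping.lookup (Poly_Mapping.single (vm_exp r n) (Poly_Mapping.lookup f n)) (vm_exp r m) \<noteq> 0"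
          by (metis (no_types, lifting) Diff_iff insertI1 sum.neutral)
        hence e: "vm_exp r n = vm_exp r m" by (auto simp: lookup_single when_def split: if_splits)
        let ?c = "Poly_Mapping.lookup f m"
        have "Poly_Mapping.single m ?c - Poly_Mapping.single n ?c \<in> vm_ideal D r"
          by (rule vm_congruence) (simp_all add: e flip: lookup_vm_exp_t[of r] lookup_vm_exp_b)
        thus ?thesis
        proof (rule step[OF m])
          show "Poly_Mapping.keys (f - (Poly_Mapping.single m ?c - Poly_Mapping.single n ?c)) \<subseteq> Poly_Mapping.keys f - {m}"
            using n(1,2) m by (auto simp: in_keys_iff lookup_minus lookup_single when_def split: if_splits)
        qed
      qed
    qed
  qed
  thus "{f :: ('d, 'k) xy_poly. vm_param D r f = 0} \<subseteq> vm_ideal D r" by blast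
qed

lemma is_prime_vm: "vm_ok D r \<Longrightarrow> is_prime (vm_ideal D r)"
  using is_prime_kernel[OF rhom_vm_param[of D r]] by (simp add: vm_ideal_eq_kernel)

lemma var_nonzero: "var v \<noteq> 0"
  by (metis var_def lookup_single_eq lookup_zero one_neq_zero)

lemma vm_ideal_var_iff: "vm_ok D r \<Longrightarrow> var v \<in> vm_ideal D r \<longleftrightarrow> v \<in> D"
  by (cases v) (simp add: vm_ideal_eq_kernel vm_param_var var_nonzero)

text \<open>For different labels the products a_(r i) b_(r j) and a_(r j) b_(r i) are different
  monomials, so the parametrisation does not kill the minor.\<close>

lemma vm_ideal_minor_iff:
  fixes r :: "'d::{finite,linorder} \<Rightarrow> 'd"
  assumes "vm_ok D r" "\<And>b. (b, i) \<notin> D" "\<And>b. (b, j) \<notin> D"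
  shows "(minor i j :: ('d, 'k::field) xy_poly) \<in> vm_ideal D r \<longleftrightarrow> r i = r j"
proof
  assume "(minor i j :: ('d, 'k) xy_poly) \<in> vm_ideal D r"
  hence "vm_param D r (minor i j :: ('d, 'k) xy_poly) = 0" by (simp add: vm_ideal_eq_kernel[OF assms(1)])
  hence eq: "var (True, True, i) * var (False, False, r i) * (var (True, True, j) * var (False, True, r j))
      = var (True, True, j) * var (False, False, r j) * (var (True, True, i) * (var (False, True, r i) :: (bool \<times> bool \<times> 'd, 'k) mpoly))"
    using assms(2,3) by (simp add: minor_def rhomD[OF rhom_vm_param] vm_param_var)
  have "Poly_Mapping.single (Poly_Mapping.single (True, True, i) (1::nat) + Poly_Mapping.single (True, True, j) 1
      + (Poly_Mapping.single (False, False, r i) 1 + Poly_Mapping.single (False, True, r j) 1)) (1::'k)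
    = Poly_Mapping.single (Poly_Mapping.single (True, True, i) 1 + Poly_Mapping.single (True, True, j) 1
      + (Poly_Mapping.single (False, False, r j) 1 + Poly_Mapping.single (False, True, r i) 1)) 1"
    using eq by (simp add: var_def mult_single ac_simps)
  hence "Poly_Mapping.single (False, False, r i) 1 + Poly_Mapping.single (False, True, r j) 1
      = Poly_Mapping.single (False, False, r j) 1 + Poly_Mapping.single (False, True, r i) (1::nat)"
    by (metis (no_types, lifting) lookup_single_eq lookup_single_not_eq one_neq_zero add_left_cancel)
  from arg_cong[OF this, of "\<lambda>q. Poly_Mapping.lookup q (False, False, r i)"] show "r i = r j"
    by (simp add: lookup_add lookup_single when_def split: if_splits)
qed (rule vm_ideal_minor)

section \<open>Minimal primes of binomial edge ideals\<close>

text \<open>Expansion of a 3 by 3 determinant with a repeated row. It serves both to extend minors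
  along paths and as Cramer's rule.\<close>

lemma minor_plucker: "var (b, i) * minor u v = var (b, u) * minor i v + var (b, v) * minor u i"
  by (cases b) (simp_all add: minor_def algebra_simps)

lemma minor_mem: "is_ideal I \<Longrightarrow> (\<And>b. var (b, i) \<in> I) \<Longrightarrow> minor i j \<in> I"
  unfolding minor_def by (intro is_ideal_diff is_ideal_mult' is_ideal_mult) auto

lemma minor_mem': "is_ideal I \<Longrightarrow> (\<And>b. var (b, j) \<in> I) \<Longrightarrow> minor i j \<in> I"
  by (subst minor_swap) (intro is_ideal_uminus minor_mem)

locale edge_graph =
  fixes E :: "'d::{finite,linorder} rel"
  assumes sym_E: "(i, j) \<in> E \<Longrightarrow> (j, i) \<in> E"
    and connected_E: "(i, j) \<in> E\<^sup>*"
begin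

definition bei :: "('d, 'k::field) xy_poly set" where
  "bei = idl {minor i j |i j. (i, j) \<in> E}"

text \<open>The reflexive closure makes every vertex of S a class of its own, so there are c(S) +
  |S| classes.\<close>

definition reach :: "'d set \<Rightarrow> 'd rel" where
  "reach S = (E \<inter> (- S) \<times> (- S))\<^sup>*"

lemma reach_refl [simp]: "(i, i) \<in> reach S"
  by (simp add: reach_def)

lemma reach_sym: "(i, j) \<in> reach S \<Longrightarrow> (j, i) \<in> reach S"
proof -
  have "sym (E \<inter> (- S) \<times> (- S))" using sym_E by (auto simp: sym_def)
  thus "(i, j) \<in> reach S \<Longrightarrow> (j, i) \<in> reach S"
    unfolding reach_def by (rule symD[OF sym_rtrancl])
qed

lemma reach_trans: "(i, j) \<in> reach S \<Longrightarrow> (j, l) \<in> reach S \<Longrightarrow> (i, l) \<in> reach S"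
  unfolding reach_def by (rule rtrancl_trans)

lemma reach_edge: "(i, j) \<in> E \<Longrightarrow> i \<notin> S \<Longrightarrow> j \<notin> S \<Longrightarrow> (i, j) \<in> reach S"
  unfolding reach_def by (intro r_into_rtrancl) auto

lemma reach_induct [consumes 1, case_names refl step]:
  assumes "(i, j) \<in> reach S" "P i"
    "\<And>j l. (i, j) \<in> reach S \<Longrightarrow> P j \<Longrightarrow> (j, l) \<in> E \<Longrightarrow> j \<notin> S \<Longrightarrow> l \<notin> S \<Longrightarrow> P l"
  shows "P j"
  using assms(1) unfolding reach_def
proof (induction rule: rtrancl_induct)
  case (step j l)
  thus ?case using assms(3)[of j l] by (auto simp: reach_def)
qed (rule assms(2))

lemma reach_in: "(i, j) \<in> reach S \<Longrightarrow> i \<in> S \<Longrightarrow> j = i"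
  by (induction rule: reach_induct) auto

lemma reach_in': "(i, j) \<in> reach S \<Longrightarrow> j \<in> S \<Longrightarrow> i = j"
  using reach_in[OF reach_sym] by blast

lemma reach_empty: "(i, j) \<in> reach {}"
  using connected_E by (simp add: reach_def)

text \<open>r picks a representative in each class, so \<open>card {i. r i \<noteq> i}\<close> is |-
  S| - c(S), the part of h(S) contributed by minors. The choice stays open: \<open>lab\<close> takes
  the least vertex, \<open>contiguous_path_poly\<close> the first one in an ordering.\<close>

definition is_lab :: "'d set \<Rightarrow> ('d \<Rightarrow> 'd) \<Rightarrow> bool" where
  "is_lab S r \<longleftrightarrow> (\<forall>i j. r i = r j \<longleftrightarrow> (i, j) \<in> reach S) \<and> (\<forall>i. r (r i) = r i)"

definition lab :: "'d set \<Rightarrow> 'd \<Rightarrow> 'd" where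
  "lab S i = Min {j. (i, j) \<in> reach S}"

lemma is_lab_eq: "is_lab S r \<Longrightarrow> r i = r j \<longleftrightarrow> (i, j) \<in> reach S"
  and is_lab_idem: "is_lab S r \<Longrightarrow> r (r i) = r i"
  by (simp_all add: is_lab_def)

lemma is_lab_reach: "is_lab S r \<Longrightarrow> (i, r i) \<in> reach S"
  using is_lab_idem is_lab_eq by metis

lemma is_lab_lab: "is_lab S (lab S)"
proof -
  have 1: "(i, lab S i) \<in> reach S" for i
    using Min_in[of "{j. (i, j) \<in> reach S}"] by (auto simp: lab_def intro: reach_refl)
  have 2: "lab S i = lab S j" if "(i, j) \<in> reach S" for i j
  proof -
    have "{l. (i, l) \<in> reach S} = {l. (j, l) \<in> reach S}"
      using that reach_trans reach_sym by blast
    thus ?thesis by (simp add: lab_def)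
  qed
  show ?thesis
    unfolding is_lab_def
  proof (intro conjI allI iffI)
    show "(i, j) \<in> reach S" if "lab S i = lab S j" for i j
      using 1[of i] 1[of j] that reach_trans reach_sym by metis
    show "lab S (lab S i) = lab S i" for i using 2[OF 1[of i]] by simp
  qed (rule 2)
qed

definition cut_prime :: "'d set \<Rightarrow> ('d, 'k::field) xy_poly set" where
  "cut_prime S = vm_ideal (UNIV \<times> S) (lab S)"

lemma cut_prime_eq: "is_lab S r \<Longrightarrow> cut_prime S = vm_ideal (UNIV \<times> S) r"
  using is_lab_eq[OF is_lab_lab] is_lab_eq unfolding cut_prime_def vm_ideal_def vm_gens_def by metis

lemma vm_ok_cut: "is_lab S r \<Longrightarrow> vm_ok (UNIV \<times> S) r"
  unfolding vm_ok_def using is_lab_eq reach_in by fastforce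

lemma is_prime_cut: "is_prime (cut_prime S :: ('d, 'k::field) xy_poly set)"
  unfolding cut_prime_def by (rule is_prime_vm[OF vm_ok_cut[OF is_lab_lab]])

lemma cut_prime_var_iff: "(var (b, i) :: ('d, 'k::field) xy_poly) \<in> cut_prime S \<longleftrightarrow> i \<in> S"
  unfolding cut_prime_def by (simp add: vm_ideal_var_iff[OF vm_ok_cut[OF is_lab_lab]])

lemma cut_prime_minor: "(i, j) \<in> reach S \<Longrightarrow> minor i j \<in> cut_prime S"
  unfolding cut_prime_def by (rule vm_ideal_minor) (simp add: is_lab_eq[OF is_lab_lab])

lemma cut_prime_minor_iff:
  "i \<notin> S \<Longrightarrow> j \<notin> S \<Longrightarrow> minor i j \<in> cut_prime S \<longleftrightarrow> (i, j) \<in> reach S"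
  unfolding cut_prime_def
  by (subst vm_ideal_minor_iff[OF vm_ok_cut[OF is_lab_lab]]) (auto simp: is_lab_eq[OF is_lab_lab])

lemma cut_prime_subset:
  assumes "is_ideal I" "\<And>b i. i \<in> S \<Longrightarrow> var (b, i) \<in> I" "\<And>i j. (i, j) \<in> reach S \<Longrightarrow> minor i j \<in> I"
  shows "cut_prime S \<subseteq> I"
  unfolding cut_prime_def using assms
  by (intro vm_ideal_subset) (auto simp: is_lab_eq[OF is_lab_lab])

lemma is_ideal_bei: "is_ideal bei"
  unfolding bei_def by (rule is_ideal_idl)

lemma bei_edge: "(i, j) \<in> E \<Longrightarrow> minor i j \<in> bei"
  unfolding bei_def by (rule idl_base) blast

lemma bei_subset: "is_ideal I \<Longrightarrow> (\<And>i j. (i, j) \<in> E \<Longrightarrow> minor i j \<in> I) \<Longrightarrow> bei \<subseteq> I"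
  unfolding bei_def by (rule idl_least) auto

lemma bei_subset_cut: "(bei :: ('d, 'k::field) xy_poly set) \<subseteq> cut_prime S"
proof (rule bei_subset[OF is_prime_ideal[OF is_prime_cut]])
  fix i j assume ij: "(i, j) \<in> E"
  show "minor i j \<in> cut_prime S"
  proof (cases "i \<in> S \<or> j \<in> S")
    case True
    thus ?thesis
      using minor_mem[OF is_prime_ideal[OF is_prime_cut]] minor_mem'[OF is_prime_ideal[OF is_prime_cut]]
        cut_prime_var_iff by metis
  next
    case False
    thus ?thesis using ij by (intro cut_prime_minor reach_edge) auto
  qed
qed

text \<open>Every vertex outside S has a variable outside Q. Along a path avoiding S, the Pluecker
  relation therefore allows a division by that variable at each step.\<close>

lemma cut_prime_least:
  assumes Q: "is_prime Q" "bei \<subseteq> Q"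
  defines "S \<equiv> {i. \<forall>b. var (b, i) \<in> Q}"
  shows "cut_prime S \<subseteq> Q"
proof (rule cut_prime_subset[OF is_prime_ideal[OF Q(1)]])
  note I = is_prime_ideal[OF Q(1)]
  show "var (b, i) \<in> Q" if "i \<in> S" for b i using that by (simp add: S_def)
  show "minor i j \<in> Q" if "(i, j) \<in> reach S" for i j
    using that
  proof (induction rule: reach_induct)
    case refl
    show ?case using is_ideal_0[OF I] by simp
  next
    case (step j l)
    from \<open>j \<notin> S\<close> obtain b where b: "var (b, j) \<notin> Q" by (auto simp: S_def)
    have "minor j l \<in> Q" using bei_edge[OF \<open>(j, l) \<in> E\<close>] Q(2) by blast
    hence "var (b, j) * minor i l \<in> Q"
      unfolding minor_plucker[of b j i l]
      by (intro is_ideal_add[OF I] is_ideal_mult[OF I] step.IH)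
    with b show ?case by (simp add: is_prime_mult[OF Q(1)])
  qed
qed

lemma minimal_prime_eq_cut:
  assumes "Q \<in> minimal_primes ring_of_type_algebra bei"
  obtains S where "Q = cut_prime S"
proof -
  have Q: "is_prime Q" "bei \<subseteq> Q" "\<And>P. is_prime P \<Longrightarrow> bei \<subseteq> P \<Longrightarrow> P \<subseteq> Q \<Longrightarrow> P = Q"
    using assms by (auto simp: minimal_primes_iff)
  from Q(3)[OF is_prime_cut bei_subset_cut cut_prime_least[OF Q(1,2)]] show ?thesis
    using that by metis
qed

lemma cut_prime_inj: "(cut_prime S :: ('d, 'k::field) xy_poly set) = cut_prime T \<Longrightarrow> S = T"
  using cut_prime_var_iff[of False _ S, where 'k = 'k] cut_prime_var_iff[of False _ T, where 'k = 'k] by blast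

text \<open>A prime below \<open>cut_prime {}\<close> contains no variable, so the set attached to
  it by \<open>cut_prime_least\<close> is again empty.\<close>

lemma cut_empty_minimal: "cut_prime {} \<in> minimal_primes ring_of_type_algebra bei"
  unfolding minimal_primes_iff
proof (intro conjI allI impI is_prime_cut bei_subset_cut)
  fix P :: "('d, 'a) xy_poly set" assume P: "is_prime P" "bei \<subseteq> P" "P \<subseteq> cut_prime {}"
  have "{i. \<forall>b. var (b, i) \<in> P} = {}"
    using P(3) cut_prime_var_iff[where S = "{}"] by blast
  with cut_prime_least[OF P(1,2)] P(3) show "P = cut_prime {}" by simp
qed

text \<open>If the neighbours of s outside S all lie in one component, returning s to the graph
  merges no components; then \<open>cut_prime (S - {s})\<close> lies strictly below
  \<open>cut_prime S\<close>.\<close>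

lemma cut_property:
  assumes min: "(cut_prime S :: ('d, 'k::field) xy_poly set) \<in> minimal_primes ring_of_type_algebra bei" and s: "s \<in> S"
  shows "\<exists>u v. (s, u) \<in> E \<and> (s, v) \<in> E \<and> u \<notin> S \<and> v \<notin> S \<and> (u, v) \<notin> reach S"
proof (rule ccontr)
  assume "\<not> ?thesis"
  hence nbrs: "(u, v) \<in> reach S" if "(s, u) \<in> E" "(s, v) \<in> E" "u \<notin> S" "v \<notin> S" for u v
    using that by blast
  let ?S' = "S - {s}"
  \<comment> \<open>A path through s leaves and re-enters the same component, so new connections
    only involve s as an endpoint. The vertex u remembers the component from which s was
    entered.\<close>
  have key: "i = s \<or> (i, j) \<in> reach S \<or> j = s \<and> (\<exists>u. u \<notin> S \<and> (s, u) \<in> E \<and> (i, u) \<in> reach S)"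
    if "(i, j) \<in> reach ?S'" for i j
    using that
  proof (induction rule: reach_induct)
    case (step j l)
    show ?case
    proof (cases "i = s")
      case False
      show ?thesis
      proof (cases "j = s")
        case True
        hence "(i, j) \<notin> reach S" using s reach_in' \<open>i \<noteq> s\<close> by metis
        then obtain u where u: "u \<notin> S" "(s, u) \<in> E" "(i, u) \<in> reach S" using step.IH \<open>i \<noteq> s\<close> by blast
        show ?thesis
        proof (cases "l = s")
          case False
          hence "(u, l) \<in> reach S" using nbrs[of u l] u step True by blast
          thus ?thesis using u(3) reach_trans by blast
        qed (use u in blast)
      next
        case js: False
        hence ij: "(i, j) \<in> reach S" "j \<notin> S" using step \<open>i \<noteq> s\<close> by auto
        show ?thesis
        proof (cases "l = s")
          case True
          thus ?thesis using ij step sym_E by blast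
        next
          case False
          hence "(j, l) \<in> reach S" using ij step by (intro reach_edge) auto
          thus ?thesis using ij reach_trans by blast
        qed
      qed
    qed blast
  qed simp
  note I = is_prime_ideal[OF is_prime_cut[of S, where 'k = 'k]]
  have "(cut_prime ?S' :: ('d, 'k) xy_poly set) \<subseteq> cut_prime S"
  proof (rule cut_prime_subset[OF I])
    show "(var (b, i) :: ('d, 'k) xy_poly) \<in> cut_prime S" if "i \<in> ?S'" for b i
      using that by (simp add: cut_prime_var_iff)
    show "(minor i j :: ('d, 'k) xy_poly) \<in> cut_prime S" if ij: "(i, j) \<in> reach ?S'" for i j
    proof -
      consider "i = s" | "j = s" | "(i, j) \<in> reach S" using key[OF ij] by blast
      thus ?thesis
        using s by cases (auto intro: minor_mem[OF I] minor_mem'[OF I] cut_prime_minor simp: cut_prime_var_iff)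
    qed
  qed
  hence "(cut_prime ?S' :: ('d, 'k) xy_poly set) = cut_prime S"
    using min is_prime_cut[of ?S', where 'k = 'k] bei_subset_cut[of ?S', where 'k = 'k]
    unfolding minimal_primes_iff by blast
  from cut_prime_inj[OF this] s show False by blast
qed

text \<open>Each step of a path outside S costs one factor x_j, which is not in the prime.\<close>

lemma minor_locally_in_bei:
  assumes "(i, j) \<in> reach S"
  shows "\<exists>t. t \<notin> (cut_prime S :: ('d, 'k::field) xy_poly set) \<and> t * minor i j \<in> bei"
  using assms
proof (induction rule: reach_induct)
  case refl
  have "1 \<notin> (cut_prime S :: ('d, 'k) xy_poly set)" by (rule is_prime_1[OF is_prime_cut])
  thus ?case using is_ideal_0[OF is_ideal_bei] by (intro exI[of _ 1]) simp
next
  case (step j l)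
  then obtain t where t: "t \<notin> (cut_prime S :: ('d, 'k) xy_poly set)" "t * minor i j \<in> bei" by blast
  have "t * (var (False, j) * minor i l) = (t * var (False, i)) * minor j l + var (False, l) * (t * minor i j)"
    unfolding minor_plucker[of False j i l] by (simp add: algebra_simps)
  also have "\<dots> \<in> bei"
    by (intro is_ideal_add[OF is_ideal_bei] is_ideal_mult[OF is_ideal_bei] bei_edge step t)
  finally have "(t * var (False, j)) * minor i l \<in> bei" by (simp add: mult.assoc)
  moreover have "t * var (False, j) \<notin> cut_prime S"
    using t(1) step by (simp add: is_prime_mult[OF is_prime_cut] cut_prime_var_iff)
  ultimately show ?case by blast
qed

text \<open>The binomial edge ideal and its minimal prime \<open>Q\<close> agree locally at \<open>Q\<close>: the variables in \<open>Q\<close> are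
  obtained by Cramer's rule, using that a vertex of the cut set joins two different components.\<close>

lemma minimal_prime_associated:
  assumes min: "Q \<in> minimal_primes ring_of_type_algebra (bei :: ('d, 'k::field) xy_poly set)"
  shows "Q \<in> assoc_primes ring_of_type_algebra bei"
proof -
  obtain S where S: "Q = cut_prime S" by (rule minimal_prime_eq_cut[OF min])
  have Q: "is_prime Q" using S is_prime_cut by blast
  have gen: "\<exists>t. t \<notin> Q \<and> t * g \<in> bei" if g: "g \<in> vm_gens (UNIV \<times> S) (lab S)" for g
    using g unfolding vm_gens_def
  proof (elim UnE imageE)
    fix v :: "bool \<times> 'd" assume v: "g = var v" "v \<in> UNIV \<times> S"
    obtain b i where bi: "v = (b, i)" by (cases v)
    obtain u w where uw: "(i, u) \<in> E" "(i, w) \<in> E" "u \<notin> S" "w \<notin> S" "(u, w) \<notin> reach S"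
      using cut_property[of S i] min v bi S by auto
    have "minor u w * var (b, i) = var (b, u) * minor i w + var (b, w) * minor u i"
      using minor_plucker[of b i u w] by (simp add: mult.commute)
    also have "\<dots> \<in> bei"
      by (intro is_ideal_add[OF is_ideal_bei] is_ideal_mult[OF is_ideal_bei] bei_edge sym_E[OF uw(1)] uw)
    finally show ?thesis
      using uw by (intro exI[of _ "minor u w"]) (simp add: v(1) bi S cut_prime_minor_iff)
  next
    assume "g \<in> {minor i j |i j. i \<noteq> j \<and> lab S i = lab S j}"
    thus ?thesis using minor_locally_in_bei[where S = S] by (auto simp: S is_lab_eq[OF is_lab_lab])
  qed
  define t where "t g = (SOME t. t \<notin> Q \<and> t * g \<in> bei)" for g
  have t: "t g \<notin> Q" "t g * g \<in> bei" if "g \<in> vm_gens (UNIV \<times> S) (lab S)" for g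
    unfolding t_def using someI_ex[OF gen[OF that]] by auto
  have fin: "finite (vm_gens (UNIV \<times> S) (lab S) :: ('d, 'k) xy_poly set)"
  proof -
    have "vm_gens (UNIV \<times> S) (lab S) \<subseteq> range var \<union> range (\<lambda>(i, j). minor i j :: ('d, 'k) xy_poly)"
      by (auto simp: vm_gens_def)
    thus ?thesis by (rule finite_subset) simp
  qed
  define s where "s = (\<Prod>g\<in>vm_gens (UNIV \<times> S) (lab S). t g)"
  have s: "s \<notin> Q" unfolding s_def by (rule is_prime_prod[OF Q]) (rule t)
  have "s * g \<in> bei" if "g \<in> vm_gens (UNIV \<times> S) (lab S)" for g
  proof -
    have "s * g = (\<Prod>g\<in>vm_gens (UNIV \<times> S) (lab S) - {g}. t g) * (t g * g)"
      unfolding s_def by (subst prod.remove[OF fin that]) (simp add: mult_ac)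
    thus ?thesis using is_ideal_mult[OF is_ideal_bei t(2)[OF that]] by metis
  qed
  hence "vm_ideal (UNIV \<times> S) (lab S) \<subseteq> {a. s * a \<in> bei}"
    unfolding vm_ideal_def by (intro idl_least[OF is_ideal_colon[OF is_ideal_bei]]) blast
  hence "s * a \<in> bei" if "a \<in> Q" for a using that by (auto simp: S cut_prime_def)
  moreover have "a \<in> Q" if "s * a \<in> bei" for a
    using that bei_subset_cut[of S] s by (auto simp: S is_prime_mult[OF is_prime_cut])
  \<comment> \<open>As s carries all of Q into the binomial edge ideal and lies outside Q, its class
    has annihilator exactly Q.\<close>
  ultimately have "Q = {a. a * s \<in> bei}" by (auto simp: mult.commute)
  thus ?thesis
    unfolding assoc_primes_def primeideal_iff using Q by (auto simp: ring_of_type_algebra_def)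
qed

text \<open>Once x is inverted at the representative of a component, every minor in that component
  is a combination of minors with the representative. The multiplier s inverts x at all vertices
  outside S.\<close>

lemma cut_prime_local_generators:
  assumes r: "is_lab S r"
  shows "\<exists>Z s. finite Z \<and> Z \<subseteq> (cut_prime S :: ('d, 'k::field) xy_poly set) \<and> card Z \<le> 2 * card S + card {i. r i \<noteq> i} \<and>
           s \<notin> cut_prime S \<and> (\<forall>q\<in>cut_prime S. s * q \<in> idl Z)"
proof -
  define Z :: "('d, 'k) xy_poly set" where "Z = var ` (UNIV \<times> S) \<union> (\<lambda>i. minor (r i) i) ` {i. r i \<noteq> i}"
  define s where "s = (\<Prod>c\<in>- S. var (False, c) :: ('d, 'k) xy_poly)"
  have finZ: "finite Z" unfolding Z_def by simp
  have ZQ: "Z \<subseteq> cut_prime S"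
    unfolding Z_def using is_lab_reach[OF r] by (auto simp: cut_prime_var_iff intro: cut_prime_minor reach_sym)
  have "card Z \<le> card (var ` (UNIV \<times> S) :: ('d, 'k) xy_poly set) + card ((\<lambda>i. minor (r i) i :: ('d, 'k) xy_poly) ` {i. r i \<noteq> i})"
    unfolding Z_def by (rule card_Un_le)
  also have "\<dots> \<le> card ((UNIV :: bool set) \<times> S) + card {i. r i \<noteq> i}"
    by (intro add_mono card_image_le) auto
  also have "card ((UNIV :: bool set) \<times> S) = 2 * card S" by (simp add: card_cartesian_product)
  finally have cardZ: "card Z \<le> 2 * card S + card {i. r i \<noteq> i}" .
  have s: "s \<notin> cut_prime S"
    unfolding s_def by (rule is_prime_prod[OF is_prime_cut]) (simp add: cut_prime_var_iff)
  have rep: "minor (r i) i \<in> idl Z" for i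
    by (cases "r i = i") (auto simp: is_ideal_0[OF is_ideal_idl] Z_def intro!: idl_base)
  have "s * g \<in> idl Z" if "g \<in> vm_gens (UNIV \<times> S) r" for g
    using that unfolding vm_gens_def
  proof (elim UnE)
    assume "g \<in> var ` (UNIV \<times> S)"
    hence "g \<in> idl Z" by (intro idl_base) (auto simp: Z_def)
    thus ?thesis by (rule is_ideal_mult[OF is_ideal_idl])
  next
    assume "g \<in> {minor i j |i j. i \<noteq> j \<and> r i = r j}"
    then obtain i j where ij: "g = minor i j" "i \<noteq> j" "r i = r j" by blast
    \<comment> \<open>A vertex of S is alone in its class, whereas i and j share one.\<close>
    have "r i \<notin> S"
    proof
      assume "r i \<in> S"
      hence "r i = i" "r j = j" using is_lab_reach[OF r] reach_in' ij(3) by metis+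
      with ij show False by simp
    qed
    hence "s * g = (\<Prod>c\<in>- S - {r i}. var (False, c)) * (var (False, r i) * minor i j)"
      unfolding s_def ij(1) by (subst prod.remove[of _ "r i"]) (simp_all add: mult_ac)
    also have "var (False, r i) * minor i j = var (False, i) * minor (r j) j - var (False, j) * minor (r i) i"
      unfolding minor_plucker[of False "r i" i j] by (simp add: ij(3) minor_swap[of i])
    finally have "s * g = (\<Prod>c\<in>- S - {r i}. var (False, c)) * (var (False, i) * minor (r j) j - var (False, j) * minor (r i) i)" .
    moreover have "\<dots> \<in> idl Z"
      by (intro is_ideal_mult[OF is_ideal_idl] is_ideal_diff[OF is_ideal_idl] rep)
    ultimately show ?thesis by simp
  qed
  hence "vm_ideal (UNIV \<times> S) r \<subseteq> {q. s * q \<in> idl Z}"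
    unfolding vm_ideal_def by (intro idl_least[OF is_ideal_colon[OF is_ideal_idl]]) blast
  hence "\<forall>q\<in>cut_prime S. s * q \<in> idl Z" by (auto simp: cut_prime_eq[OF r])
  with finZ ZQ cardZ s show ?thesis by blast
qed

end

section \<open>Heights\<close>

definition chain_to :: "nat \<Rightarrow> 'a::idom set \<Rightarrow> bool" where
  "chain_to n P \<longleftrightarrow> (\<exists>c. prime_chain ring_of_type_algebra P n c)"

lemma chain_to_0: "is_prime P \<Longrightarrow> chain_to 0 P"
  unfolding chain_to_def prime_chain_def primeideal_iff by (intro exI[of _ "\<lambda>_. P"]) simp

lemma chain_to_Suc: "chain_to n P \<Longrightarrow> is_prime P' \<Longrightarrow> P \<subset> P' \<Longrightarrow> chain_to (Suc n) P'"
proof -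
  assume "chain_to n P" "is_prime P'" "P \<subset> P'"
  then obtain c where c: "prime_chain ring_of_type_algebra P n c" by (auto simp: chain_to_def)
  have "prime_chain ring_of_type_algebra P' (Suc n) (c(Suc n := P'))"
    unfolding prime_chain_def primeideal_iff
  proof (intro conjI allI impI)
    fix i assume "i \<le> Suc n"
    thus "is_prime ((c(Suc n := P')) i)"
      using c \<open>is_prime P'\<close> by (cases "i = Suc n") (auto simp: prime_chain_def primeideal_iff)
  next
    fix i assume "i < Suc n"
    thus "(c(Suc n := P')) i \<subset> (c(Suc n := P')) (Suc i)"
      using c \<open>P \<subset> P'\<close> by (cases "i = n") (auto simp: prime_chain_def)
  qed simp
  thus ?thesis by (auto simp: chain_to_def)
qed

lemma chain_to_le: "chain_to n (P :: ('v::{finite,linorder}, 'k::field) mpoly set) \<Longrightarrow> n \<le> card (UNIV :: 'v set)"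
  unfolding chain_to_def prime_chain_def primeideal_iff
  using prime_chain_length_le[of n] by blast

lemma prime_height_ge: "chain_to n P \<Longrightarrow> enat n \<le> prime_height ring_of_type_algebra P"
  unfolding prime_height_def chain_to_def by (rule SUP_upper) blast

lemma prime_height_le: "(\<And>n. chain_to n P \<Longrightarrow> n \<le> m) \<Longrightarrow> prime_height ring_of_type_algebra P \<le> enat m"
  unfolding prime_height_def chain_to_def by (rule SUP_least) auto

lemma vm_ideal_kill:
  assumes ok: "vm_ok (insert v D) r" and v: "v \<notin> D"
  shows "vm_ideal D r \<subset> (vm_ideal (insert v D) r :: ('d::{finite,linorder}, 'k::field) xy_poly set)"
proof
  show "vm_ideal D r \<subseteq> (vm_ideal (insert v D) r :: ('d, 'k) xy_poly set)"
    by (intro vm_ideal_subset[OF is_ideal_vm] vm_ideal_var vm_ideal_minor) auto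
  have "vm_ok D r" using ok by (auto simp: vm_ok_def)
  hence "(var v :: ('d, 'k) xy_poly) \<notin> vm_ideal D r" using v by (simp add: vm_ideal_var_iff)
  moreover have "(var v :: ('d, 'k) xy_poly) \<in> vm_ideal (insert v D) r" by (rule vm_ideal_var) simp
  ultimately show "vm_ideal D r \<noteq> (vm_ideal (insert v D) r :: ('d, 'k) xy_poly set)" by metis
qed

context edge_graph
begin

text \<open>The chain starts at the zero ideal. Each vertex that is not a representative joins the
  block of its representative in one step; afterwards the 2 |S| variables of S are killed one at a
  time.\<close>

lemma chain_to_cut:
  assumes r: "is_lab S r"
  shows "chain_to (2 * card S + card {i. r i \<noteq> i}) (cut_prime S :: ('d, 'k::field) xy_poly set)"
proof -
  \<comment> \<open>M is the set of vertices already merged into their blocks; all others still have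
    a label of their own or serve as representatives.\<close>
  define rM where "rM M i = (if i \<in> M then r i else i)" for M i
  have ok: "vm_ok {} q" for q :: "'d \<Rightarrow> 'd" by (simp add: vm_ok_def)
  have 1: "chain_to (card M) (vm_ideal {} (rM M) :: ('d, 'k) xy_poly set)" if "M \<subseteq> {i. r i \<noteq> i}" for M
    using finite[of M] that
  proof (induction M rule: finite_induct)
    case empty
    show ?case using chain_to_0[OF is_prime_vm[OF ok]] by simp
  next
    case (insert i M)
    have i: "r i \<noteq> i" "r i \<notin> insert i M" "i \<notin> M" using insert is_lab_idem[OF r] by auto
    have "vm_ideal {} (rM M) \<subset> (vm_ideal {} (rM (insert i M)) :: ('d, 'k) xy_poly set)"
    proof
      show "vm_ideal {} (rM M) \<subseteq> (vm_ideal {} (rM (insert i M)) :: ('d, 'k) xy_poly set)"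
      proof (intro vm_ideal_subset[OF is_ideal_vm] vm_ideal_minor)
        fix a b assume "a \<noteq> b" "rM M a = rM M b"
        moreover have "r (r a) = r a" "r (r b) = r b" by (rule is_lab_idem[OF r])+
        ultimately show "rM (insert i M) a = rM (insert i M) b"
          using i(1) by (auto simp: rM_def split: if_splits)
      qed simp
      have "(minor i (r i) :: ('d, 'k) xy_poly) \<in> vm_ideal {} (rM (insert i M))"
        using i by (intro vm_ideal_minor) (simp add: rM_def)
      moreover have "(minor i (r i) :: ('d, 'k) xy_poly) \<notin> vm_ideal {} (rM M)"
        using i by (subst vm_ideal_minor_iff[OF ok]) (auto simp: rM_def)
      ultimately show "vm_ideal {} (rM M) \<noteq> (vm_ideal {} (rM (insert i M)) :: ('d, 'k) xy_poly set)" by metis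
    qed
    from chain_to_Suc[OF insert.IH is_prime_vm[OF ok] this] insert show ?case by simp
  qed
  have "rM {i. r i \<noteq> i} = r" by (auto simp: rM_def)
  with 1[of "{i. r i \<noteq> i}"] have 2: "chain_to (card {i. r i \<noteq> i}) (vm_ideal {} r :: ('d, 'k) xy_poly set)" by simp
  have "chain_to (card V + card {i. r i \<noteq> i}) (vm_ideal V r :: ('d, 'k) xy_poly set)" if "V \<subseteq> UNIV \<times> S" for V
    using finite[of V] that
  proof (induction V rule: finite_induct)
    case (insert v V)
    have okV: "vm_ok (insert v V) r"
      using vm_ok_cut[OF r] insert.prems unfolding vm_ok_def by blast
    from chain_to_Suc[OF insert.IH is_prime_vm[OF okV] vm_ideal_kill[OF okV]] insert show ?case by simp
  qed (use 2 in simp)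
  from this[of "UNIV \<times> S"] show ?thesis
    by (simp add: cut_prime_eq[OF r] card_cartesian_product)
qed

text \<open>Any chain ending here is prolonged by d + 1 primes: each vertex other than c leaves the
  common block by having both its variables killed, and then x_c and y_c are killed. The total is at
  most 2d, so n is at most d - 1.\<close>

lemma chain_to_cut_empty:
  assumes n: "chain_to n (cut_prime {} :: ('d, 'k::field) xy_poly set)"
  shows "n \<le> card (UNIV :: 'd set) - 1"
proof -
  obtain c :: 'd where True by simp
  have lab: "is_lab {} (\<lambda>_. c)" by (simp add: is_lab_def reach_empty)
  define r where "r M i = (if i \<in> M then i else c)" for M :: "'d set" and i
  have ok: "vm_ok (UNIV \<times> M) (r M)" if "M \<subseteq> - {c}" for M
    using that by (auto simp: vm_ok_def r_def)
  have 1: "chain_to (card M + n) (vm_ideal (UNIV \<times> M) (r M) :: ('d, 'k) xy_poly set)" if "M \<subseteq> - {c}" for M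
    using finite[of M] that
  proof (induction M rule: finite_induct)
    case empty
    show ?case using n by (simp add: cut_prime_eq[OF lab] r_def)
  next
    case (insert i M)
    have "vm_ideal (UNIV \<times> M) (r M) \<subset> (vm_ideal (UNIV \<times> insert i M) (r (insert i M)) :: ('d, 'k) xy_poly set)"
    proof
      show "vm_ideal (UNIV \<times> M) (r M) \<subseteq> (vm_ideal (UNIV \<times> insert i M) (r (insert i M)) :: ('d, 'k) xy_poly set)"
      proof (intro vm_ideal_subset[OF is_ideal_vm] vm_ideal_var)
        fix a b assume ab: "a \<noteq> b" "r M a = r M b"
        show "(minor a b :: ('d, 'k) xy_poly) \<in> vm_ideal (UNIV \<times> insert i M) (r (insert i M))"
        proof (cases "a = i \<or> b = i")
          case True
          thus ?thesis
          proof
            assume "a = i" thus ?thesis by (intro minor_mem[OF is_ideal_vm] vm_ideal_var) simp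
          next
            assume "b = i" thus ?thesis by (intro minor_mem'[OF is_ideal_vm] vm_ideal_var) simp
          qed
        next
          case False
          thus ?thesis using ab by (intro vm_ideal_minor) (auto simp: r_def split: if_splits)
        qed
      qed auto
      have "(var (False, i) :: ('d, 'k) xy_poly) \<notin> vm_ideal (UNIV \<times> M) (r M)"
        using insert by (subst vm_ideal_var_iff[OF ok]) auto
      moreover have "(var (False, i) :: ('d, 'k) xy_poly) \<in> vm_ideal (UNIV \<times> insert i M) (r (insert i M))"
        by (rule vm_ideal_var) simp
      ultimately show "vm_ideal (UNIV \<times> M) (r M) \<noteq> (vm_ideal (UNIV \<times> insert i M) (r (insert i M)) :: ('d, 'k) xy_poly set)"
        by metis
    qed
    from chain_to_Suc[OF insert.IH is_prime_vm[OF ok[OF insert.prems]] this] insert show ?case by simp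
  qed
  let ?M = "- {c}"
  have lab': "r ?M i = i" for i by (simp add: r_def)
  have ok': "vm_ok D (r ?M)" for D by (simp add: vm_ok_def lab')
  have "chain_to (card ?M + n) (vm_ideal (UNIV \<times> ?M) (r ?M) :: ('d, 'k) xy_poly set)" by (rule 1) simp
  from chain_to_Suc[OF this is_prime_vm[OF ok'] vm_ideal_kill[OF ok', of "(False, c)"]]
  have "chain_to (Suc (card ?M + n)) (vm_ideal (insert (False, c) (UNIV \<times> ?M)) (r ?M) :: ('d, 'k) xy_poly set)"
    by simp
  from chain_to_Suc[OF this is_prime_vm[OF ok'] vm_ideal_kill[OF ok', of "(True, c)"]]
  have "chain_to (Suc (Suc (card ?M + n))) (vm_ideal (insert (True, c) (insert (False, c) (UNIV \<times> ?M))) (r ?M) :: ('d, 'k) xy_poly set)"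
    by simp
  from chain_to_le[OF this] have "Suc (Suc (card ?M + n)) \<le> 2 * card (UNIV :: 'd set)"
    by (simp add: card_cartesian_product flip: UNIV_Times_UNIV)
  moreover have "card ?M = card (UNIV :: 'd set) - 1" by (simp add: Compl_eq_Diff_UNIV card_Diff_singleton)
  moreover have "card (UNIV :: 'd set) > 0" by (simp add: card_gt_0_iff)
  ultimately show ?thesis by linarith
qed

text \<open>Equality of heights transfers the upper bound at the empty cut set to the lower bound at
  S.\<close>

lemma unmixed_cut_le:
  assumes unm: "unmixed ring_of_type_algebra (bei :: ('d, 'k::field) xy_poly set)"
    and min: "(cut_prime S :: ('d, 'k) xy_poly set) \<in> minimal_primes ring_of_type_algebra bei" and r: "is_lab S r"
  shows "2 * card S + card {i. r i \<noteq> i} \<le> card (UNIV :: 'd set) - 1"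
proof -
  have "enat (2 * card S + card {i. r i \<noteq> i}) \<le> prime_height ring_of_type_algebra (cut_prime S :: ('d, 'k) xy_poly set)"
    by (rule prime_height_ge[OF chain_to_cut[OF r]])
  also have "\<dots> = prime_height ring_of_type_algebra (cut_prime {} :: ('d, 'k) xy_poly set)"
    using unm minimal_prime_associated[OF min] minimal_prime_associated[OF cut_empty_minimal]
    unfolding unmixed_def by blast
  also have "\<dots> \<le> enat (card (UNIV :: 'd set) - 1)"
    by (rule prime_height_le) (rule chain_to_cut_empty)
  finally show ?thesis by simp
qed

end

section \<open>The splitting attached to an ordering of the vertices\<close>

lemma is_ideal_ipow_one: "is_ideal I \<Longrightarrow> a \<in> I \<Longrightarrow> a \<in> ipow I 1"
  using ipow_1 by simp

context edge_graph
begin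

text \<open>An endpoint in S makes both of its variables lie in the prime and counts once; a minor
  within one component outside S counts once as a generator.\<close>

lemma minor_mem_ipow:
  assumes "u \<noteq> v"
  shows "minor u v \<in> ipow (cut_prime S) (of_bool (u \<in> S) + of_bool (v \<in> S) + of_bool (u \<notin> S \<and> (u, v) \<in> reach S))"
proof -
  note I = is_prime_ideal[OF is_prime_cut[of S]]
  have var: "var (b, i) \<in> ipow (cut_prime S) 1" if "i \<in> S" for b i
    using that by (intro is_ideal_ipow_one[OF I]) (simp add: cut_prime_var_iff)
  show ?thesis
  proof (cases "u \<in> S \<or> v \<in> S")
    case True
    hence "minor u v \<in> cut_prime S"
      using minor_mem[OF I] minor_mem'[OF I] cut_prime_var_iff by metis
    hence 1: "minor u v \<in> ipow (cut_prime S) 1" by (rule is_ideal_ipow_one[OF I])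
    have "(u, v) \<notin> reach S" using True assms reach_in reach_in' by metis
    moreover have "minor u v \<in> ipow (cut_prime S) (1 + 1)" if "u \<in> S" "v \<in> S"
      unfolding minor_def using that
      by (intro is_ideal_diff[OF is_ideal_ipow[OF I]] ipow_mult[OF I] var)
    ultimately show ?thesis using True 1 by auto
  next
    case False
    thus ?thesis
      using is_ideal_ipow_one[OF I cut_prime_minor] by (auto simp: ipow_0)
  qed
qed

text \<open>With the outer variables included, every vertex occurs in exactly two factors, which
  gives 2 |S|. Each consecutive pair joined outside S adds one.\<close>

lemma path_poly_mem_ipow:
  fixes S :: "'d set"
  assumes vs: "distinct vs" "set vs = UNIV"
  shows "(path_poly vs :: ('d, 'k::field) xy_poly) \<in> ipow (cut_prime S)
    (2 * card S + card {j. Suc j < length vs \<and> vs ! j \<notin> S \<and> (vs ! j, vs ! Suc j) \<in> reach S})"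
proof -
  note I = is_prime_ideal[OF is_prime_cut[of S, where 'k = 'k]]
  let ?m = "\<lambda>i. of_bool (i \<in> S) :: nat"
  let ?s = "\<lambda>j. of_bool (vs ! j \<notin> S \<and> (vs ! j, vs ! Suc j) \<in> reach S) :: nat"
  obtain e where e: "length vs = Suc e"
    using vs by (cases vs) auto
  have ne: "vs \<noteq> []" using e by auto
  have var: "(var (b, i) :: ('d, 'k) xy_poly) \<in> ipow (cut_prime S) (?m i)" for b i
    using is_ideal_ipow_one[OF I, of "var (b, i)"] by (auto simp: cut_prime_var_iff ipow_0)
  have "(path_poly vs :: ('d, 'k) xy_poly) \<in> ipow (cut_prime S) (?m (hd vs) + ?m (last vs)
      + (\<Sum>j<e. ?m (vs ! j) + ?m (vs ! Suc j) + ?s j))"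
    unfolding path_poly_def e diff_Suc_1
  proof (intro ipow_mult[OF I] var ipow_prod[OF I])
    fix j assume "j \<in> {..<e}"
    hence "vs ! j \<noteq> vs ! Suc j" using vs(1) e by (simp add: nth_eq_iff_index_eq)
    thus "(minor (vs ! j) (vs ! Suc j) :: ('d, 'k) xy_poly) \<in> ipow (cut_prime S) (?m (vs ! j) + ?m (vs ! Suc j) + ?s j)"
      by (rule minor_mem_ipow)
  qed
  also have "?m (hd vs) + ?m (last vs) + (\<Sum>j<e. ?m (vs ! j) + ?m (vs ! Suc j) + ?s j)
      = (\<Sum>j<Suc e. ?m (vs ! j)) + (\<Sum>j<Suc e. ?m (vs ! j)) + (\<Sum>j<e. ?s j)"
  proof -
    have "(\<Sum>j<Suc e. ?m (vs ! j)) = ?m (hd vs) + (\<Sum>j<e. ?m (vs ! Suc j))"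
      by (simp only: sum.lessThan_Suc_shift hd_conv_nth[OF ne])
    moreover have "(\<Sum>j<Suc e. ?m (vs ! j)) = (\<Sum>j<e. ?m (vs ! j)) + ?m (last vs)"
      by (simp only: sum.lessThan_Suc last_conv_nth[OF ne] e diff_Suc_1)
    ultimately show ?thesis by (simp only: sum.distrib)
  qed
  also have "(\<Sum>j<Suc e. ?m (vs ! j)) = (\<Sum>v\<in>UNIV. ?m v)"
  proof (rule sum.reindex_bij_betw)
    show "bij_betw ((!) vs) {..<Suc e} UNIV"
      using bij_betw_nth[OF vs(1), of "{..<length vs}" UNIV] vs(2) e by simp
  qed
  also have "\<dots> = card S" by (simp add: of_bool_def sum.If_cases)
  also have "(\<Sum>j<e. ?s j) = card {j. Suc j < length vs \<and> vs ! j \<notin> S \<and> (vs ! j, vs ! Suc j) \<in> reach S}"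
  proof -
    have "{..<e} \<inter> {j. vs ! j \<notin> S \<and> (vs ! j, vs ! Suc j) \<in> reach S}
        = {j. Suc j < length vs \<and> vs ! j \<notin> S \<and> (vs ! j, vs ! Suc j) \<in> reach S}"
      by (auto simp: e)
    thus ?thesis by (simp add: of_bool_def sum.If_cases)
  qed
  finally show ?thesis by (simp add: mult_2)
qed

text \<open>By descent on j, every class is an interval of \<open>vs\<close>. The form with the
  predecessor matches the count of consecutive pairs in \<open>path_poly_mem_ipow\<close>.\<close>

definition contiguous :: "'d list \<Rightarrow> 'd set \<Rightarrow> bool" where
  "contiguous vs S \<longleftrightarrow> (\<forall>i j. i < j \<longrightarrow> j < length vs \<longrightarrow> (vs ! i, vs ! j) \<in> reach S \<longrightarrow> (vs ! (j - 1), vs ! j) \<in> reach S)"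

text \<open>Taking the first vertex of each class as its representative, every other vertex is
  joined to its predecessor in \<open>vs\<close>, so there are at least as many joined pairs as
  vertices with r i different from i.\<close>

lemma contiguous_path_poly:
  fixes S :: "'d set"
  assumes vs: "distinct vs" "set vs = UNIV" and cont: "contiguous vs S"
  shows "\<exists>r. is_lab S r \<and> (path_poly vs :: ('d, 'k::field) xy_poly) \<in> ipow (cut_prime S) (2 * card S + card {i. r i \<noteq> i})"
proof -
  define f where "f v = (LEAST j. j < length vs \<and> (vs ! j, v) \<in> reach S)" for v
  define r where "r v = vs ! f v" for v
  have ex: "\<exists>j. j < length vs \<and> vs ! j = v" for v using vs(2) by (metis UNIV_I in_set_conv_nth)
  have f: "f v < length vs" "(r v, v) \<in> reach S" for v
  proof -
    have "\<exists>j. j < length vs \<and> (vs ! j, v) \<in> reach S" using ex[of v] by force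
    from LeastI_ex[OF this] show "f v < length vs" "(r v, v) \<in> reach S" by (simp_all add: f_def r_def)
  qed
  have r_cong: "r i = r j" if "(i, j) \<in> reach S" for i j
  proof -
    have "(a, i) \<in> reach S \<longleftrightarrow> (a, j) \<in> reach S" for a using that reach_sym reach_trans by blast
    thus ?thesis by (simp add: r_def f_def)
  qed
  have lab: "is_lab S r"
    unfolding is_lab_def
  proof (intro conjI allI iffI)
    show "(i, j) \<in> reach S" if "r i = r j" for i j
      using f(2)[of i] f(2)[of j] that reach_sym reach_trans by metis
    show "r (r i) = r i" for i using r_cong[OF f(2)] .
  qed (rule r_cong)
  let ?J = "{j. Suc j < length vs \<and> vs ! j \<notin> S \<and> (vs ! j, vs ! Suc j) \<in> reach S}"
  have "{i. r i \<noteq> i} \<subseteq> (\<lambda>j. vs ! Suc j) ` ?J"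
  proof
    fix v assume "v \<in> {i. r i \<noteq> i}"
    obtain j where j: "j < length vs" "vs ! j = v" using ex by blast
    have "f v \<le> j" unfolding f_def by (rule Least_le) (use j in simp)
    moreover have "f v \<noteq> j" using \<open>v \<in> _\<close> j by (auto simp: r_def)
    ultimately have fj: "f v < j" by simp
    hence reach: "(vs ! (j - 1), vs ! j) \<in> reach S"
      using cont f(2)[of v] j unfolding contiguous_def r_def by blast
    obtain l where l: "j = Suc l" using fj by (cases j) auto
    have "vs ! l \<noteq> vs ! Suc l" using nth_eq_iff_index_eq[OF vs(1), of l "Suc l"] j l by simp
    hence "vs ! l \<notin> S" using reach l reach_in by force
    with reach j l have "l \<in> ?J" by simp
    thus "v \<in> (\<lambda>j. vs ! Suc j) ` ?J" using j l by blast
  qed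
  moreover have "finite ?J" by (rule finite_subset[of _ "{..<length vs}"]) auto
  ultimately have "card {i. r i \<noteq> i} \<le> card ?J"
    by (rule surj_card_le[rotated])
  hence "2 * card S + card {i. r i \<noteq> i} \<le> 2 * card S + card ?J" by simp
  from ipow_antimono[OF is_prime_ideal[OF is_prime_cut] this] path_poly_mem_ipow[OF vs, of S, where 'k = 'k]
  have "(path_poly vs :: ('d, 'k) xy_poly) \<in> ipow (cut_prime S) (2 * card S + card {i. r i \<noteq> i})" by blast
  with lab show ?thesis by blast
qed

lemma edge_path_poly:
  assumes "\<And>j. Suc j < length vs \<Longrightarrow> (vs ! j, vs ! Suc j) \<in> E" and Q: "is_ideal Q" "bei \<subseteq> Q"
  shows "(path_poly vs :: ('d, 'k::field) xy_poly) \<in> ipow Q (length vs - 1)"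
proof -
  have "(\<Prod>j<length vs - 1. minor (vs ! j) (vs ! Suc j) :: ('d, 'k) xy_poly) \<in> ipow Q (\<Sum>j<length vs - 1. 1)"
  proof (rule ipow_prod[OF Q(1)], rule is_ideal_ipow_one[OF Q(1)])
    fix j assume "j \<in> {..<length vs - 1}"
    hence "(minor (vs ! j) (vs ! Suc j) :: ('d, 'k) xy_poly) \<in> bei" by (intro bei_edge assms(1)) simp
    thus "(minor (vs ! j) (vs ! Suc j) :: ('d, 'k) xy_poly) \<in> Q" using Q(2) by blast
  qed
  thus ?thesis
    unfolding path_poly_def by (intro is_ideal_mult[OF is_ideal_ipow[OF Q(1)]]) simp
qed

text \<open>The same r serves twice: it bounds the number of local generators of the prime and the
  order to which the polynomial lies in it.\<close>

lemma symbolic_F_split_bei: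
  fixes vs :: "'d list"
  assumes prime_p: "Factorial_Ring.prime p" and char_p: "CHAR('k::field) = p" and vs: "distinct vs" "set vs = UNIV"
    and h: "\<And>S. (cut_prime S :: ('d, 'k) xy_poly set) \<in> minimal_primes ring_of_type_algebra bei \<Longrightarrow>
      \<exists>r. is_lab S r \<and> (path_poly vs :: ('d, 'k) xy_poly) \<in> ipow (cut_prime S) (2 * card S + card {i. r i \<noteq> i})"
  shows "symbolic_F_split p (bei :: ('d, 'k) xy_poly set)"
proof -
  obtain \<pi> :: "'k \<Rightarrow> 'k" where \<pi>: "\<And>a b. \<pi> (a + b) = \<pi> a + \<pi> b" "\<And>a b. \<pi> (a ^ p * b) = a * \<pi> b" "\<pi> 1 = 1"
    using exists_frobenius_section[OF prime_p char_p] by blast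
  interpret frobenius_section p \<pi>
    by unfold_locales (use prime_p char_p \<pi> in auto)
  show ?thesis
  proof (rule symbolic_F_splitI[where T = "cartier p \<pi>" and F = "path_poly vs ^ (p - 1)"])
    show "CHAR(('d, 'k) xy_poly) = p" using char_p by (simp add: CHAR_mpoly)
    show "cartier p \<pi> (path_poly vs ^ (p - 1) :: ('d, 'k) xy_poly) = 1" by (rule cartier_path_poly[OF vs])
  next
    fix Q :: "('d, 'k) xy_poly set" and n g
    assume Q: "Q \<in> minimal_primes ring_of_type_algebra bei" and g: "g \<in> local_power Q (n * p + 1)"
    obtain S where S: "Q = cut_prime S" by (rule minimal_prime_eq_cut[OF Q])
    obtain r where r: "is_lab S r" "(path_poly vs :: ('d, 'k) xy_poly) \<in> ipow Q (2 * card S + card {i. r i \<noteq> i})"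
      using h[of S] Q S by blast
    obtain Z s where Z: "finite Z" "Z \<subseteq> Q" "card Z \<le> 2 * card S + card {i. r i \<noteq> i}"
      "s \<notin> Q" "\<forall>q\<in>Q. s * q \<in> idl Z"
      using cut_prime_local_generators[OF r(1), where 'k = 'k] unfolding S by blast
    show "cartier p \<pi> (path_poly vs ^ (p - 1) * g) \<in> local_power Q (n + 1)"
      by (rule cartier_local_power[OF _ Z(1,2,4) _ r(2) Z(3) prime_gt_0_nat[OF prime_p] cartier_add cartier_power g])
         (use Z(5) S is_prime_cut in auto)
  qed (rule prime_p cartier_add cartier_power)+
qed

end

section \<open>The four classes of graphs\<close>

lemma exists_sorted_vertices:
  fixes key :: "'d::{finite,linorder} \<Rightarrow> 'b::linorder"
  obtains vs where "distinct vs" "set vs = UNIV" "\<And>i j. i \<le> j \<Longrightarrow> j < length vs \<Longrightarrow> key (vs ! i) \<le> key (vs ! j)"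
proof -
  let ?vs = "sort_key key (sorted_list_of_set UNIV)"
  have "sorted (map key ?vs)" by simp
  hence "key (?vs ! i) \<le> key (?vs ! j)" if "i \<le> j" "j < length ?vs" for i j
    using sorted_nth_mono[of "map key ?vs" i j] that by simp
  thus ?thesis using that[of ?vs] by simp
qed

context edge_graph
begin

lemma reach_first_step:
  assumes "(a, b) \<in> reach S" "a \<noteq> b"
  obtains w where "(a, w) \<in> E" "a \<notin> S" "w \<notin> S" "(w, b) \<in> reach S"
  using assms unfolding reach_def by (auto elim: converse_rtranclE)

lemma contiguous_label_sorted:
  assumes lab: "is_lab S r" and sorted: "\<And>i j. i \<le> j \<Longrightarrow> j < length vs \<Longrightarrow> r (vs ! i) \<le> r (vs ! j)"
  shows "contiguous vs S"
  unfolding contiguous_def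
proof (intro allI impI)
  fix i j assume ij: "i < j" "j < length vs" "(vs ! i, vs ! j) \<in> reach S"
  have "r (vs ! i) = r (vs ! j)" using ij(3) is_lab_eq[OF lab] by blast
  moreover have "r (vs ! i) \<le> r (vs ! (j - 1))" "r (vs ! (j - 1)) \<le> r (vs ! j)"
    using ij(1,2) by (intro sorted; simp)+
  ultimately have "r (vs ! (j - 1)) = r (vs ! j)" by simp
  thus "(vs ! (j - 1), vs ! j) \<in> reach S" using is_lab_eq[OF lab] by blast
qed

lemma contiguous_discrete:
  assumes vs: "distinct vs" and "\<And>a b. (a, b) \<in> reach S \<Longrightarrow> a = b"
  shows "contiguous vs S"
  unfolding contiguous_def using assms(2) nth_eq_iff_index_eq[OF vs]
  by (metis less_trans less_not_refl)

lemma contiguous_empty: "contiguous vs {}"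
  by (simp add: contiguous_def reach_empty)

text \<open>An edge outside S connects all vertices outside S, since each of them is in a different
  part from one of its ends. A nonempty cut set disconnects the rest, so it leaves no edges and any
  ordering works.\<close>

lemma multipartite_contiguous:
  fixes \<V> :: "'d set set"
  assumes part: "partition_on UNIV \<V>" and inner: "\<And>A u v. A \<in> \<V> \<Longrightarrow> u \<in> A \<Longrightarrow> v \<in> A \<Longrightarrow> (u, v) \<notin> E"
    and outer: "\<And>A B u v. A \<in> \<V> \<Longrightarrow> B \<in> \<V> \<Longrightarrow> A \<noteq> B \<Longrightarrow> u \<in> A \<Longrightarrow> v \<in> B \<Longrightarrow> (u, v) \<in> E"
    and min: "(cut_prime S :: ('d, 'k::field) xy_poly set) \<in> minimal_primes ring_of_type_algebra bei" and vs: "distinct vs"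
  shows "contiguous vs S"
proof (cases "S = {}")
  case True
  thus ?thesis using contiguous_empty by simp
next
  case False
  then obtain s where "s \<in> S" by blast
  from cut_property[OF min this] obtain u v where uv: "u \<notin> S" "v \<notin> S" "(u, v) \<notin> reach S" by blast
  have part_of: "\<exists>A\<in>\<V>. w \<in> A" for w using partition_onD1[OF part] by blast
  show ?thesis
  proof (rule contiguous_discrete[OF vs], rule ccontr)
    fix a b assume "(a, b) \<in> reach S" "a \<noteq> b"
    then obtain c where c: "(a, c) \<in> E" "a \<notin> S" "c \<notin> S" by (rule reach_first_step)
    have "(a, w) \<in> reach S" if w: "w \<notin> S" for w
    proof -
      obtain A where A: "A \<in> \<V>" "a \<in> A" using part_of by blast
      obtain C where C: "C \<in> \<V>" "c \<in> C" using part_of by blast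
      obtain W where W: "W \<in> \<V>" "w \<in> W" using part_of by blast
      have AC: "A \<noteq> C" using inner A C c(1) by blast
      show ?thesis
      proof (cases "W = A")
        case True
        have "(c, w) \<in> E" by (rule outer[OF C(1) A(1)]) (use AC C W True in auto)
        thus ?thesis using reach_edge[OF c] reach_edge[OF _ c(3) w] reach_trans by blast
      next
        case False
        have "(a, w) \<in> E" by (rule outer[OF A(1) W(1)]) (use A W False in auto)
        thus ?thesis using reach_edge c(2) w by blast
      qed
    qed
    with uv reach_sym reach_trans show False by blast
  qed
qed

lemma cut_vertex_not_leaf:
  assumes min: "(cut_prime S :: ('d, 'k::field) xy_poly set) \<in> minimal_primes ring_of_type_algebra bei"
    and leaf: "{w. (u, w) \<in> E} = {v}"
  shows "u \<notin> S"
proof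
  assume "u \<in> S"
  from cut_property[OF min this] obtain a b where "(u, a) \<in> E" "(u, b) \<in> E" "(a, b) \<notin> reach S" by blast
  moreover from this(1,2) have "a = v" "b = v" using leaf by blast+
  ultimately show False by simp
qed

text \<open>The vertices of a caterpillar are ordered along the spine, each spine vertex being followed by its leaves.\<close>

lemma caterpillar_order:
  fixes P :: "'d list"
  assumes P: "distinct P" and path: "\<And>i j. i < length P \<Longrightarrow> j < length P \<Longrightarrow> (P ! i, P ! j) \<in> E \<longleftrightarrow> j = Suc i \<or> i = Suc j"
    and leaf: "\<And>u. u \<notin> set P \<Longrightarrow> \<exists>v\<in>set P. {w. (u, w) \<in> E} = {v}"
  obtains vs where "distinct vs" "set vs = UNIV"
    "\<And>S. (cut_prime S :: ('d, 'k::field) xy_poly set) \<in> minimal_primes ring_of_type_algebra bei \<Longrightarrow> contiguous vs S"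
proof -
  define sp where "sp u = (if u \<in> set P then u else (SOME v. v \<in> set P \<and> {w. (u, w) \<in> E} = {v}))" for u
  have sp_leaf: "sp u \<in> set P" "{w. (u, w) \<in> E} = {sp u}" if "u \<notin> set P" for u
  proof -
    have "\<exists>v. v \<in> set P \<and> {w. (u, w) \<in> E} = {v}" using leaf[OF that] by blast
    from someI_ex[OF this] that show "sp u \<in> set P" "{w. (u, w) \<in> E} = {sp u}"
      unfolding sp_def by auto
  qed
  have sp_P: "sp u = u" if "u \<in> set P" for u using that by (simp add: sp_def)
  have sp_in: "sp u \<in> set P" for u using sp_leaf sp_P by (cases "u \<in> set P") auto
  define idx where "idx u = (SOME k. k < length P \<and> P ! k = sp u)" for u
  have idx: "idx u < length P" "P ! idx u = sp u" for u
  proof -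
    have "\<exists>k. k < length P \<and> P ! k = sp u" using sp_in[of u] by (auto simp: in_set_conv_nth)
    from someI_ex[OF this] show "idx u < length P" "P ! idx u = sp u" unfolding idx_def by auto
  qed
  have idx_nth: "idx (P ! k) = k" if "k < length P" for k
    using idx[of "P ! k"] that nth_eq_iff_index_eq[OF P] sp_P[of "P ! k"] by simp
  have idx_eqI: "idx u = idx v" if "sp u = sp v" for u v using that by (simp add: idx_def)
  have idx_sp: "idx (sp u) = idx u" for u by (rule idx_eqI) (simp add: sp_P sp_in)
  \<comment> \<open>Only edges between neighbouring spine vertices change the index.\<close>
  have edge: "idx u = idx v \<or> (u = P ! idx u \<and> v = P ! idx v \<and> (idx v = Suc (idx u) \<or> idx u = Suc (idx v)))"
    if uv: "(u, v) \<in> E" for u v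
  proof -
    consider "u \<notin> set P" | "v \<notin> set P" | "u \<in> set P" "v \<in> set P" by blast
    thus ?thesis
    proof cases
      case 1
      hence "v = sp u" using sp_leaf(2)[of u] uv by blast
      thus ?thesis using idx_sp by simp
    next
      case 2
      hence "u = sp v" using sp_leaf(2)[of v] sym_E[OF uv] by blast
      thus ?thesis using idx_sp by simp
    next
      case 3
      hence "P ! idx u = u" "P ! idx v = v" using idx(2) sp_P by auto
      thus ?thesis using path[of "idx u" "idx v"] idx(1) uv by simp
    qed
  qed
  \<comment> \<open>Even keys belong to single spine vertices; the leaves at a spine vertex share
    the next odd key.\<close>
  define key where "key u = 2 * idx u + (if u \<in> set P then 0 else 1)" for u
  have key_P: "u = P ! k" if "key u = 2 * k" for u k
  proof -
    have "u \<in> set P" using that by (auto simp: key_def split: if_splits) presburger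
    thus ?thesis using that idx(2)[of u] sp_P[of u] by (simp add: key_def)
  qed
  obtain vs where vs: "distinct vs" "set vs = UNIV" and sorted: "\<And>i j. i \<le> j \<Longrightarrow> j < length vs \<Longrightarrow> key (vs ! i) \<le> key (vs ! j)"
    using exists_sorted_vertices[of key] by blast
  have "contiguous vs S" if min: "(cut_prime S :: ('d, 'k) xy_poly set) \<in> minimal_primes ring_of_type_algebra bei" for S
    unfolding contiguous_def
  proof (intro allI impI)
    fix i j assume ij: "i < j" "j < length vs" "(vs ! i, vs ! j) \<in> reach S"
    define a b c where "a = vs ! i" and "b = vs ! j" and "c = vs ! (j - 1)"
    have reach: "(a, b) \<in> reach S" using ij(3) by (simp add: a_def b_def)
    have "a \<noteq> b" "c \<noteq> b" using ij(1,2) nth_eq_iff_index_eq[OF vs(1)] by (auto simp: a_def b_def c_def)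
    from reach_first_step[OF reach \<open>a \<noteq> b\<close>] have aS: "a \<notin> S" by blast
    obtain w where w: "(b, w) \<in> E" "b \<notin> S" "w \<notin> S"
      using reach_first_step[OF reach_sym[OF reach]] \<open>a \<noteq> b\<close> by metis
    have keys: "key a \<le> key c" "key c \<le> key b"
      unfolding a_def b_def c_def using ij by (intro sorted; simp)+
    \<comment> \<open>c is the immediate predecessor of b, so every vertex with a smaller key than b
      stands at c or before it.\<close>
    have before: "key v \<le> key c" if "key v < key b" for v
    proof -
      obtain l where l: "l < length vs" "vs ! l = v" using vs(2) by (metis UNIV_I in_set_conv_nth)
      have "l < j"
      proof (rule ccontr)
        assume "\<not> l < j"
        hence "key b \<le> key v" using sorted[of j l] l by (simp add: b_def)
        with that show False by simp
      qed
      thus ?thesis using sorted[of l "j - 1"] ij(2) l(2) by (simp add: c_def)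
    qed
    have leaf_S: "u \<notin> S" if "u \<notin> set P" for u
      using cut_vertex_not_leaf[OF min sp_leaf(2)[OF that]] .
    have leaf_reach: "(u, sp u) \<in> reach S" if "sp u \<notin> S" for u
    proof (cases "u \<in> set P")
      case True
      thus ?thesis by (simp add: sp_P)
    next
      case False
      hence "(u, sp u) \<in> E" using sp_leaf(2) by blast
      thus ?thesis using leaf_S[OF False] that by (rule reach_edge)
    qed
    have "(c, b) \<in> reach S"
    proof (cases "b \<in> set P")
      case False
      have "w = sp b" using sp_leaf(2)[OF False] w(1) by blast
      hence spb: "sp b \<notin> S" using w(3) by simp
      have kb: "key b = 2 * idx b + 1" using False by (simp add: key_def)
      have "key (sp b) = 2 * idx b" by (simp add: key_def sp_in idx_sp)
      hence "2 * idx b \<le> key c" using before[of "sp b"] kb by simp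
      hence "idx c = idx b" using keys(2) kb by (auto simp: key_def split: if_splits)
      hence "sp c = sp b" using idx(2) by metis
      thus ?thesis using leaf_reach[of c] leaf_reach[of b] spb reach_sym reach_trans by metis
    next
      case True
      define k where "k = idx b"
      have kb: "key b = 2 * k" using True by (simp add: key_def k_def)
      have bk: "b = P ! k" using idx(2)[of b] sp_P[OF True] by (simp add: k_def)
      have kl: "k < length P" using idx(1) by (simp add: k_def)
      have "key a \<noteq> 2 * k" using key_P[of a k] bk \<open>a \<noteq> b\<close> by blast
      hence ka: "idx a < k" using keys kb by (auto simp: key_def split: if_splits)
      then obtain l where l: "k = Suc l" by (cases k) auto
      \<comment> \<open>If the preceding spine vertex were removed, the component of a could not
        pass beyond index l and would miss b.\<close>
      have ql: "P ! l \<notin> S"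
      proof
        assume q: "P ! l \<in> S"
        have "idx z \<le> l" if "(a, z) \<in> reach S" for z
          using that
        proof (induction rule: reach_induct)
          case refl
          show ?case using ka l by simp
        next
          case (step y z)
          show ?case
          proof (cases "idx y = l")
            case True
            hence "y \<noteq> P ! idx y" using q \<open>y \<notin> S\<close> by auto
            thus ?thesis using edge[OF \<open>(y, z) \<in> E\<close>] True by auto
          next
            case False
            thus ?thesis using edge[OF \<open>(y, z) \<in> E\<close>] step.IH by auto
          qed
        qed
        from this[OF reach] show False using l by (simp add: k_def)
      qed
      have "(P ! l, b) \<in> E" using path[of l k] kl l bk by simp
      hence lb: "(P ! l, b) \<in> reach S" using ql w(2) by (rule reach_edge)
      have "key (P ! l) = 2 * l" using kl l by (simp add: key_def idx_nth)
      hence "2 * l \<le> key c" using before[of "P ! l"] kb l by simp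
      moreover have "key c \<noteq> 2 * k" using key_P[of c k] bk \<open>c \<noteq> b\<close> by blast
      ultimately have "idx c = l" using keys(2) kb l by (auto simp: key_def split: if_splits)
      hence "sp c = P ! l" using idx(2)[of c] by simp
      thus ?thesis using leaf_reach[of c] ql lb reach_trans by metis
    qed
    thus "(vs ! (j - 1), vs ! j) \<in> reach S" by (simp add: b_def c_def)
  qed
  with vs that show ?thesis by blast
qed

text \<open>\<open>cut_prime {}\<close> always takes up one of the two associated primes, so there
  is room for at most one nonempty cut set.\<close>

lemma at_most_two_associated:
  assumes fin: "finite (assoc_primes ring_of_type_algebra (bei :: ('d, 'k::field) xy_poly set))"
    and card: "card (assoc_primes ring_of_type_algebra (bei :: ('d, 'k) xy_poly set)) \<le> 2"
    and S: "(cut_prime S :: ('d, 'k) xy_poly set) \<in> minimal_primes ring_of_type_algebra bei" "S \<noteq> {}"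
    and T: "(cut_prime T :: ('d, 'k) xy_poly set) \<in> minimal_primes ring_of_type_algebra bei" "T \<noteq> {}"
  shows "S = T"
proof (rule ccontr)
  assume ST: "S \<noteq> T"
  let ?A = "{cut_prime {}, cut_prime S, cut_prime T} :: ('d, 'k) xy_poly set set"
  have "?A \<subseteq> assoc_primes ring_of_type_algebra bei"
    using minimal_prime_associated[OF S(1)] minimal_prime_associated[OF T(1)]
      minimal_prime_associated[OF cut_empty_minimal] by simp
  from order_trans[OF card_mono[OF fin this] card] have "card ?A \<le> 2" .
  moreover have "(cut_prime {} :: ('d, 'k) xy_poly set) \<noteq> cut_prime S"
    "(cut_prime {} :: ('d, 'k) xy_poly set) \<noteq> cut_prime T" "(cut_prime S :: ('d, 'k) xy_poly set) \<noteq> cut_prime T"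
    using ST S(2) T(2) by (auto dest: cut_prime_inj)
  ultimately show False by simp
qed

end

lemma vwalk_arcs_nth: "Suc j < length P \<Longrightarrow> (P ! j, P ! Suc j) \<in> set (vwalk_arcs P)"
proof (induction P arbitrary: j rule: vwalk_arcs.induct)
  case (3 u v es)
  show ?case
  proof (cases j)
    case (Suc l)
    thus ?thesis using "3.IH"[of l] "3.prems" by simp
  qed simp
qed simp_all

lemma edge_graph_parcs:
  fixes G :: "'d::{finite,linorder} pair_pre_digraph"
  assumes G: "pair_graph G" and V: "pverts G = UNIV" and conn: "Digraph_Component.connected (with_proj G)"
  shows "edge_graph (parcs G)"
proof -
  interpret pair_graph G by (rule G)
  have sym: "(i, j) \<in> parcs G \<Longrightarrow> (j, i) \<in> parcs G" for i j
    by (rule symD[OF pair_sym_arcs[unfolded symmetric_def with_proj_simps]])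
  show ?thesis
  proof
    fix i j
    have "parcs (mk_symmetric G) \<subseteq> parcs G" using sym by (auto simp: parcs_mk_symmetric)
    hence "(parcs (mk_symmetric G))\<^sup>* \<subseteq> (parcs G)\<^sup>*" by (rule rtrancl_mono)
    moreover have "(i, j) \<in> rtrancl_on UNIV (parcs (mk_symmetric G))"
    proof -
      have "i \<rightarrow>\<^sup>*\<^bsub>mk_symmetric G\<^esub> j"
        using conn V unfolding connected_def strongly_connected_def by simp
      thus ?thesis using V by (simp add: reachable_def)
    qed
    hence "(i, j) \<in> (parcs (mk_symmetric G))\<^sup>*" by (rule rtrancl_on_rtranclI)
    ultimately show "(i, j) \<in> (parcs G)\<^sup>*" by (rule subsetD)
  qed (rule sym)
qed

theorem theorem1:
  fixes p :: nat
    and G :: "'d::{finite, linorder} pair_pre_digraph"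
  assumes "Factorial_Ring.prime p" and "CHAR('k::field) = p" and "F_finite TYPE('k)"
    and "pair_graph G" and "pverts G = UNIV" and "Digraph_Component.connected (with_proj G)"
    and "complete_multipartite G
       \<or> caterpillar G
       \<or> (finite (assoc_primes ring_of_type_algebra (binomial_edge_ideal TYPE('k) G)) \<and>
          card (assoc_primes ring_of_type_algebra (binomial_edge_ideal TYPE('k) G)) \<le> 2)
       \<or> (traceable G \<and> unmixed ring_of_type_algebra (binomial_edge_ideal TYPE('k) G))"
  shows "symbolic_F_split p (binomial_edge_ideal TYPE('k) G)"
proof -
  interpret edge_graph "parcs G" by (rule edge_graph_parcs[OF assms(4-6)])
  have J: "binomial_edge_ideal TYPE('k) G = (bei :: ('d, 'k) xy_poly set)"
    by (simp add: binomial_edge_ideal_def bei_def Idl_eq minor_def x_var_eq y_var_eq)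
  let ?min = "\<lambda>S. (cut_prime S :: ('d, 'k) xy_poly set) \<in> minimal_primes ring_of_type_algebra bei"
  have by_order: "symbolic_F_split p (binomial_edge_ideal TYPE('k) G)"
    if vs: "distinct vs" "set vs = UNIV" and cont: "\<And>S. ?min S \<Longrightarrow> contiguous vs S" for vs
    unfolding J
    by (rule symbolic_F_split_bei[OF assms(1,2) vs]) (intro contiguous_path_poly[OF vs] cont)
  from assms(7) show ?thesis
  proof (elim disjE conjE)
    assume "complete_multipartite G"
    then obtain \<V> where part: "partition_on UNIV \<V>" and inner: "\<forall>A\<in>\<V>. \<forall>u\<in>A. \<forall>v\<in>A. (u, v) \<notin> parcs G"
      and outer: "\<forall>A\<in>\<V>. \<forall>B\<in>\<V>. A \<noteq> B \<longrightarrow> (\<forall>u\<in>A. \<forall>v\<in>B. (u, v) \<in> parcs G)"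
      unfolding complete_multipartite_def assms(5) by (elim exE conjE) (rule that)
    have "contiguous vs S" if "?min S" "distinct vs" for vs S
      by (rule multipartite_contiguous[OF part _ _ that]) (use inner outer in simp_all)
    thus ?thesis
      by (intro by_order[of "sorted_list_of_set UNIV"]) simp_all
  next
    assume "caterpillar G"
    then obtain P where P: "vpath P (with_proj G)"
      and path: "\<forall>i<length P. \<forall>j<length P. (P ! i, P ! j) \<in> parcs G \<longleftrightarrow> j = Suc i \<or> i = Suc j"
      and leaf: "\<forall>u \<in> pverts G - set P. \<exists>v \<in> set P - {hd P, last P}. {w. (u, w) \<in> parcs G} = {v}"
      unfolding caterpillar_def by (elim exE conjE) (rule that)
    have "distinct P" using P by (simp add: vpath_def)
    moreover have "(P ! i, P ! j) \<in> parcs G \<longleftrightarrow> j = Suc i \<or> i = Suc j" if "i < length P" "j < length P" for i j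
      using path that by simp
    moreover have "\<exists>v\<in>set P. {w. (u, w) \<in> parcs G} = {v}" if "u \<notin> set P" for u
    proof -
      have "u \<in> pverts G - set P" using that assms(5) by simp
      from bspec[OF leaf this] show ?thesis by (elim bexE) (rule bexI, auto)
    qed
    ultimately show ?thesis
    proof (rule caterpillar_order[where 'k = 'k])
      fix vs assume "distinct vs" "set vs = UNIV" "\<And>S. ?min S \<Longrightarrow> contiguous vs S"
      thus ?thesis by (rule by_order)
    qed
  next
    assume fin: "finite (assoc_primes ring_of_type_algebra (binomial_edge_ideal TYPE('k) G))"
      and card: "card (assoc_primes ring_of_type_algebra (binomial_edge_ideal TYPE('k) G)) \<le> 2"
    \<comment> \<open>The only possible nonempty cut set; sorting by its labels makes its components
      intervals. If there is none, \<open>S0\<close> is arbitrary and only the empty set, contiguous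
      in any ordering, has to be considered.\<close>
    define S0 where "S0 = (SOME S. ?min S \<and> S \<noteq> {})"
    have S0: "S = S0" if S: "?min S" "S \<noteq> {}" for S
    proof -
      have "?min S0 \<and> S0 \<noteq> {}" unfolding S0_def by (rule someI[of _ S]) (use S in simp)
      thus ?thesis using at_most_two_associated[OF fin[unfolded J] card[unfolded J] S] by simp
    qed
    obtain vs where vs: "distinct vs" "set vs = UNIV"
      and sorted: "\<And>i j. i \<le> j \<Longrightarrow> j < length vs \<Longrightarrow> lab S0 (vs ! i) \<le> lab S0 (vs ! j)"
      using exists_sorted_vertices[of "lab S0"] by blast
    have "contiguous vs S" if "?min S" for S
    proof (cases "S = {}")
      case True
      thus ?thesis by (simp only: contiguous_empty)
    next
      case False
      with that have "S = S0" by (rule S0)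
      thus ?thesis using contiguous_label_sorted[OF is_lab_lab sorted] by simp
    qed
    with vs show ?thesis by (rule by_order)
  next
    assume "traceable G" and unm: "unmixed ring_of_type_algebra (binomial_edge_ideal TYPE('k) G)"
    then obtain P where P: "vpath P (with_proj G)" "set P = UNIV"
      unfolding traceable_def assms(5) by (elim exE conjE) (rule that)
    have dist: "distinct P" using P(1) by (simp add: vpath_def)
    have len: "length P = card (UNIV :: 'd set)" using distinct_card[OF dist] P(2) by simp
    have edges: "(P ! j, P ! Suc j) \<in> parcs G" if "Suc j < length P" for j
      using vwalk_arcs_nth[OF that] P(1) by (auto simp: vpath_def vwalk_def)
    show ?thesis
      unfolding J
    proof (rule symbolic_F_split_bei[OF assms(1,2) dist P(2)])
      fix S assume "?min S"
      from unmixed_cut_le[OF unm[unfolded J] this is_lab_lab]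
      have "2 * card S + card {i. lab S i \<noteq> i} \<le> length P - 1" by (simp add: len)
      from ipow_antimono[OF is_prime_ideal[OF is_prime_cut] this]
        edge_path_poly[OF edges is_prime_ideal[OF is_prime_cut] bei_subset_cut]
      have "(path_poly P :: ('d, 'k) xy_poly) \<in> ipow (cut_prime S) (2 * card S + card {i. lab S i \<noteq> i})"
        by (rule subsetD)
      with is_lab_lab show "\<exists>r. is_lab S r \<and> (path_poly P :: ('d, 'k) xy_poly) \<in> ipow (cut_prime S) (2 * card S + card {i. r i \<noteq> i})"
        by blast
    qed
  qed
qed

end
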